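(* Let $K_0\in\mathbb{K}$ with $J(K_0)=\alpha$, and suppose $X_0\succ0$. Let $L$ be the constant defined in the context (with this $\alpha$), let $0<\eta\le\mu\sigma_{\min}(C)^2/L$, and let $(K_i)_{i\ge0}$ be generated by the natural policy gradient method $$K_{i+1}=K_i-\eta\nabla^{\mathrm{NA}}J(K_i),\qquad \nabla^{\mathrm{NA}}J(K):=\nabla J(K)\mathcal{L}_K^{-1}.$$ Then: (i) $J(K_i)$ is monotonically diminishing in $i$, i.e. $J(K_{i+1})\le J(K_i)$ for all $i$ (so $K_i\in\mathbb{K}_\alpha\subseteq\mathbb{K}$ for all $i$, i.e. every $K_i$ is stabilizing). (ii) For every $\epsilon>0$, an $\epsilon$-stationary point, i.e. an iterate $K_i$ with $\|\nabla^{\mathrm{NA}}J(K_i)\|_F\le\epsilon$, is reached within $$\frac{2\alpha}{\eta\mu\sigma_{\min}(C)^2\epsilon^2}$$ iterations. (iii) If $d=n$ and $C$ has rank $n$, then for every $\epsilon_J>0$ the iterate $K_N$ satisfies $J(K_N)-J_s^\star\le\epsilon_J$ whenever $$N\ge\frac{\|\Sigma_{K^\star}\|}{2\eta\mu\sigma_{\min}(R)}\log\left(\frac{J(K_0)-J_s^\star}{\epsilon_J}\right).$$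
   Context: Setting (static output feedback, SOF). $A\in\mathbb{R}^{n\times n}$, $B\in\mathbb{R}^{n\times m}$, $C\in\mathbb{R}^{d\times n}$; $(A,B)$ is controllable, $(C,A)$ is observable, and $C$ has linearly independent rows. $Q\in\mathbb{R}^{n\times n}$ and $R\in\mathbb{R}^{m\times m}$ are symmetric positive definite. $\mathcal{D}$ is a probability distribution on $\mathbb{R}^n$ with $X_0:=\mathbb{E}_{x_0\sim\mathcal{D}}[x_0x_0^\top]\succ 0$, and $\mu:=\sigma_{\min}(X_0)>0$. For $K\in\mathbb{R}^{m\times d}$ put $\mathcal{A}_K:=A-BKC$. The set of stabilizing gains is $\mathbb{K}:=\{K\in\mathbb{R}^{m\times d}:\rho(\mathcal{A}_K)<1\}$ ($\rho$ is the spectral radius), assumed nonempty. For $K\in\mathbb{K}$, $$J(K):=\mathbb{E}_{x_0\sim\mathcal{D}}\Big[\sum_{t=0}^\infty x_t^\top(Q+C^\top K^\top RKC)x_t\Big],\quad x_{t+1}=\mathcal{A}_Kx_t,\qquad \Sigma_K:=\mathbb{E}_{x_0\sim\mathcal{D}}\sum_{t=0}^\infty x_tx_t^\top,$$ and $\mathcal{L}_K:=C\Sigma_KC^\top$. Equivalently $J(K)=\mathrm{Tr}(P_KX_0)=\mathrm{Tr}((Q+C^\top K^\top RKC)\Sigma_K)$, where $P_K=Q+C^\top K^\top RKC+\mathcal{A}_K^\top P_K\mathcal{A}_K$ and $\Sigma_K=X_0+\mathcal{A}_K\Sigma_K\mathcal{A}_K^\top$. $K^\star$ is a global minimizer of $J$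 over $\mathbb{K}$. $\mathbb{K}_\alpha:=\{K\in\mathbb{K}: J(K)\le\alpha\}$. $\nabla J(K)\in\mathbb{R}^{m\times d}$ is the gradient with respect to the entries of $K$. $J_s^\star$ is the globally optimal cost of the corresponding full-state-feedback LQR problem, i.e. the minimum of $\mathbb{E}_{x_0\sim\mathcal{D}}[\sum_{t\ge0}(x_t^\top Qx_t+u_t^\top Ru_t)]$ with $x_{t+1}=Ax_t+Bu_t$, $u_t=-K_sx_t$, over all $K_s\in\mathbb{R}^{m\times n}$ with $\rho(A-BK_s)<1$. Constants: $$L=\frac{2\alpha}{\sigma_{\min}(Q)}\left(\|R\|+\frac{\alpha}{\mu}\Big(1+\frac{2\zeta_1}{\|B\|\|C\|}\Big)\|B\|^2\right)\|C\|^2,$$ $$\zeta_1=\frac{1}{\sigma_{\min}(Q)}\left(\frac{\alpha}{\mu}(1+\|B\|^2\|C\|^2)+\|R\|\|C\|^2\right)-1 .$$ Notation: $\|\cdot\|$ is the induced 2-norm, $\|\cdot\|_F$ the Frobenius norm, $\sigma_{\min}$ the minimal singular value (for $C\in\mathbb{R}^{d\times n}$ with independent rows, $\sigma_{\min}(C)=\sqrt{\lambda_{\min}(CC^\top)}>0$). *)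

theory Defs
  imports "HOL-Probability.Probability"
begin

definition sym_posdef :: "real^'n^'n \<Rightarrow> bool" where
  "sym_posdef M \<longleftrightarrow> transpose M = M \<and> (\<forall>x. x \<noteq> 0 \<longrightarrow> 0 < x \<bullet> (M *v x))"

definition complex_spectrum :: "real^'n^'n \<Rightarrow> complex set" where
  "complex_spectrum M =
     {l. \<exists>v::complex^'n. v \<noteq> 0 \<and> map_matrix complex_of_real M *v v = l *s v}"

definition spec_radius :: "real^'n^'n \<Rightarrow> real" where
  "spec_radius M = Max (cmod ` complex_spectrum M)"

definition real_spectrum :: "real^'n^'n \<Rightarrow> real set" where
  "real_spectrum M = {l. \<exists>v. v \<noteq> 0 \<and> M *v v = l *s v}"

text \<open>
  Minimal singular value of a matrix with at most as many rows as columns; it is applied only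
  to square matrices and to the wide matrix \<open>C\<close>.
\<close>

definition sigma_min :: "real^'n^'m \<Rightarrow> real" where
  "sigma_min M = sqrt (Min (real_spectrum (M ** transpose M)))"

definition op_norm :: "real^'n^'m \<Rightarrow> real" where
  "op_norm M = onorm (\<lambda>x. M *v x)"

definition outer :: "real^'n \<Rightarrow> real^'n \<Rightarrow> real^'n^'n" where
  "outer x y = (\<chi> i j. x $ i * y $ j)"

primrec mat_pow :: "real^'n^'n \<Rightarrow> nat \<Rightarrow> real^'n^'n" where
  "mat_pow M 0 = mat 1"
| "mat_pow M (Suc k) = M ** mat_pow M k"

text \<open>
  Independence of the family of rows; the set \<open>rows M\<close> would identify repeated rows.
\<close>

definition independent_rows :: "real^'n^'m \<Rightarrow> bool" where
  "independent_rows M \<longleftrightarrow>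
     (\<forall>c. (\<Sum>i\<in>UNIV. c i *\<^sub>R row i M) = 0 \<longrightarrow> (\<forall>i. c i = 0))"

text \<open>
  The dimensions below are the ranks of the block matrices with columns
  \<open>B, AB, \<dots>\<close> and with rows \<open>C, CA, \<dots>\<close>, where the exponents are less than \<open>n\<close>.
\<close>

definition controllable :: "real^'n^'n \<Rightarrow> real^'m^'n \<Rightarrow> bool" where
  "controllable A B \<longleftrightarrow>
     dim (\<Union>k<CARD('n). columns (mat_pow A k ** B)) = CARD('n)"

definition observable :: "real^'n^'d \<Rightarrow> real^'n^'n \<Rightarrow> bool" where
  "observable C A \<longleftrightarrow>
     dim (\<Union>k<CARD('n). rows (C ** mat_pow A k)) = CARD('n)"

primrec traj :: "real^'n^'n \<Rightarrow> real^'n \<Rightarrow> nat \<Rightarrow> real^'n" where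
  "traj M x0 0 = x0"
| "traj M x0 (Suc t) = M *v traj M x0 t"

definition closed_loop ::
  "real^'n^'n \<Rightarrow> real^'m^'n \<Rightarrow> real^'n^'d \<Rightarrow> real^'d^'m \<Rightarrow> real^'n^'n" where
  "closed_loop A B C K = A - B ** K ** C"

definition stabilizing ::
  "real^'n^'n \<Rightarrow> real^'m^'n \<Rightarrow> real^'n^'d \<Rightarrow> (real^'d^'m) set" where
  "stabilizing A B C = {K. spec_radius (closed_loop A B C K) < 1}"

text \<open>
  A Bochner integral of a non-integrable function is \<open>0\<close>, so positive definiteness of
  this matrix already entails that the second moments of \<open>D\<close> are finite.
\<close>

definition init_corr :: "(real^'n) measure \<Rightarrow> real^'n^'n" where
  "init_corr D = (LINT x0|D. outer x0 x0)"

text \<open>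
  The cost and the state correlation matrix are meaningful for stabilizing \<open>K\<close> only.
\<close>

definition sof_cost ::
  "real^'n^'n \<Rightarrow> real^'m^'n \<Rightarrow> real^'n^'d \<Rightarrow> real^'n^'n \<Rightarrow> real^'m^'m \<Rightarrow>
     (real^'n) measure \<Rightarrow> real^'d^'m \<Rightarrow> real" where
  "sof_cost A B C Q R D K =
     (LINT x0|D. (\<Sum>t. let x = traj (closed_loop A B C K) x0 t in
        x \<bullet> ((Q + transpose C ** transpose K ** R ** K ** C) *v x)))"

definition state_corr ::
  "real^'n^'n \<Rightarrow> real^'m^'n \<Rightarrow> real^'n^'d \<Rightarrow> (real^'n) measure \<Rightarrow> real^'d^'m \<Rightarrow> real^'n^'n" where
  "state_corr A B C D K =
     (LINT x0|D. (\<Sum>t. let x = traj (closed_loop A B C K) x0 t in outer x x))"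

definition output_corr ::
  "real^'n^'n \<Rightarrow> real^'m^'n \<Rightarrow> real^'n^'d \<Rightarrow> (real^'n) measure \<Rightarrow> real^'d^'m \<Rightarrow> real^'d^'d" where
  "output_corr A B C D K = C ** state_corr A B C D K ** transpose C"

definition sublevel ::
  "real^'n^'n \<Rightarrow> real^'m^'n \<Rightarrow> real^'n^'d \<Rightarrow> real^'n^'n \<Rightarrow> real^'m^'m \<Rightarrow>
     (real^'n) measure \<Rightarrow> real \<Rightarrow> (real^'d^'m) set" where
  "sublevel A B C Q R D \<alpha> = {K \<in> stabilizing A B C. sof_cost A B C Q R D K \<le> \<alpha>}"

text \<open>
  The inner product on matrices is the entrywise (Frobenius) one, so this is the matrix of
  partial derivatives with respect to the entries, and \<open>norm\<close> is the Frobenius norm.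
\<close>

definition gradient :: "(real^'d^'m \<Rightarrow> real) \<Rightarrow> real^'d^'m \<Rightarrow> real^'d^'m" where
  "gradient f K = (THE G. GDERIV f K :> G)"

definition natural_gradient ::
  "real^'n^'n \<Rightarrow> real^'m^'n \<Rightarrow> real^'n^'d \<Rightarrow> real^'n^'n \<Rightarrow> real^'m^'m \<Rightarrow>
     (real^'n) measure \<Rightarrow> real^'d^'m \<Rightarrow> real^'d^'m" where
  "natural_gradient A B C Q R D K =
     gradient (sof_cost A B C Q R D) K ** matrix_inv (output_corr A B C D K)"

definition state_feedback_cost ::
  "real^'n^'n \<Rightarrow> real^'m^'n \<Rightarrow> real^'n^'n \<Rightarrow> real^'m^'m \<Rightarrow>
     (real^'n) measure \<Rightarrow> real^'n^'m \<Rightarrow> real" where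
  "state_feedback_cost A B Q R D Ks =
     (LINT x0|D. (\<Sum>t. let x = traj (A - B ** Ks) x0 t; u = - (Ks *v x) in
        x \<bullet> (Q *v x) + u \<bullet> (R *v u)))"

text \<open>
  The minimal full-state cost, written as an infimum so that attainment is not presupposed.
\<close>

definition lqr_opt_cost ::
  "real^'n^'n \<Rightarrow> real^'m^'n \<Rightarrow> real^'n^'n \<Rightarrow> real^'m^'m \<Rightarrow> (real^'n) measure \<Rightarrow> real" where
  "lqr_opt_cost A B Q R D =
     (INF Ks \<in> {Ks. spec_radius (A - B ** Ks) < 1}. state_feedback_cost A B Q R D Ks)"

definition zeta1 ::
  "real^'m^'n \<Rightarrow> real^'n^'d \<Rightarrow> real^'n^'n \<Rightarrow> real^'m^'m \<Rightarrow> real \<Rightarrow> real \<Rightarrow> real" where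
  "zeta1 B C Q R \<mu> \<alpha> =
     1 / sigma_min Q * (\<alpha> / \<mu> * (1 + (op_norm B)\<^sup>2 * (op_norm C)\<^sup>2) + op_norm R * (op_norm C)\<^sup>2) - 1"

definition smooth_const ::
  "real^'m^'n \<Rightarrow> real^'n^'d \<Rightarrow> real^'n^'n \<Rightarrow> real^'m^'m \<Rightarrow> real \<Rightarrow> real \<Rightarrow> real" where
  "smooth_const B C Q R \<mu> \<alpha> =
     2 * \<alpha> / sigma_min Q *
       (op_norm R + \<alpha> / \<mu> * (1 + 2 * zeta1 B C Q R \<mu> \<alpha> / (op_norm B * op_norm C)) * (op_norm B)\<^sup>2)
       * (op_norm C)\<^sup>2"

end

theory Submission
  imports Defs "HOL-Computational_Algebra.Fundamental_Theorem_Algebra"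
begin

text \<open>
  For a stabilizing gain \<open>K\<close> the cost is the pairing of \<open>X\<^sub>0\<close> with the solution \<open>P\<close> of a discrete
  Lyapunov equation, and the Lyapunov solution operator can be differentiated implicitly. This
  gives the gradient \<open>2 E\<^sub>K \<Sigma> C\<^sup>T\<close> and the second derivative of the cost along a line. The first
  derivative of \<open>P\<close> in a unit direction lies between \<open>- \<zeta>\<^sub>1 P\<close> and \<open>\<zeta>\<^sub>1 P\<close>, which bounds the second
  derivative of the cost on the \<open>\<alpha>\<close>-sublevel set by \<open>L\<close>. Since \<open>P\<close> stays a Lyapunov function for
  nearby gains, uniformly on the sublevel set, a step cannot leave the sublevel set, and every step
  decreases the cost by at least \<open>\<eta> \<mu> \<sigma>\<^sub>m\<^sub>i\<^sub>n(C)\<^sup>2 / 2\<close> times the squared norm of the natural gradient.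

  If \<open>C\<close> is invertible, the step changes \<open>K C\<close> by \<open>- 2 \<eta> E\<^sub>K\<close>. The exact formula for cost differences
  then bounds the decrease from below and the optimality gap from above by multiples of the squared
  norm of \<open>E\<^sub>K\<close>, so the gap contracts geometrically.
\<close>

section \<open>Spectral radius and powers\<close>

text \<open>The spectral radius enters the analysis through two facts: a value below
  \<open>1\<close> gives geometric decay of the powers, and a quadratic form that strictly decreases
  along the dynamics gives back a value below \<open>1\<close>. The cost carries no information at
  non-stabilizing gains, and the sublevel set need not be convex. Each segment therefore has to be
  followed from its starting point, and a radius of stability that depends on the level
  \<open>\<alpha>\<close> but not on the gain takes the place of compactness. The constants record
  how large the data can get on one sublevel set: \<open>\<alpha> / sigma_min Q\<close> bounds the
  trace of \<open>\<Sigma>\<close>, \<open>\<alpha> / \<mu>\<close> bounds \<open>P\<close>, and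
  \<open>\<mu> * (sigma_min C)\<^sup>2\<close> is a floor under the output correlation. The floor
  turns the pairing of natural gradient and gradient into the squared norm of the natural gradient,
  which is why the step size is measured against it.\<close>

lemma nontrivial_relation:
  fixes w :: "nat \<Rightarrow> 'a::euclidean_space"
  obtains c N where "\<exists>k\<le>N. c k \<noteq> 0" "(\<Sum>k\<le>N. c k *\<^sub>R w k) = 0"
proof (cases "inj_on w {..DIM('a)}")
  case True
  then have "card (w ` {..DIM('a)}) > DIM('a)"
    by (simp add: card_image)
  then have "dependent (w ` {..DIM('a)})"
    using dependent_biggerset by blast
  then obtain u where u: "\<exists>v\<in>w ` {..DIM('a)}. u v \<noteq> 0" "(\<Sum>v\<in>w ` {..DIM('a)}. u v *\<^sub>R v) = 0"
    by (auto simp: dependent_finite)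
  then have "(\<Sum>k\<le>DIM('a). u (w k) *\<^sub>R w k) = 0"
    using True by (simp add: sum.reindex)
  with u(1) show ?thesis
    by (intro that[of "DIM('a)" "u \<circ> w"]) auto
next
  case False
  then obtain i j where ij: "i \<le> DIM('a)" "j \<le> DIM('a)" "w i = w j" "i \<noteq> j"
    by (auto simp: inj_on_def)
  \<comment> \<open>A repetition in the sequence is a relation by itself: coefficient
    \<open>1\<close> at \<open>i\<close> and \<open>-1\<close> at \<open>j\<close>.\<close>
  let ?c = "\<lambda>k. (if k = i then 1 else 0) - (if k = j then 1 else 0::real)"
  have "(\<Sum>k\<le>DIM('a). ?c k *\<^sub>R w k) = (\<Sum>k\<le>DIM('a). (if k = i then w k else 0) - (if k = j then w k else 0))"
    by (intro sum.cong) auto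
  also have "\<dots> = 0"
    using ij by (simp add: sum_subtractf)
  finally show ?thesis
    using ij by (intro that[of "DIM('a)" ?c]) auto
qed

text \<open>This is \<open>p(M) v\<close>, evaluated by Horner's scheme; acting on a vector keeps
  everything in terms of matrix-vector products.\<close>

definition poly_act :: "complex^'n^'n \<Rightarrow> complex poly \<Rightarrow> complex^'n \<Rightarrow> complex^'n" where
  "poly_act M p v = fold_coeffs (\<lambda>a w. a *s v + M *v w) p 0"

lemma poly_act_0 [simp]: "poly_act M 0 v = 0"
  by (simp add: poly_act_def)

lemma poly_act_pCons [simp]: "poly_act M (pCons a p) v = a *s v + M *v poly_act M p v"
  by (cases "a = 0 \<and> p = 0") (auto simp: poly_act_def)

lemma poly_act_add: "poly_act M (p + q) v = poly_act M p v + poly_act M q v"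
  by (induction p q rule: poly_induct2)
    (simp_all add: vec.scale_left_distrib matrix_vector_right_distrib)

lemma poly_act_smult: "poly_act M (smult c p) v = c *s poly_act M p v"
  by (induction p) (simp_all add: vec.scale_right_distrib vector_scalar_commute vec.scale_scale)

lemma poly_act_sum: "poly_act M (sum f S) v = (\<Sum>k\<in>S. poly_act M (f k) v)"
  by (induction S rule: infinite_finite_induct) (simp_all add: poly_act_add)

lemma poly_act_monom: "poly_act M (monom c k) v = c *s (((*v) M ^^ k) v)"
  by (induction k) (simp_all add: monom_0 monom_Suc vector_scalar_commute)

lemma poly_act_vec_diff: "poly_act M p (u - v) = poly_act M p u - poly_act M p v"
  by (induction p) (simp_all add: vec.scale_right_diff_distrib matrix_vector_mult_diff_distrib)

lemma poly_act_vec_scale: "poly_act M p (c *s v) = c *s poly_act M p v"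
  by (induction p) (simp_all add: vec.scale_right_distrib vector_scalar_commute vec.scale_scale mult.commute)

lemma poly_act_vec_mult: "poly_act M p (M *v v) = M *v poly_act M p v"
  by (induction p) (simp_all add: matrix_vector_right_distrib vector_scalar_commute)

lemma poly_act_factor:
  "poly_act M ([:- l, 1:] * p) v = M *v poly_act M p v - l *s poly_act M p v"
proof -
  have "[:- l, 1:] * p = smult (- l) p + pCons 0 p"
    by simp
  then show ?thesis
    by (simp only: poly_act_add poly_act_smult) simp
qed

lemma poly_act_eigenvector:
  assumes "M *v v = l *s v"
  shows "poly_act M p v = poly p l *s v"
  using assms
  by (induction p) (simp_all add: vector_scalar_commute vec.scale_left_distrib vec.scale_scale mult.commute)

text \<open>The powers of \<open>M\<close> live in a real vector space of finite dimension, so some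
  nontrivial real combination of them vanishes; its coefficients form the polynomial.\<close>

lemma exists_annihilating_poly:
  fixes M :: "complex^'n^'n"
  shows "\<exists>p. p \<noteq> 0 \<and> (\<forall>v. poly_act M p v = 0)"
proof -
  obtain c N where cN: "\<exists>k\<le>N. c k \<noteq> 0" "(\<Sum>k\<le>N. c k *\<^sub>R ((**) M ^^ k) (mat 1)) = (0::complex^'n^'n)"
    by (rule nontrivial_relation)
  define p where "p = (\<Sum>k\<le>N. monom (complex_of_real (c k)) k)"
  have pow: "((*v) M ^^ k) v = ((**) M ^^ k) (mat 1) *v v" for k v
    by (induction k) (simp_all add: matrix_vector_mul_assoc)
  have "coeff p k = complex_of_real (c k)" if "k \<le> N" for k
    using that by (simp add: p_def coeff_sum)
  with cN(1) have "p \<noteq> 0"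
    by force
  moreover have "poly_act M p v = 0" for v
  proof -
    have lin: "linear (\<lambda>X::complex^'n^'n. X *v v)"
      by (simp add: linear_iff vec_eq_iff matrix_vector_mult_def scaleR_sum_right sum.distrib
          distrib_right)
    have "poly_act M p v = (\<Sum>k\<le>N. c k *\<^sub>R (((**) M ^^ k) (mat 1) *v v))"
      unfolding p_def poly_act_sum poly_act_monom pow
      by (intro sum.cong refl) (simp only: vec_eq_iff vector_scaleR_component
          vector_smult_component, simp add: scaleR_conv_of_real)
    also have "\<dots> = (\<Sum>k\<le>N. c k *\<^sub>R ((**) M ^^ k) (mat 1)) *v v"
      by (simp add: linear_sum[OF lin] linear_scale[OF lin])
    finally show ?thesis
      by (simp add: cN(2))
  qed
  ultimately show ?thesis
    by blast
qed

section \<open>Complex spectrum of a real matrix and growth of its powers\<close>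

abbreviation complexify :: "real^'n^'n \<Rightarrow> complex^'n^'n" where
  "complexify M \<equiv> map_matrix complex_of_real M"

text \<open>Every eigenvalue is a root of an annihilating polynomial. Finiteness is what makes
  \<open>Max\<close> in the spectral radius an upper bound for all eigenvalue moduli.\<close>

lemma finite_complex_spectrum: "finite (complex_spectrum M)"
proof -
  obtain p where p: "p \<noteq> 0" "\<And>v. poly_act (complexify M) p v = 0"
    using exists_annihilating_poly[of "complexify M"] by blast
  have "complex_spectrum M \<subseteq> {l. poly p l = 0}"
  proof
    fix l assume "l \<in> complex_spectrum M"
    then obtain v where v: "v \<noteq> 0" "complexify M *v v = l *s v"
      by (auto simp: complex_spectrum_def)
    then show "l \<in> {l. poly p l = 0}"
      using p(2)[of v] poly_act_eigenvector[OF v(2), of p] by (simp add: vec.scale_eq_0_iff)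
  qed
  then show ?thesis
    using poly_roots_finite[OF p(1)] finite_subset by blast
qed

text \<open>
  If \<open>p(M) v = 0\<close>, split a root off \<open>p\<close>: a root that is not an eigenvalue can be cancelled,
  and an eigenvalue \<open>l\<close> turns the orbit of \<open>v\<close> into a scalar recursion with ratio \<open>l\<close>,
  driven by the orbit of \<open>(M - l) v\<close>.
\<close>

lemma geometric_orbit:
  fixes M :: "complex^'n^'n"
  assumes eig: "\<And>l v. v \<noteq> 0 \<Longrightarrow> M *v v = l *s v \<Longrightarrow> cmod l < r"
    and "p \<noteq> 0" "poly_act M p v = 0"
  shows "\<exists>c. \<forall>k. norm (((*v) M ^^ k) v) \<le> c * r ^ k"
  using assms(2,3)
proof (induction "degree p" arbitrary: p v rule: less_induct)
  case less
  show ?case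
  proof (cases "degree p = 0")
    case True
    then obtain a where "p = [:a:]"
      using degree_eq_zeroE by blast
    with less.prems have "v = 0"
      by (simp add: vec.scale_eq_0_iff)
    then have "((*v) M ^^ k) v = 0" for k
      by (induction k) auto
    then show ?thesis
      by (intro exI[of _ 0]) auto
  next
    case False
    then obtain l where "poly p l = 0"
      using fundamental_theorem_of_algebra[of p] constant_degree[of p] by auto
    then obtain q where q: "p = [:- l, 1:] * q"
      by (auto simp: poly_eq_0_iff_dvd elim: dvdE)
    have "q \<noteq> 0"
      using q less.prems by auto
    have deg: "degree q < degree p"
      using \<open>q \<noteq> 0\<close> unfolding q by (subst degree_mult_eq) auto
    have Mq: "M *v poly_act M q v = l *s poly_act M q v"
      using less.prems(2) unfolding q poly_act_factor by simp
    show ?thesis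
    proof (cases "poly_act M q v = 0")
      case True
      then show ?thesis
        using less.hyps[OF deg \<open>q \<noteq> 0\<close>] by blast
    next
      case False
      then have l: "cmod l < r"
        using eig Mq by blast
      have "poly_act M q (M *v v - l *s v) = 0"
        using Mq by (simp add: poly_act_vec_diff poly_act_vec_mult poly_act_vec_scale)
      then obtain c where c: "\<And>k. norm (((*v) M ^^ k) (M *v v - l *s v)) \<le> c * r ^ k"
        using less.hyps[OF deg \<open>q \<noteq> 0\<close>] by blast
      have pow_diff: "((*v) M ^^ k) (M *v v - l *s v) = ((*v) M ^^ Suc k) v - l *s ((*v) M ^^ k) v" for k
        by (induction k) (simp_all add: matrix_vector_mult_diff_distrib vector_scalar_commute)
      \<comment> \<open>Chosen to close the induction: \<open>c + cmod l * c' \<le> r * c'\<close>,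
        and \<open>norm v \<le> c'\<close> for the start.\<close>
      define c' where "c' = max (norm v) (c / (r - cmod l))"
      have "r > 0"
        using l by (meson norm_ge_zero le_less_trans)
      have "c \<le> (r - cmod l) * c'"
        using l by (simp add: c'_def max_def field_simps)
      have norm_scale: "norm (a *s x) = cmod a * norm x" for a and x :: "complex^'n"
        by (simp add: norm_vec_def norm_mult L2_set_right_distrib)
      have "norm (((*v) M ^^ k) v) \<le> c' * r ^ k" for k
      proof (induction k)
        case (Suc k)
        have "norm (((*v) M ^^ Suc k) v)
            \<le> norm (((*v) M ^^ Suc k) v - l *s ((*v) M ^^ k) v) + norm (l *s ((*v) M ^^ k) v)"
          by (metis diff_add_cancel norm_triangle_ineq)
        also have "\<dots> \<le> c * r ^ k + cmod l * (c' * r ^ k)"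
          using c[of k] Suc unfolding pow_diff norm_scale by (intro add_mono mult_left_mono) auto
        also have "\<dots> \<le> (r - cmod l) * c' * r ^ k + cmod l * (c' * r ^ k)"
          using \<open>c \<le> _\<close> \<open>r > 0\<close> by (intro add_right_mono mult_right_mono) auto
        finally show ?case
          by (simp add: algebra_simps)
      qed (simp add: c'_def)
      then show ?thesis
        by blast
    qed
  qed
qed

lemma complexify_vec:
  "complexify M *v (\<chi> i. complex_of_real (x $ i)) = (\<chi> i. complex_of_real ((M *v x) $ i))"
  by (simp add: vec_eq_iff matrix_vector_mult_def map_matrix_def)

lemma mat_pow_vec_Suc: "mat_pow M (Suc k) *v x = M *v (mat_pow M k *v x)"
  by (simp add: matrix_vector_mul_assoc)

lemma complexify_pow_vec:
  "((*v) (complexify M) ^^ k) (\<chi> i. complex_of_real (x $ i))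
     = (\<chi> i. complex_of_real ((mat_pow M k *v x) $ i))"
  by (induction k) (simp_all add: complexify_vec matrix_vector_mul_assoc del: mat_pow.simps(2)
      add: mat_pow_vec_Suc)

lemma geometric_mat_pow:
  fixes M :: "real^'n^'n"
  assumes "spec_radius M < 1"
  obtains c r where "0 \<le> c" "0 < r" "r < 1" "\<And>k. norm (mat_pow M k) \<le> c * r ^ k"
proof -
  \<comment> \<open>The midpoint between the spectral radius and \<open>1\<close>; the maximum with
    \<open>1/2\<close> secures \<open>0 < r\<close> whatever the sign of the spectral
    radius.\<close>
  define r where "r = max (1/2) ((1 + spec_radius M) / 2)"
  have r: "0 < r" "r < 1" "spec_radius M < r"
    using assms by (auto simp: r_def max_def)
  have eig: "cmod l < r" if "v \<noteq> 0" "complexify M *v v = l *s v" for l v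
  proof -
    have "l \<in> complex_spectrum M"
      using that by (auto simp: complex_spectrum_def)
    then have "cmod l \<le> spec_radius M"
      unfolding spec_radius_def using finite_complex_spectrum[of M] by (intro Max_ge) auto
    with r show ?thesis by simp
  qed
  obtain p where p: "p \<noteq> 0" "\<And>v. poly_act (complexify M) p v = 0"
    using exists_annihilating_poly[of "complexify M"] by blast
  have "\<exists>c. \<forall>k. norm (mat_pow M k *v x) \<le> c * r ^ k" for x
  proof -
    obtain c where c: "\<And>k. norm (((*v) (complexify M) ^^ k) (\<chi> i. complex_of_real (x $ i))) \<le> c * r ^ k"
      using geometric_orbit[where M = "complexify M" and r = r, OF _ p] eig by blast
    have "norm (\<chi> i. complex_of_real (y $ i)) = norm y" for y :: "real^'n"
      by (simp add: norm_vec_def)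
    then show ?thesis
      using c unfolding complexify_pow_vec by metis
  qed
  then obtain c where c: "\<And>x k. norm (mat_pow M k *v x) \<le> c x * r ^ k"
    by metis
  \<comment> \<open>The entry at \<open>i\<close>, \<open>j\<close> of a power is bounded by the
    orbit of the \<open>j\<close>-th basis vector, so the constants are added up over all
    entries.\<close>
  define d where "d = (\<Sum>i\<in>(UNIV::'n set). \<Sum>j\<in>(UNIV::'n set). c (axis j 1))"
  have "norm (mat_pow M k) \<le> d * r ^ k" for k
  proof -
    have "norm (mat_pow M k) \<le> (\<Sum>i\<in>UNIV. norm (mat_pow M k $ i))"
      by (simp add: norm_vec_def[of "mat_pow M k"] L2_set_le_sum)
    also have "\<dots> \<le> (\<Sum>i\<in>UNIV. \<Sum>j\<in>UNIV. norm (mat_pow M k $ i $ j))"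
      by (intro sum_mono) (simp add: norm_vec_def L2_set_le_sum)
    also have "\<dots> \<le> (\<Sum>i\<in>(UNIV::'n set). \<Sum>j\<in>(UNIV::'n set). c (axis j 1) * r ^ k)"
    proof (intro sum_mono)
      fix i j
      have "mat_pow M k $ i $ j = (mat_pow M k *v axis j 1) $ i"
        by (simp add: matrix_vector_mult_basis column_def)
      then show "norm (mat_pow M k $ i $ j) \<le> c (axis j 1) * r ^ k"
        using c[of k "axis j 1"] component_le_norm_cart[of "mat_pow M k *v axis j 1" i] by simp
    qed
    finally show ?thesis
      by (simp add: d_def sum_distrib_right mult.assoc)
  qed
  moreover from this[of 0] have "0 \<le> d"
    by (simp add: order_trans[OF norm_ge_zero])
  ultimately show ?thesis
    using that r by blast
qed

text \<open>
  Needed because \<open>Max\<close> of the empty set is unspecified. Without eigenvalues \<open>geometric_orbit\<close>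
  would apply even with \<open>r = -1\<close>.
\<close>

lemma complex_spectrum_nonempty:
  fixes M :: "real^'n^'n"
  shows "complex_spectrum M \<noteq> {}"
proof
  assume empty: "complex_spectrum M = {}"
  obtain p where p: "p \<noteq> 0" "\<And>v. poly_act (complexify M) p v = 0"
    using exists_annihilating_poly[of "complexify M"] by blast
  have "\<exists>c. \<forall>k. norm (((*v) (complexify M) ^^ k) (axis undefined 1)) \<le> c * (-1) ^ k"
    using empty by (intro geometric_orbit[OF _ p]) (auto simp: complex_spectrum_def)
  then obtain c where c: "\<And>k. norm (((*v) (complexify M) ^^ k) (axis undefined 1)) \<le> c * (-1) ^ k"
    by blast
  have "0 < norm (axis undefined 1 :: complex^'n)"
    by (simp add: axis_eq_0_iff)
  then have "0 < c" "0 \<le> - c"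
    using c[of 0] order_trans[OF norm_ge_zero c[of 1]] by auto
  then show False
    by simp
qed

text \<open>Lyapunov's criterion over the reals. For an eigenvector with real part \<open>a\<close>
  and imaginary part \<open>b\<close>, the mixed terms of \<open>q (M a)\<close> and
  \<open>q (M b)\<close> cancel in the sum, so \<open>q a + q b\<close> is multiplied by exactly the
  squared modulus of the eigenvalue.\<close>

lemma spec_radius_less_oneI:
  assumes psd: "\<And>x. 0 \<le> x \<bullet> (P *v x)"
    and dec: "\<And>x. x \<noteq> 0 \<Longrightarrow> (M *v x) \<bullet> (P *v (M *v x)) < x \<bullet> (P *v x)"
  shows "spec_radius M < 1"
proof -
  have "cmod l < 1" if l: "l \<in> complex_spectrum M" for l
  proof -
    obtain v where v: "v \<noteq> 0" "complexify M *v v = l *s v"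
      using l unfolding complex_spectrum_def by blast
    define a b where "a = (\<chi> i. Re (v $ i))" and "b = (\<chi> i. Im (v $ i))"
    have re: "M *v a = Re l *\<^sub>R a - Im l *\<^sub>R b"
    proof (intro vec_eq_iff[THEN iffD2] allI)
      fix i
      have "Re ((complexify M *v v) $ i) = Re ((l *s v) $ i)"
        using v by simp
      then show "(M *v a) $ i = (Re l *\<^sub>R a - Im l *\<^sub>R b) $ i"
        by (simp add: matrix_vector_mult_def map_matrix_def a_def b_def)
    qed
    have im: "M *v b = Re l *\<^sub>R b + Im l *\<^sub>R a"
    proof (intro vec_eq_iff[THEN iffD2] allI)
      fix i
      have "Im ((complexify M *v v) $ i) = Im ((l *s v) $ i)"
        using v by simp
      then show "(M *v b) $ i = (Re l *\<^sub>R b + Im l *\<^sub>R a) $ i"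
        by (simp add: matrix_vector_mult_def map_matrix_def a_def b_def)
    qed
    define q where "q x = x \<bullet> (P *v x)" for x
    have "a \<noteq> 0 \<or> b \<noteq> 0"
      using v(1) by (auto simp: a_def b_def vec_eq_iff complex_eq_iff)
    then have "q (M *v a) + q (M *v b) < q a + q b"
      using dec[of a] dec[of b] unfolding q_def by (cases "a = 0"; cases "b = 0") auto
    moreover have "q (M *v a) + q (M *v b) = ((Re l)\<^sup>2 + (Im l)\<^sup>2) * (q a + q b)"
      unfolding q_def re im
      by (simp add: matrix_vector_mult_diff_distrib matrix_vector_right_distrib matrix_vector_mult_scaleR
          inner_diff_left inner_diff_right inner_add_left inner_add_right power2_eq_square
          distrib_left distrib_right left_diff_distrib right_diff_distrib)
    moreover have "0 \<le> q a + q b"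
      using psd by (simp add: q_def)
    ultimately have "(Re l)\<^sup>2 + (Im l)\<^sup>2 < 1"
      using mult_right_mono[of 1 "(Re l)\<^sup>2 + (Im l)\<^sup>2" "q a + q b"]
      by (cases "1 \<le> (Re l)\<^sup>2 + (Im l)\<^sup>2") auto
    then show ?thesis
      by (simp add: cmod_def)
  qed
  then show ?thesis
    unfolding spec_radius_def using finite_complex_spectrum complex_spectrum_nonempty
    by (subst Max_less_iff) auto
qed

section \<open>The discrete Lyapunov equation\<close>

lemma inner_matrix: "(A::real^'n^'m) \<bullet> B = (\<Sum>i\<in>UNIV. \<Sum>j\<in>UNIV. A $ i $ j * B $ i $ j)"
  by (simp add: inner_vec_def)

lemma inner_transpose: "transpose (A::real^'n^'m) \<bullet> transpose B = A \<bullet> B"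
  unfolding inner_matrix transpose_def by (simp, rule sum.swap)

lemma norm_transpose: "norm (transpose (A::real^'n^'m)) = norm A"
  by (simp add: norm_eq_sqrt_inner inner_transpose)

lemma inner_matrix_mult_right: "(A ** B) \<bullet> C = A \<bullet> (C ** transpose (B::real^'n^'k))" for A :: "real^'k^'m"
proof -
  have "(A ** B) \<bullet> C = (\<Sum>i\<in>UNIV. \<Sum>j\<in>UNIV. \<Sum>k\<in>UNIV. A $ i $ k * B $ k $ j * C $ i $ j)"
    by (simp add: inner_matrix matrix_matrix_mult_def sum_distrib_right)
  also have "\<dots> = (\<Sum>i\<in>UNIV. \<Sum>k\<in>UNIV. \<Sum>j\<in>UNIV. A $ i $ k * B $ k $ j * C $ i $ j)"
    by (intro sum.cong refl sum.swap)
  also have "\<dots> = A \<bullet> (C ** transpose B)"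
    by (simp add: inner_matrix matrix_matrix_mult_def transpose_def sum_distrib_left mult_ac)
  finally show ?thesis .
qed

lemma inner_matrix_mult_left: "(A ** B) \<bullet> C = B \<bullet> (transpose A ** C)" for A :: "real^'k^'m"
proof -
  have "(A ** B) \<bullet> C = (transpose B ** transpose A) \<bullet> transpose C"
    by (simp add: inner_transpose flip: matrix_transpose_mul)
  also have "\<dots> = transpose B \<bullet> transpose (transpose A ** C)"
    by (simp add: inner_matrix_mult_right matrix_transpose_mul)
  finally show ?thesis
    by (simp add: inner_transpose)
qed

text \<open>Cyclicity of the trace. It moves the dynamics between state correlations and cost
  matrices.\<close>

lemma inner_congruence: "(A ** X ** transpose A) \<bullet> Y = X \<bullet> (transpose A ** Y ** A)"
  for A :: "real^'n^'m"
  by (simp only: inner_matrix_mult_right[of "A ** X" "transpose A"] transpose_transpose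
      inner_matrix_mult_left[of A X] matrix_mul_assoc)

lemma norm_matrix_vector_mult: "norm (A *v x) \<le> norm A * norm x" for A :: "real^'n^'m"
proof -
  have "norm (A *v x) \<le> L2_set (\<lambda>i. norm (A $ i) * norm x) UNIV"
    unfolding norm_vec_def[of "A *v x"]
    by (intro L2_set_mono) (simp_all add: matrix_vector_mul_component Cauchy_Schwarz_ineq2)
  also have "\<dots> = norm A * norm x"
    by (simp add: norm_vec_def[of A] L2_set_left_distrib)
  finally show ?thesis .
qed

lemma row_matrix_mult: "(A ** B) $ i = transpose B *v (A $ i)" for A :: "real^'k^'m"
  by (simp add: vec_eq_iff matrix_matrix_mult_def vector_matrix_mult_def)

lemma norm_matrix_mult: "norm (A ** B) \<le> norm A * norm B" for A :: "real^'k^'m" and B :: "real^'n^'k"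
proof -
  have "norm (A ** B) \<le> L2_set (\<lambda>i. norm (A $ i) * norm B) UNIV"
    unfolding norm_vec_def[of "A ** B"] row_matrix_mult
    by (intro L2_set_mono order_trans[OF norm_matrix_vector_mult])
      (simp_all add: norm_transpose mult.commute)
  also have "\<dots> = norm A * norm B"
    by (simp add: norm_vec_def[of A] L2_set_left_distrib)
  finally show ?thesis .
qed

lemma matrix_add_rdistrib: "(A + B) ** C = A ** C + B ** C" for A :: "real^'k^'m"
  by (simp add: vec_eq_iff matrix_matrix_mult_def distrib_right sum.distrib)

lemma bounded_bilinear_matrix_mult:
  "bounded_bilinear (\<lambda>(A::real^'k^'m) (B::real^'n^'k). A ** B)"
proof
  show "\<exists>K. \<forall>(A::real^'k^'m) (B::real^'n^'k). norm (A ** B) \<le> norm A * norm B * K"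
    by (intro exI[of _ 1]) (simp add: norm_matrix_mult)
qed (simp_all add: matrix_add_ldistrib matrix_add_rdistrib matrix_scalar_ac scalar_matrix_assoc)

interpretation matrix_mult: bounded_bilinear "\<lambda>(A::real^'k^'m) (B::real^'n^'k). A ** B"
  by (rule bounded_bilinear_matrix_mult)

lemma bounded_linear_transpose: "bounded_linear (transpose :: real^'n^'m \<Rightarrow> real^'m^'n)"
  by (intro bounded_linear_intro[where K = 1])
    (simp_all add: norm_transpose transpose_scalar, simp add: transpose_def vec_eq_iff)

lemmas transpose_add = linear_add[OF bounded_linear.linear[OF bounded_linear_transpose]]
lemmas transpose_diff = linear_diff[OF bounded_linear.linear[OF bounded_linear_transpose]]
lemmas transpose_minus = linear_neg[OF bounded_linear.linear[OF bounded_linear_transpose]]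
lemmas transpose_zero = linear_0[OF bounded_linear.linear[OF bounded_linear_transpose]]
lemmas isCont_transpose = bounded_linear.isCont[OF bounded_linear_transpose]

lemmas has_derivative_matrix_mult =
  bounded_bilinear.FDERIV[OF bounded_bilinear_matrix_mult]

lemmas has_derivative_transpose =
  bounded_linear.has_derivative[OF bounded_linear_transpose]

lemmas matrix_simps = matrix_add_ldistrib matrix_add_rdistrib
  matrix_mult.diff_left matrix_mult.diff_right
  matrix_mult.minus_left matrix_mult.minus_right
  matrix_mult.scaleR_left matrix_mult.scaleR_right matrix_mul_assoc
  transpose_add transpose_diff transpose_minus transpose_scalar matrix_transpose_mul

text \<open>Values of a quadratic form become pairings with rank one matrices, that is, linear
  functionals through which series and expectations can be pulled.\<close>

lemma inner_outer: "outer x y \<bullet> S = x \<bullet> (S *v y)"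
  unfolding inner_matrix outer_def
  by (simp add: inner_vec_def matrix_vector_mult_def sum_distrib_left mult_ac)

lemma quad_mult: "x \<bullet> ((transpose A ** S) *v y) = (A *v x) \<bullet> (S *v y)" for A :: "real^'n^'m"
  unfolding matrix_vector_mul_assoc[symmetric]
  by (simp add: inner_commute[of x] dot_lmul_matrix) (simp add: inner_commute)

lemma inner_transpose_vec: "x \<bullet> (transpose A *v y) = (A *v x) \<bullet> y" for A :: "real^'n^'m"
  by (simp add: inner_commute[of x] dot_lmul_matrix) (simp add: inner_commute)

lemma quad_transpose: "x \<bullet> (transpose S *v x) = x \<bullet> (S *v x)" for S :: "real^'n^'n"
  unfolding inner_transpose_vec by (rule inner_commute)

section \<open>Positive semidefinite forms and the series solution\<close>

definition psd :: "real^'n^'n \<Rightarrow> bool" where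
  "psd S \<longleftrightarrow> (\<forall>x. 0 \<le> x \<bullet> (S *v x))"

text \<open>The solution \<open>Z\<close> of \<open>Z = S + M ** Z ** transpose M\<close>, written
  as its Neumann series.\<close>

definition dlyap :: "real^'n^'n \<Rightarrow> real^'n^'n \<Rightarrow> real^'n^'n" where
  "dlyap M S = (\<Sum>t. mat_pow M t ** S ** transpose (mat_pow M t))"

lemma summable_dlyap:
  assumes "spec_radius M < 1"
  shows "summable (\<lambda>t. mat_pow M t ** S ** transpose (mat_pow M t))"
proof -
  obtain c r where cr: "0 \<le> c" "0 < r" "r < 1" "\<And>k. norm (mat_pow M k) \<le> c * r ^ k"
    using geometric_mat_pow[OF assms] by blast
  have bound: "norm (mat_pow M t ** S ** transpose (mat_pow M t)) \<le> (c\<^sup>2 * norm S) * (r\<^sup>2) ^ t" for t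
  proof -
    have "norm (mat_pow M t ** S ** transpose (mat_pow M t)) \<le> norm (mat_pow M t) * norm S * norm (mat_pow M t)"
      using mult_right_mono[OF norm_matrix_mult[of "mat_pow M t" S], of "norm (mat_pow M t)"]
        norm_matrix_mult[of "mat_pow M t ** S" "transpose (mat_pow M t)"]
      by (simp add: norm_transpose)
    also have "\<dots> \<le> (c * r ^ t) * norm S * (c * r ^ t)"
      using cr by (intro mult_mono mult_nonneg_nonneg) auto
    finally show ?thesis
      by (simp add: power2_eq_square power_mult_distrib mult_ac)
  qed
  have "summable (\<lambda>t. (c\<^sup>2 * norm S) * (r\<^sup>2) ^ t)"
    using cr by (intro summable_mult summable_geometric) (simp add: power_less_one_iff)
  then show ?thesis
    by (rule summable_comparison_test[rotated]) (use bound in blast)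
qed

lemma bounded_linear_congruence: "bounded_linear (\<lambda>X. A ** X ** transpose A)"
  for A :: "real^'n^'m"
proof -
  have "linear (\<lambda>X. A ** X ** transpose A)"
  proof (rule linearI)
    show "A ** (X + Y) ** transpose A = A ** X ** transpose A + A ** Y ** transpose A" for X Y
      by (simp only: matrix_add_ldistrib matrix_add_rdistrib)
    show "A ** (c *\<^sub>R X) ** transpose A = c *\<^sub>R (A ** X ** transpose A)" for c X
      by (simp only: matrix_mult.scaleR_left matrix_mult.scaleR_right)
  qed
  then show ?thesis
    by (simp add: linear_conv_bounded_linear)
qed

lemma dlyap_eq:
  assumes "spec_radius M < 1"
  shows "dlyap M S = S + M ** dlyap M S ** transpose M"
proof -
  have "dlyap M S = S + (\<Sum>t. M ** (mat_pow M t ** S ** transpose (mat_pow M t)) ** transpose M)"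
    using suminf_split_head[OF summable_dlyap[OF assms, of S]]
    by (simp add: dlyap_def matrix_transpose_mul matrix_mul_assoc)
  also have "(\<Sum>t. M ** (mat_pow M t ** S ** transpose (mat_pow M t)) ** transpose M)
      = M ** dlyap M S ** transpose M"
    unfolding dlyap_def
    by (rule bounded_linear.suminf[OF bounded_linear_congruence summable_dlyap[OF assms], symmetric])
  finally show ?thesis .
qed

text \<open>The difference of two solutions is a fixed point of the congruence by \<open>M\<close>,
  so its own series has constant terms, and convergence forces them to vanish.\<close>

lemma dlyap_unique:
  assumes "spec_radius M < 1" and Z: "Z = S + M ** Z ** transpose M"
  shows "Z = dlyap M S"
proof -
  define W where "W = Z - dlyap M S"
  have W: "W = M ** W ** transpose M"
    using arg_cong2[where f = "(-)", OF Z dlyap_eq[OF assms(1), of S]]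
    unfolding W_def matrix_mult.diff_right matrix_mult.diff_left add_diff_cancel_left .
  have "mat_pow M t ** W ** transpose (mat_pow M t) = W" for t
  proof (induction t)
    case (Suc t)
    have "mat_pow M (Suc t) ** W ** transpose (mat_pow M (Suc t))
        = M ** (mat_pow M t ** W ** transpose (mat_pow M t)) ** transpose M"
      by (simp add: matrix_transpose_mul matrix_mul_assoc)
    with Suc W show ?case
      by simp
  qed simp
  then have "summable (\<lambda>t::nat. W)"
    using summable_dlyap[OF assms(1), of W] by simp
  then show ?thesis
    by (simp add: summable_const_iff W_def)
qed

lemma bounded_linear_dlyap:
  assumes "spec_radius M < 1"
  shows "bounded_linear (dlyap M)"
proof -
  have "linear (dlyap M)"
  proof (rule linearI)
    show "dlyap M (S + T) = dlyap M S + dlyap M T" for S T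
      unfolding dlyap_def suminf_add[OF summable_dlyap[OF assms] summable_dlyap[OF assms]]
      by (simp add: matrix_simps)
    show "dlyap M (c *\<^sub>R S) = c *\<^sub>R dlyap M S" for c S
      unfolding dlyap_def suminf_scaleR_right[OF summable_dlyap[OF assms]]
      by (simp only: matrix_mult.scaleR_left matrix_mult.scaleR_right)
  qed
  then show ?thesis
    by (simp add: linear_conv_bounded_linear)
qed

lemma psd_dlyap:
  assumes "spec_radius M < 1" "psd S"
  shows "psd (dlyap M S)"
  unfolding psd_def
proof
  fix x
  have bl: "bounded_linear (\<lambda>X. outer x x \<bullet> (X::real^'a^'a))"
    by (rule bounded_linear_inner_right)
  have "outer x x \<bullet> dlyap M S = (\<Sum>t. outer x x \<bullet> (mat_pow M t ** S ** transpose (mat_pow M t)))"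
    unfolding dlyap_def by (rule bounded_linear.suminf[OF bl summable_dlyap[OF assms(1)]])
  also have "\<dots> \<ge> 0"
  proof (rule suminf_nonneg)
    show "summable (\<lambda>t. outer x x \<bullet> (mat_pow M t ** S ** transpose (mat_pow M t)))"
      by (rule bounded_linear.summable[OF bl summable_dlyap[OF assms(1)]])
    show "0 \<le> outer x x \<bullet> (mat_pow M t ** S ** transpose (mat_pow M t))" for t
      using assms(2) quad_mult[of x "transpose (mat_pow M t)" "S ** transpose (mat_pow M t)" x]
      by (simp add: inner_outer psd_def matrix_mul_assoc flip: matrix_vector_mul_assoc)
  qed
  finally show "0 \<le> x \<bullet> (dlyap M S *v x)"
    by (simp add: inner_outer)
qed

lemma psd_mat_1: "psd (mat 1)"
  by (simp add: psd_def)

text \<open>The Lyapunov solution of \<open>M\<close> with right-hand side \<open>mat 1\<close> is a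
  Lyapunov function for the transposed dynamics: its form drops by \<open>x \<bullet> x\<close> in
  each step.\<close>

lemma spec_radius_transpose_less_one:
  assumes "spec_radius M < 1"
  shows "spec_radius (transpose M) < 1"
proof (rule spec_radius_less_oneI)
  let ?H = "dlyap M (mat 1)"
  show "0 \<le> x \<bullet> (?H *v x)" for x
    using psd_dlyap[OF assms psd_mat_1] by (simp add: psd_def)
  fix x :: "real^'a" assume "x \<noteq> 0"
  have "x \<bullet> (?H *v x) = x \<bullet> ((mat 1 + M ** ?H ** transpose M) *v x)"
    using dlyap_eq[OF assms, of "mat 1"] by simp
  also have "\<dots> = x \<bullet> x + (transpose M *v x) \<bullet> (?H *v (transpose M *v x))"
    using quad_mult[of x "transpose M" "?H ** transpose M" x]
    by (simp add: matrix_vector_mult_add_rdistrib inner_add_right matrix_mul_assoc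
        flip: matrix_vector_mul_assoc)
  finally show "(transpose M *v x) \<bullet> (?H *v (transpose M *v x)) < x \<bullet> (?H *v x)"
    using \<open>x \<noteq> 0\<close> by simp
qed

text \<open>The duality between the two formulas for the cost: propagating the state forward and
  weighting it, or propagating the weight backward and pairing it with the initial state. Both
  Lyapunov equations are inserted, and one congruence is moved across.\<close>

lemma dlyap_adjoint:
  assumes "spec_radius M < 1"
  shows "dlyap M S \<bullet> T = S \<bullet> dlyap (transpose M) T"
proof -
  let ?Z = "dlyap M S" and ?Y = "dlyap (transpose M) T"
  have "S \<bullet> ?Y = (?Z - M ** ?Z ** transpose M) \<bullet> ?Y"
    using dlyap_eq[OF assms, of S] by (metis add_diff_cancel_right')
  also have "\<dots> = ?Z \<bullet> ?Y - ?Z \<bullet> (transpose M ** ?Y ** M)"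
    by (simp add: inner_diff_left inner_congruence)
  also have "\<dots> = ?Z \<bullet> T"
    using dlyap_eq[OF spec_radius_transpose_less_one[OF assms], of T]
    by (metis add_diff_cancel_right' inner_diff_right transpose_transpose)
  finally show ?thesis ..
qed

lemma transpose_dlyap:
  assumes "spec_radius M < 1"
  shows "transpose (dlyap M S) = dlyap M (transpose S)"
proof (rule dlyap_unique[OF assms])
  have "transpose (dlyap M S) = transpose (S + M ** dlyap M S ** transpose M)"
    using dlyap_eq[OF assms, of S] by simp
  then show "transpose (dlyap M S) = transpose S + M ** transpose (dlyap M S) ** transpose M"
    by (simp add: matrix_simps)
qed

text \<open>If one factor vanishes at the point, continuity of the other suffices for the product
  rule. This permits implicit differentiation of a Lyapunov solution before its differentiability is
  known.\<close>

lemma has_derivative_bilinear_vanishing: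
  assumes "bounded_bilinear pr"
    and g: "(g has_derivative g') (at x)" "g x = 0"
    and h: "isCont h x"
  shows "((\<lambda>y. pr (g y) (h y)) has_derivative (\<lambda>d. pr (g' d) (h x))) (at x)"
proof -
  interpret bounded_bilinear pr by fact
  have "((\<lambda>y. pr (g y) (h x)) has_derivative (\<lambda>d. pr (g' d) (h x))) (at x)"
    using bounded_linear.has_derivative[OF bounded_linear_left g(1)] .
  \<comment> \<open>Here the first factor is of order \<open>norm d\<close> and the second tends to
    \<open>0\<close>, so the product is of smaller order than \<open>norm d\<close>.\<close>
  moreover have "((\<lambda>y. pr (g y) (h y - h x)) has_derivative (\<lambda>d. 0)) (at x)"
  proof -
    obtain K where K: "\<And>a b. norm (pr a b) \<le> norm a * norm b * K" "K \<ge> 0"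
      using nonneg_bounded by blast
    have "bounded_linear g'"
      using g(1) has_derivative_bounded_linear by blast
    then obtain G where G: "\<And>d. norm (g' d) \<le> norm d * G"
      using bounded_linear.bounded by blast
    define e where "e d = norm (g (x + d) - g x - g' d) / norm d" for d
    have e: "(e \<longlongrightarrow> 0) (at 0)"
      using g(1) unfolding has_derivative_at e_def by simp
    have hc: "((\<lambda>d. h (x + d) - h x) \<longlongrightarrow> 0) (at 0)"
      using h unfolding isCont_iff by (rule LIM_zero)
    have bound: "norm (pr (g (x + d)) (h (x + d) - h x)) / norm d
        \<le> (e d + G) * norm (h (x + d) - h x) * K" if "d \<noteq> 0" for d
    proof -
      have "norm (g (x + d)) \<le> norm (g (x + d) - g x - g' d) + norm (g' d)"
        using norm_triangle_ineq[of "g (x + d) - g x - g' d" "g' d"] g(2) by simp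
      also have "\<dots> \<le> (e d + G) * norm d"
        using G[of d] that by (simp add: e_def field_simps)
      finally have "norm (g (x + d)) \<le> (e d + G) * norm d" .
      then have "norm (pr (g (x + d)) (h (x + d) - h x))
          \<le> (e d + G) * norm d * norm (h (x + d) - h x) * K"
        by (meson K mult_right_mono norm_ge_zero order_trans)
      then show ?thesis
        using that by (simp add: field_simps)
    qed
    have "((\<lambda>d. (e d + G) * norm (h (x + d) - h x) * K) \<longlongrightarrow> (0 + G) * norm (0::'b) * K) (at 0)"
      by (intro tendsto_intros e hc)
    then have lim: "((\<lambda>d. (e d + G) * norm (h (x + d) - h x) * K) \<longlongrightarrow> 0) (at 0)"
      by simp
    have "((\<lambda>d. norm (pr (g (x + d)) (h (x + d) - h x)) / norm d) \<longlongrightarrow> 0) (at 0)"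
      by (rule tendsto_sandwich[OF _ _ tendsto_const lim])
        (auto simp: eventually_at intro!: exI[of _ 1] bound)
    then show ?thesis
      unfolding has_derivative_at using g(2) by (simp add: zero_right zero_left)
  qed
  ultimately have "((\<lambda>y. pr (g y) (h x) + pr (g y) (h y - h x)) has_derivative
      (\<lambda>d. pr (g' d) (h x) + 0)) (at x)"
    by (rule has_derivative_add)
  then show ?thesis
    by (simp flip: add_right)
qed

text \<open>An exact resolvent-type identity. The change in the dynamics appears as a factor
  \<open>N - M\<close>, at the price that the unknown solution at \<open>N\<close> remains on the
  right; continuity and the derivative are both read off from it.\<close>

lemma dlyap_perturbation:
  assumes "spec_radius M < 1" "spec_radius N < 1"
  shows "dlyap N T - dlyap M S
    = dlyap M (T - S + ((N - M) ** dlyap N T ** transpose N + M ** dlyap N T ** transpose (N - M)))"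
proof (rule dlyap_unique[OF assms(1)])
  have "dlyap N T - dlyap M S
      = T + N ** dlyap N T ** transpose N - (S + M ** dlyap M S ** transpose M)"
    using dlyap_eq[OF assms(1), of S] dlyap_eq[OF assms(2), of T] by simp
  then show "dlyap N T - dlyap M S
    = T - S + ((N - M) ** dlyap N T ** transpose N + M ** dlyap N T ** transpose (N - M))
      + M ** (dlyap N T - dlyap M S) ** transpose M"
    by (simp add: matrix_simps algebra_simps)
qed

text \<open>The perturbation identity estimates the change of the solution by the solution itself,
  so a local bound has to be won before the estimate tends to \<open>0\<close>.\<close>

lemma isCont_dlyap:
  fixes M S :: "'a::real_normed_vector \<Rightarrow> real^'n^'n"
  assumes M: "isCont M x" and S: "isCont S x"
    and stable: "\<forall>\<^sub>F y in nhds x. spec_radius (M y) < 1"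
  shows "isCont (\<lambda>y. dlyap (M y) (S y)) x"
proof -
  have stable_x: "spec_radius (M x) < 1"
    using eventually_nhds_x_imp_x[OF stable] .
  obtain c where c: "0 < c" "\<And>X. norm (dlyap (M x) X) \<le> norm X * c"
    using bounded_linear.pos_bounded[OF bounded_linear_dlyap[OF stable_x]] by blast
  let ?Z = "\<lambda>y. dlyap (M y) (S y)"
  define e where "e y = norm (M y - M x) * (norm (M y) + norm (M x))" for y
  have stable': "\<forall>\<^sub>F y in at x. spec_radius (M y) < 1"
    using stable by (simp add: eventually_nhds_conv_at)
  have diff: "norm (?Z y - ?Z x) \<le> (norm (S y - S x) + e y * norm (?Z y)) * c"
    if "spec_radius (M y) < 1" for y
  proof -
    have "norm (S y - S x + ((M y - M x) ** ?Z y ** transpose (M y) + M x ** ?Z y ** transpose (M y - M x)))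
        \<le> norm (S y - S x) + (norm (M y - M x) * norm (?Z y) * norm (M y)
            + norm (M x) * norm (?Z y) * norm (M y - M x))"
      by (intro norm_triangle_le add_mono order_refl order_trans[OF norm_matrix_mult] mult_right_mono)
        (simp_all add: norm_transpose norm_matrix_mult mult_right_mono)
    also have "\<dots> = norm (S y - S x) + e y * norm (?Z y)"
      by (simp add: e_def algebra_simps)
    finally show ?thesis
      unfolding dlyap_perturbation[OF stable_x that] using c
      by (meson less_imp_le mult_right_mono order_trans)
  qed
  have "(e \<longlongrightarrow> norm (M x - M x) * (norm (M x) + norm (M x))) (at x)"
    unfolding e_def using M by (intro tendsto_intros) (auto simp: isCont_def)
  then have e0: "(e \<longlongrightarrow> 0) (at x)"
    by simp
  have "((\<lambda>y. norm (S y - S x)) \<longlongrightarrow> norm (S x - S x)) (at x)"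
    using S by (intro tendsto_intros) (auto simp: isCont_def)
  then have S0: "((\<lambda>y. norm (S y - S x)) \<longlongrightarrow> 0) (at x)"
    by simp
  \<comment> \<open>Once \<open>e y < 1 / (2 * c)\<close> and \<open>norm (S y - S x) < 1\<close>,
    the identity gives \<open>norm (?Z y) \<le> norm (?Z x) + c + norm (?Z y) / 2\<close>; absorbing
    the last term leaves this bound.\<close>
  define B where "B = 2 * (norm (?Z x) + c)"
  have "\<forall>\<^sub>F y in at x. e y < 1 / (2 * c)"
    using order_tendstoD(2)[OF e0, of "1 / (2 * c)"] c by simp
  moreover have "\<forall>\<^sub>F y in at x. norm (S y - S x) < 1"
    using order_tendstoD(2)[OF S0, of 1] by simp
  ultimately have ev: "\<forall>\<^sub>F y in at x. norm (?Z y - ?Z x) \<le> (norm (S y - S x) + e y * B) * c"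
    using stable'
  proof eventually_elim
    case (elim y)
    have e: "0 \<le> e y"
      by (simp add: e_def)
    have "e y * norm (?Z y) * c \<le> 1 / (2 * c) * norm (?Z y) * c"
      using elim c by (intro mult_right_mono) auto
    also have "\<dots> = norm (?Z y) / 2"
      using c by simp
    finally have "e y * norm (?Z y) * c \<le> norm (?Z y) / 2" .
    moreover have "norm (S y - S x) * c \<le> c"
      using elim c by simp
    moreover have "norm (?Z y) \<le> norm (?Z x) + norm (?Z y - ?Z x)"
      by (metis add.commute diff_add_cancel norm_triangle_ineq)
    ultimately have "norm (?Z y) \<le> B"
      using diff[OF elim(3)] by (simp add: B_def distrib_right)
    then have "(norm (S y - S x) + e y * norm (?Z y)) * c \<le> (norm (S y - S x) + e y * B) * c"
      using e c by (intro mult_right_mono add_left_mono mult_left_mono) auto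
    with diff[OF elim(3)] show ?case
      by simp
  qed
  have "((\<lambda>y. (norm (S y - S x) + e y * B) * c) \<longlongrightarrow> (0 + 0 * B) * c) (at x)"
    by (intro tendsto_intros e0 S0)
  then have "((\<lambda>y. (norm (S y - S x) + e y * B) * c) \<longlongrightarrow> 0) (at x)"
    by simp
  from Lim_null_comparison[OF ev this] show ?thesis
    unfolding isCont_def by (simp add: LIM_zero_iff)
qed

text \<open>Implicit differentiation: in the perturbation identity each product contains the
  differentiable factor \<open>M y - M x\<close>, which vanishes at \<open>x\<close>, while the
  solution beside it is so far known to be continuous.\<close>

lemma has_derivative_dlyap:
  fixes M S :: "'a::real_normed_vector \<Rightarrow> real^'n^'n"
  assumes M: "(M has_derivative M') (at x)" and S: "(S has_derivative S') (at x)"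
    and stable: "\<forall>\<^sub>F y in nhds x. spec_radius (M y) < 1"
    and Z: "Z = dlyap (M x) (S x)"
  shows "((\<lambda>y. dlyap (M y) (S y)) has_derivative
    (\<lambda>h. dlyap (M x) (S' h + (M' h ** Z ** transpose (M x) + M x ** Z ** transpose (M' h))))) (at x)"
proof -
  have stable_x: "spec_radius (M x) < 1"
    using eventually_nhds_x_imp_x[OF stable] .
  let ?Z = "\<lambda>y. dlyap (M y) (S y)"
  have contM: "isCont M x" and contS: "isCont S x"
    using M S has_derivative_continuous by auto
  have contZ: "isCont ?Z x"
    by (rule isCont_dlyap[OF contM contS stable])
  have dM: "((\<lambda>y. M y - M x) has_derivative M') (at x)"
    using has_derivative_diff[OF M has_derivative_const[of "M x"]] by simp
  have d1: "((\<lambda>y. (M y - M x) ** (?Z y ** transpose (M y))) has_derivative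
      (\<lambda>h. M' h ** (Z ** transpose (M x)))) (at x)"
    unfolding Z
    by (rule has_derivative_bilinear_vanishing[OF bounded_bilinear_matrix_mult dM])
      (auto intro!: matrix_mult.isCont isCont_transpose contM contZ)
  have d2: "((\<lambda>y. M x ** (?Z y ** transpose (M y - M x))) has_derivative
      (\<lambda>h. M x ** (Z ** transpose (M' h)))) (at x)"
  proof -
    have "((\<lambda>y. transpose (M y - M x)) has_derivative (\<lambda>h. transpose (M' h))) (at x)"
      by (rule has_derivative_transpose[OF dM])
    then have "((\<lambda>y. ?Z y ** transpose (M y - M x)) has_derivative (\<lambda>h. Z ** transpose (M' h))) (at x)"
      using has_derivative_bilinear_vanishing[OF bounded_bilinear.flip[OF bounded_bilinear_matrix_mult],
          of "\<lambda>y. transpose (M y - M x)" _ x ?Z] contZ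
      unfolding Z by (simp add: transpose_zero)
    then show ?thesis
      by (rule bounded_linear.has_derivative[OF matrix_mult.bounded_linear_right])
  qed
  have dS: "((\<lambda>y. S y - S x) has_derivative S') (at x)"
    using has_derivative_diff[OF S has_derivative_const[of "S x"]] by simp
  have "((\<lambda>y. dlyap (M x) (S y - S x + ((M y - M x) ** (?Z y ** transpose (M y))
        + M x ** (?Z y ** transpose (M y - M x))))) has_derivative
      (\<lambda>h. dlyap (M x) (S' h + (M' h ** (Z ** transpose (M x)) + M x ** (Z ** transpose (M' h))))))
      (at x)"
    by (intro bounded_linear.has_derivative[OF bounded_linear_dlyap[OF stable_x]]
        has_derivative_add dS d1 d2)
  then have "((\<lambda>y. dlyap (M x) (S y - S x + ((M y - M x) ** ?Z y ** transpose (M y)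
        + M x ** ?Z y ** transpose (M y - M x))) + ?Z x) has_derivative
      (\<lambda>h. dlyap (M x) (S' h + (M' h ** Z ** transpose (M x) + M x ** Z ** transpose (M' h))) + 0))
      (at x)"
    by (intro has_derivative_add has_derivative_const) (simp add: matrix_mul_assoc)
  then have *: "((\<lambda>y. dlyap (M x) (S y - S x + ((M y - M x) ** ?Z y ** transpose (M y)
        + M x ** ?Z y ** transpose (M y - M x))) + ?Z x) has_derivative
      (\<lambda>h. dlyap (M x) (S' h + (M' h ** Z ** transpose (M x) + M x ** Z ** transpose (M' h)))))
      (at x)"
    by simp
  have "\<forall>\<^sub>F y in at x. dlyap (M x) (S y - S x + ((M y - M x) ** ?Z y ** transpose (M y)
        + M x ** ?Z y ** transpose (M y - M x))) + ?Z x = ?Z y"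
    using stable[unfolded eventually_nhds_conv_at, THEN conjunct1]
    by eventually_elim (simp add: dlyap_perturbation[OF stable_x, symmetric])
  then show ?thesis
    by (rule has_derivative_transform_eventually[OF *])
      (simp_all add: transpose_zero linear_0[OF bounded_linear.linear[OF bounded_linear_dlyap[OF stable_x]]])
qed

section \<open>Singular values and quadratic forms\<close>

lemma mat_pow_Suc_right: "mat_pow M (Suc k) = mat_pow M k ** M"
  by (induction k) (simp_all add: matrix_mul_assoc)

lemma mat_pow_transpose: "mat_pow (transpose M) k = transpose (mat_pow M k)"
proof (induction k)
  case (Suc k)
  have "mat_pow (transpose M) (Suc k) = transpose (mat_pow M k ** M)"
    using Suc by (simp add: matrix_transpose_mul)
  then show ?case
    by (simp only: mat_pow_Suc_right)
qed simp

lemma traj_eq: "traj M x t = mat_pow M t *v x"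
  by (induction t) (simp_all add: matrix_vector_mul_assoc)

lemma outer_mult: "outer (A *v x) (A *v x) = A ** outer x x ** transpose A"
  unfolding vec_eq_iff outer_def matrix_matrix_mult_def transpose_def matrix_vector_mult_def
  by (simp add: sum_product sum_distrib_right sum_distrib_left mult_ac)

lemma outer_vec: "outer u v *v x = (v \<bullet> x) *\<^sub>R u"
  by (simp add: vec_eq_iff outer_def matrix_vector_mult_def inner_vec_def sum_distrib_right
      sum_distrib_left mult_ac)

lemma scaleR_matrix_vec: "(c *\<^sub>R S) *v x = c *\<^sub>R (S *v x)" for S :: "real^'n^'m"
  by (simp add: scaleR_matrix_vector_assoc)

lemma neg_matrix_vec: "(- S) *v x = - (S *v x)" for S :: "real^'n^'m"
  by (simp add: vec_eq_iff matrix_vector_mult_def sum_negf)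

lemma inner_symmetric: "transpose S = S \<Longrightarrow> y \<bullet> (S *v x) = x \<bullet> (S *v y)" for S :: "real^'n^'n"
  by (metis inner_commute inner_transpose_vec)

lemma finite_real_spectrum: "finite (real_spectrum M)"
proof -
  have "complex_of_real ` real_spectrum M \<subseteq> complex_spectrum M"
  proof
    fix z assume "z \<in> complex_of_real ` real_spectrum M"
    then obtain l v where z: "z = complex_of_real l" and v: "v \<noteq> 0" "M *v v = l *s v"
      by (auto simp: real_spectrum_def)
    let ?w = "\<chi> i. complex_of_real (v $ i)"
    have "?w \<noteq> 0"
      using v(1) by (auto simp: vec_eq_iff)
    moreover have "complexify M *v ?w = z *s ?w"
      unfolding complexify_vec v(2) z by (simp add: vec_eq_iff)
    ultimately show "z \<in> complex_spectrum M"
      unfolding complex_spectrum_def by blast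
  qed
  then have "finite (complex_of_real ` real_spectrum M)"
    using finite_complex_spectrum finite_subset by blast
  then show ?thesis
    by (rule finite_imageD) (simp add: inj_on_def)
qed

lemma linear_term_zero:
  fixes b c :: real
  assumes nonneg: "\<And>t. 0 \<le> 2 * t * b + t\<^sup>2 * c" and "0 \<le> c"
  shows "b = 0"
proof -
  \<comment> \<open>The minimiser would be \<open>- b / c\<close>; the shift by \<open>1\<close>
    also covers \<open>c = 0\<close> and still gives a negative value unless
    \<open>b = 0\<close>.\<close>
  let ?t = "- b / (c + 1)"
  have "(2 * ?t * b + ?t\<^sup>2 * c) * (c + 1)\<^sup>2 = - (b\<^sup>2 * (c + 2))"
    using \<open>0 \<le> c\<close> by (simp add: divide_simps power2_eq_square) (simp add: algebra_simps)
  then have "b\<^sup>2 * (c + 2) \<le> 0"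
    using mult_nonneg_nonneg[OF nonneg[of ?t] zero_le_power2[of "c + 1"]] by linarith
  then show ?thesis
    using \<open>0 \<le> c\<close> by (auto simp: mult_le_0_iff)
qed

text \<open>A minimiser \<open>v\<close> of the form on the unit sphere is an eigenvector. Moving
  from \<open>v\<close> along the residual \<open>w = S v - l v\<close> changes the nonnegative form
  of \<open>S - l\<close>, which is \<open>0\<close> at \<open>v\<close>, by
  \<open>2 * t * (w \<bullet> w)\<close> to first order, so the residual vanishes.\<close>

lemma lowest_eigenvalue:
  fixes S :: "real^'n^'n"
  assumes sym: "transpose S = S"
  shows "\<exists>l v. v \<noteq> 0 \<and> S *v v = l *s v \<and> (\<forall>x. l * (x \<bullet> x) \<le> x \<bullet> (S *v x))"
proof -
  have "continuous_on (sphere 0 1) (\<lambda>x. x \<bullet> (S *v x))"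
    by (intro continuous_intros matrix_vector_mult_linear_continuous_on)
  moreover have "axis undefined 1 \<in> sphere (0::real^'n) 1"
    by (simp add: norm_axis_1)
  ultimately obtain v where v: "v \<in> sphere 0 1" "\<And>y. y \<in> sphere 0 1 \<Longrightarrow> v \<bullet> (S *v v) \<le> y \<bullet> (S *v y)"
    using continuous_attains_inf[OF compact_sphere] by blast
  define l where "l = v \<bullet> (S *v v)"
  have vv: "v \<bullet> v = 1"
    using v(1) by (simp add: dot_square_norm)
  have low: "l * (x \<bullet> x) \<le> x \<bullet> (S *v x)" for x
  proof (cases "x = 0")
    case False
    then have "l \<le> ((1 / norm x) *\<^sub>R x) \<bullet> (S *v ((1 / norm x) *\<^sub>R x))"
      unfolding l_def by (intro v(2)) simp
    also have "\<dots> = (x \<bullet> (S *v x)) / (x \<bullet> x)"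
      using False by (simp add: matrix_vector_mult_scaleR dot_square_norm power2_eq_square)
    finally show ?thesis
      using False by (simp add: pos_le_divide_eq)
  qed simp
  define w where "w = S *v v - l *\<^sub>R v"
  have "w \<bullet> w = 0"
  proof (rule linear_term_zero)
    show "0 \<le> w \<bullet> (S *v w) - l * (w \<bullet> w)"
      using low[of w] by simp
    fix t :: real
    have "l * ((v + t *\<^sub>R w) \<bullet> (v + t *\<^sub>R w)) \<le> (v + t *\<^sub>R w) \<bullet> (S *v (v + t *\<^sub>R w))"
      by (rule low)
    moreover have "v \<bullet> (S *v w) = w \<bullet> (S *v v)"
      by (rule inner_symmetric[OF sym])
    moreover have "w \<bullet> (S *v v) = w \<bullet> w + l * (w \<bullet> v)"
      by (simp add: w_def inner_diff_right)
    ultimately show "0 \<le> 2 * t * (w \<bullet> w) + t\<^sup>2 * (w \<bullet> (S *v w) - l * (w \<bullet> w))"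
      by (simp add: matrix_vector_right_distrib matrix_vector_mult_scaleR inner_add_left
          inner_add_right vv l_def[symmetric] inner_commute[of v w] power2_eq_square algebra_simps)
  qed
  then have "S *v v = l *s v"
    by (simp add: w_def scalar_mult_eq_scaleR)
  moreover have "v \<noteq> 0"
    using vv by auto
  ultimately show ?thesis
    using low by blast
qed

section \<open>The smallest singular value\<close>

context
  fixes M :: "real^'n^'m"
begin

lemma symmetric_gram: "transpose (M ** transpose M) = M ** transpose M"
  by (simp add: matrix_transpose_mul)

lemma gram_quad: "y \<bullet> ((M ** transpose M) *v y) = (norm (transpose M *v y))\<^sup>2"
  using quad_mult[of y "transpose M" "transpose M" y] by (simp add: dot_square_norm)

text \<open>The Gram spectrum is finite, nonempty and nonnegative. Hence \<open>Min\<close> is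
  attained and squaring undoes the square root in the definition.\<close>

lemma sigma_min_in_spectrum: "(sigma_min M)\<^sup>2 \<in> real_spectrum (M ** transpose M)"
  and sigma_min_nonneg: "0 \<le> sigma_min M"
  and sigma_min_le: "l \<in> real_spectrum (M ** transpose M) \<Longrightarrow> (sigma_min M)\<^sup>2 \<le> l"
proof -
  let ?S = "real_spectrum (M ** transpose M)"
  have ne: "?S \<noteq> {}"
    using lowest_eigenvalue[OF symmetric_gram] by (auto simp: real_spectrum_def)
  have nonneg: "0 \<le> l" if "l \<in> ?S" for l
  proof -
    obtain v where v: "v \<noteq> 0" "(M ** transpose M) *v v = l *s v"
      using \<open>l \<in> ?S\<close> by (auto simp: real_spectrum_def)
    have "l * (v \<bullet> v) = (norm (transpose M *v v))\<^sup>2"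
      using gram_quad[of v] unfolding v(2) by (simp add: scalar_mult_eq_scaleR)
    then have "0 \<le> l * (v \<bullet> v)" "0 < v \<bullet> v"
      using v(1) by simp_all
    then show ?thesis
      by (auto simp: zero_le_mult_iff)
  qed
  have Min: "Min ?S \<in> ?S"
    using Min_in[OF finite_real_spectrum ne] .
  then have sq: "(sigma_min M)\<^sup>2 = Min ?S"
    using nonneg by (simp add: sigma_min_def)
  show "(sigma_min M)\<^sup>2 \<in> ?S"
    using Min sq by simp
  show "0 \<le> sigma_min M"
    using nonneg[OF Min] by (simp add: sigma_min_def)
  show "(sigma_min M)\<^sup>2 \<le> l" if "l \<in> ?S"
    unfolding sq using that by (intro Min_le finite_real_spectrum)
qed

lemma sigma_min_transpose_lower: "(sigma_min M)\<^sup>2 * (y \<bullet> y) \<le> (norm (transpose M *v y))\<^sup>2"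
proof -
  obtain l v where l: "v \<noteq> 0" "(M ** transpose M) *v v = l *s v"
      "\<And>x. l * (x \<bullet> x) \<le> x \<bullet> ((M ** transpose M) *v x)"
    using lowest_eigenvalue[OF symmetric_gram] by blast
  then have "(sigma_min M)\<^sup>2 \<le> l"
    by (intro sigma_min_le) (auto simp: real_spectrum_def)
  then have "(sigma_min M)\<^sup>2 * (y \<bullet> y) \<le> l * (y \<bullet> y)"
    by (intro mult_right_mono) auto
  with l(3)[of y] show ?thesis
    by (simp add: gram_quad)
qed

lemma sigma_min_pos:
  assumes "\<And>y. transpose M *v y = 0 \<Longrightarrow> y = 0"
  shows "0 < sigma_min M"
proof -
  obtain v where v: "v \<noteq> 0" "(M ** transpose M) *v v = (sigma_min M)\<^sup>2 *s v"
    using sigma_min_in_spectrum by (auto simp: real_spectrum_def)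
  have "transpose M *v v \<noteq> 0"
    using assms v(1) by blast
  then have "0 < (sigma_min M)\<^sup>2 * (v \<bullet> v)"
    using gram_quad[of v] unfolding v(2) by (simp add: scalar_mult_eq_scaleR)
  then have "sigma_min M \<noteq> 0"
    by auto
  with sigma_min_nonneg show ?thesis
    by simp
qed

end

text \<open>The lowest eigenvalue \<open>l\<close> of \<open>S\<close> is positive and makes
  \<open>l\<^sup>2\<close> an eigenvalue of \<open>S ** transpose S\<close>, so
  \<open>sigma_min S \<le> l\<close>, which is the direction that the bound on the form
  requires.\<close>

lemma sigma_min_posdef:
  assumes "sym_posdef S"
  shows "0 < sigma_min S" and "sigma_min S * (x \<bullet> x) \<le> x \<bullet> (S *v x)"
proof -
  have sym: "transpose S = S" and pos: "\<And>x. x \<noteq> 0 \<Longrightarrow> 0 < x \<bullet> (S *v x)"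
    using assms by (auto simp: sym_posdef_def)
  show "0 < sigma_min S"
  proof (rule sigma_min_pos)
    fix y assume "transpose S *v y = 0"
    then have "S *v y = 0"
      unfolding sym .
    then show "y = 0"
      using pos[of y] by auto
  qed
  obtain l v where l: "v \<noteq> 0" "S *v v = l *s v" "\<And>x. l * (x \<bullet> x) \<le> x \<bullet> (S *v x)"
    using lowest_eigenvalue[OF sym] by blast
  have "l * (v \<bullet> v) > 0"
    using pos[OF l(1)] unfolding l(2) by (simp add: scalar_mult_eq_scaleR)
  then have "l > 0"
    using l(1) by (intro zero_less_mult_pos2[of l "v \<bullet> v"]) auto
  have "(S ** transpose S) *v v = l\<^sup>2 *s v"
    unfolding sym matrix_vector_mul_assoc[symmetric] l(2) vector_scalar_commute
    by (simp add: power2_eq_square vec.scale_scale)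
  then have "(sigma_min S)\<^sup>2 \<le> l\<^sup>2"
    using l(1) by (intro sigma_min_le) (auto simp: real_spectrum_def)
  then have "sigma_min S \<le> l"
    using power2_le_imp_le[of "sigma_min S" l] \<open>l > 0\<close> by simp
  then have "sigma_min S * (x \<bullet> x) \<le> l * (x \<bullet> x)"
    by (intro mult_right_mono) auto
  with l(3)[of x] show "sigma_min S * (x \<bullet> x) \<le> x \<bullet> (S *v x)"
    by simp
qed

section \<open>Operator norm and estimates of bilinear terms\<close>

lemma norm_op_norm: "norm (M *v x) \<le> op_norm M * norm x"
  unfolding op_norm_def by (rule onorm) simp

lemma op_norm_nonneg: "0 \<le> op_norm M"
  unfolding op_norm_def by (rule onorm_pos_le) simp

lemma op_norm_quad: "x \<bullet> (S *v x) \<le> op_norm S * (x \<bullet> x)"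
proof -
  have "x \<bullet> (S *v x) \<le> norm x * (op_norm S * norm x)"
    by (rule order_trans[OF norm_cauchy_schwarz mult_left_mono[OF norm_op_norm]]) simp
  then show ?thesis
    by (simp add: dot_square_norm power2_eq_square mult_ac)
qed

text \<open>Nonnegativity of the form at \<open>a - e b\<close>. The weight becomes
  \<open>\<theta>\<close> in the stability margin and \<open>norm E\<close> in the bound on the
  derivative of \<open>P\<close>.\<close>

lemma psd_AM_GM:
  assumes "psd S" "transpose S = S" "0 < e"
  shows "2 * (a \<bullet> (S *v b)) \<le> (a \<bullet> (S *v a)) / e + e * (b \<bullet> (S *v b))"
proof -
  have "0 \<le> (a - e *\<^sub>R b) \<bullet> (S *v (a - e *\<^sub>R b))"
    using assms(1) by (simp add: psd_def)
  also have "\<dots> = (a \<bullet> (S *v a)) - 2 * e * (a \<bullet> (S *v b)) + e\<^sup>2 * (b \<bullet> (S *v b))"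
    by (simp add: matrix_vector_mult_diff_distrib matrix_vector_mult_scaleR inner_diff_left
        inner_diff_right inner_symmetric[OF assms(2), of b a] power2_eq_square algebra_simps)
  finally have "2 * (a \<bullet> (S *v b)) * e \<le> (a \<bullet> (S *v a)) + e\<^sup>2 * (b \<bullet> (S *v b))"
    by (simp add: mult_ac)
  then have "2 * (a \<bullet> (S *v b)) \<le> ((a \<bullet> (S *v a)) + e\<^sup>2 * (b \<bullet> (S *v b))) / e"
    using assms(3) by (simp add: pos_le_divide_eq)
  also have "\<dots> = (a \<bullet> (S *v a)) / e + e * (b \<bullet> (S *v b))"
    using assms(3) by (simp add: field_simps power2_eq_square)
  finally show ?thesis .
qed

text \<open>Polarization and the parallelogram law. It serves the derivative of \<open>P\<close>,
  which is symmetric but may be indefinite, so that Cauchy-Schwarz for a semidefinite form does not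
  apply.\<close>

lemma polarization_bound:
  fixes U :: "real^'n^'n"
  assumes "transpose U = U" and bound: "\<And>x. \<bar>x \<bullet> (U *v x)\<bar> \<le> c * (x \<bullet> x)"
  shows "2 * (a \<bullet> (U *v b)) \<le> c * (a \<bullet> a + b \<bullet> b)"
proof -
  have "4 * (a \<bullet> (U *v b)) = (a + b) \<bullet> (U *v (a + b)) - (a - b) \<bullet> (U *v (a - b))"
    by (simp add: matrix_vector_mult_diff_distrib matrix_vector_right_distrib inner_diff_left
        inner_diff_right inner_add_left inner_add_right inner_symmetric[OF assms(1), of b a])
  also have "\<dots> \<le> c * ((a + b) \<bullet> (a + b)) + c * ((a - b) \<bullet> (a - b))"
    using bound[of "a + b"] bound[of "a - b"] by linarith
  also have "\<dots> = 2 * (c * (a \<bullet> a + b \<bullet> b))"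
    by (simp add: inner_diff_left inner_diff_right inner_add_left inner_add_right algebra_simps)
  finally show ?thesis
    by simp
qed

section \<open>Cost and Lyapunov matrices of a stabilizing gain\<close>

locale output_feedback =
  fixes A :: "real^'n^'n" and B :: "real^'m^'n" and C :: "real^'n^'d"
    and Q :: "real^'n^'n" and R :: "real^'m^'m" and D :: "(real^'n) measure"
  assumes Q: "sym_posdef Q" and R: "sym_posdef R" and X0: "sym_posdef (init_corr D)"
begin

abbreviation X\<^sub>0 where "X\<^sub>0 \<equiv> init_corr D"
abbreviation Acl where "Acl \<equiv> closed_loop A B C"
abbreviation J where "J \<equiv> sof_cost A B C Q R D"
abbreviation stab where "stab K \<equiv> spec_radius (Acl K) < 1"

definition Qcl :: "real^'d^'m \<Rightarrow> real^'n^'n" where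
  "Qcl K = Q + transpose C ** transpose K ** R ** K ** C"

text \<open>The transposed closed loop appears because costs propagate backward along the
  trajectory.\<close>

definition P :: "real^'d^'m \<Rightarrow> real^'n^'n" where
  "P K = dlyap (transpose (Acl K)) (Qcl K)"

definition \<Sigma> :: "real^'d^'m \<Rightarrow> real^'n^'n" where
  "\<Sigma> K = dlyap (Acl K) X\<^sub>0"

lemma stabilizing_iff: "K \<in> stabilizing A B C \<longleftrightarrow> stab K"
  by (simp add: stabilizing_def)

lemma weights_symmetric: "transpose Q = Q" "transpose R = R" "transpose X\<^sub>0 = X\<^sub>0"
  using Q R X0 by (auto simp: sym_posdef_def)

lemma psd_R: "psd R"
  unfolding psd_def using R by (metis inner_zero_left less_eq_real_def sym_posdef_def)

lemma Qcl_quad: "x \<bullet> (Qcl K *v x) = x \<bullet> (Q *v x) + (K *v (C *v x)) \<bullet> (R *v (K *v (C *v x)))"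
proof -
  have "Qcl K = Q + transpose (K ** C) ** (R ** (K ** C))"
    by (simp add: Qcl_def matrix_transpose_mul matrix_mul_assoc)
  then show ?thesis
    by (simp only: matrix_vector_mult_add_rdistrib inner_add_right quad_mult)
      (simp add: matrix_vector_mul_assoc matrix_mul_assoc)
qed

lemma Qcl_ge: "x \<bullet> (Q *v x) \<le> x \<bullet> (Qcl K *v x)"
  using psd_R by (simp add: Qcl_quad psd_def)

lemma Q_ge: "sigma_min Q * (x \<bullet> x) \<le> x \<bullet> (Q *v x)" and sQ_pos: "0 < sigma_min Q"
  using sigma_min_posdef[OF Q] by auto

lemma mu_pos: "0 < sigma_min X\<^sub>0" and X0_ge: "sigma_min X\<^sub>0 * (x \<bullet> x) \<le> x \<bullet> (X\<^sub>0 *v x)"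
  using sigma_min_posdef[OF X0] by auto

lemma psd_Qcl: "psd (Qcl K)"
  unfolding psd_def
proof
  fix x :: "real^'n"
  have "0 \<le> sigma_min Q * (x \<bullet> x)"
    using sQ_pos by simp
  also have "\<dots> \<le> x \<bullet> (Qcl K *v x)"
    using Q_ge Qcl_ge order_trans by blast
  finally show "0 \<le> x \<bullet> (Qcl K *v x)" .
qed

lemma transpose_Qcl: "transpose (Qcl K) = Qcl K"
  by (simp add: Qcl_def matrix_simps weights_symmetric)

lemma psd_P: "stab K \<Longrightarrow> psd (P K)"
  unfolding P_def by (intro psd_dlyap psd_Qcl spec_radius_transpose_less_one)

lemma transpose_P: "stab K \<Longrightarrow> transpose (P K) = P K"
  unfolding P_def by (subst transpose_dlyap) (simp_all add: spec_radius_transpose_less_one transpose_Qcl)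

lemma transpose_\<Sigma>: "stab K \<Longrightarrow> transpose (\<Sigma> K) = \<Sigma> K"
  unfolding \<Sigma>_def by (simp add: transpose_dlyap weights_symmetric)

lemma P_eq: "stab K \<Longrightarrow> P K = Qcl K + transpose (Acl K) ** P K ** Acl K"
  unfolding P_def using dlyap_eq[OF spec_radius_transpose_less_one, of "Acl K" "Qcl K"] by simp

lemma \<Sigma>_eq: "stab K \<Longrightarrow> \<Sigma> K = X\<^sub>0 + Acl K ** \<Sigma> K ** transpose (Acl K)"
  unfolding \<Sigma>_def by (rule dlyap_eq)

lemma P_quad:
  assumes "stab K"
  shows "x \<bullet> (P K *v x) = x \<bullet> (Qcl K *v x) + (Acl K *v x) \<bullet> (P K *v (Acl K *v x))"
proof -
  have "x \<bullet> (P K *v x) = x \<bullet> ((Qcl K + transpose (Acl K) ** (P K ** Acl K)) *v x)"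
    using P_eq[OF assms] by (simp add: matrix_mul_assoc)
  then show ?thesis
    by (simp only: matrix_vector_mult_add_rdistrib inner_add_right quad_mult) (simp add: matrix_vector_mul_assoc)
qed

text \<open>Otherwise the default value of the integral would make \<open>X\<^sub>0\<close> the zero
  matrix, contradicting positive definiteness.\<close>

lemma integrable_outer: "integrable D (\<lambda>x. outer x x)"
proof (rule ccontr)
  assume "\<not> ?thesis"
  then have "X\<^sub>0 = 0"
    by (simp add: init_corr_def not_integrable_integral_eq)
  moreover have "axis undefined 1 \<noteq> (0::real^'n)"
    by (simp add: axis_eq_0_iff)
  ultimately show False
    using X0 unfolding sym_posdef_def by (metis matrix_vector_mult_0 inner_zero_right less_irrefl)
qed

lemma X0_inner: "X\<^sub>0 \<bullet> T = (LINT x|D. outer x x \<bullet> T)"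
  unfolding init_corr_def by (rule integral_inner_left[OF integrable_outer, symmetric])

lemma X0_inner_nonneg: "psd T \<Longrightarrow> 0 \<le> X\<^sub>0 \<bullet> T"
  unfolding X0_inner by (rule Bochner_Integration.integral_nonneg) (simp add: inner_outer psd_def)

lemma \<Sigma>_inner: "stab K \<Longrightarrow> \<Sigma> K \<bullet> T = X\<^sub>0 \<bullet> dlyap (transpose (Acl K)) T"
  unfolding \<Sigma>_def by (rule dlyap_adjoint)

text \<open>By adjointness the comparison moves to \<open>X\<^sub>0\<close>, and the Lyapunov
  operator preserves semidefiniteness. The later estimates of the cost are pointwise inequalities
  between quadratic forms, integrated by this lemma.\<close>

lemma \<Sigma>_mono:
  assumes "stab K" and "\<And>x. x \<bullet> (S *v x) \<le> x \<bullet> (T *v x)"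
  shows "\<Sigma> K \<bullet> S \<le> \<Sigma> K \<bullet> T"
proof -
  have "psd (T - S)"
    using assms(2) by (simp add: psd_def matrix_vector_mult_diff_rdistrib inner_diff_right)
  then have "0 \<le> X\<^sub>0 \<bullet> dlyap (transpose (Acl K)) (T - S)"
    by (intro X0_inner_nonneg psd_dlyap spec_radius_transpose_less_one assms(1))
  then show ?thesis
    by (simp flip: \<Sigma>_inner[OF assms(1)] add: inner_diff_right)
qed

lemma X0_mono:
  assumes "\<And>x. x \<bullet> (S *v x) \<le> x \<bullet> (T *v x)"
  shows "X\<^sub>0 \<bullet> S \<le> X\<^sub>0 \<bullet> T"
proof -
  have "0 \<le> X\<^sub>0 \<bullet> (T - S)"
    using assms by (intro X0_inner_nonneg) (simp add: psd_def matrix_vector_mult_diff_rdistrib inner_diff_right)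
  then show ?thesis
    by (simp add: inner_diff_right)
qed

text \<open>For each initial state the stage costs sum to a linear functional of
  \<open>outer x0 x0\<close>, so the expectation only meets the second moment of the initial
  distribution.\<close>

lemma J_eq:
  assumes "stab K"
  shows "J K = X\<^sub>0 \<bullet> P K"
proof -
  have "(\<Sum>t. let x = traj (Acl K) x0 t in
          x \<bullet> ((Q + transpose C ** transpose K ** R ** K ** C) *v x)) = outer x0 x0 \<bullet> P K" for x0
  proof -
    have "(let x = traj (Acl K) x0 t in
          x \<bullet> ((Q + transpose C ** transpose K ** R ** K ** C) *v x))
        = outer x0 x0 \<bullet> (mat_pow (transpose (Acl K)) t ** Qcl K ** transpose (mat_pow (transpose (Acl K)) t))" for t
    proof -
      let ?M = "mat_pow (Acl K) t"
      have "outer x0 x0 \<bullet> (mat_pow (transpose (Acl K)) t ** Qcl K ** transpose (mat_pow (transpose (Acl K)) t))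
          = x0 \<bullet> ((transpose ?M ** (Qcl K ** ?M)) *v x0)"
        by (simp only: inner_outer mat_pow_transpose transpose_transpose matrix_mul_assoc)
      also have "\<dots> = (?M *v x0) \<bullet> (Qcl K *v (?M *v x0))"
        by (simp only: quad_mult matrix_vector_mul_assoc)
      finally show ?thesis
        by (simp add: Let_def traj_eq Qcl_def)
    qed
    then show ?thesis
      unfolding P_def dlyap_def
      by (simp add: bounded_linear.suminf[OF bounded_linear_inner_right
            summable_dlyap[OF spec_radius_transpose_less_one[OF assms]]])
  qed
  then show ?thesis
    by (simp only: sof_cost_def X0_inner)
qed

lemma state_corr_eq:
  assumes "stab K"
  shows "state_corr A B C D K = \<Sigma> K"
proof -
  have "(\<Sum>t. let x = traj (Acl K) x0 t in outer x x) = dlyap (Acl K) (outer x0 x0)" for x0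
    by (simp only: Let_def traj_eq outer_mult dlyap_def)
  then show ?thesis
    using integral_bounded_linear[OF bounded_linear_dlyap[OF assms] integrable_outer]
    by (simp add: state_corr_def \<Sigma>_def init_corr_def)
qed

lemma \<Sigma>_Qcl: "stab K \<Longrightarrow> \<Sigma> K \<bullet> Qcl K = J K"
  by (simp add: J_eq \<Sigma>_inner P_def)

text \<open>Source of the factor \<open>\<alpha> / sigma_min Q\<close> in \<open>L\<close>.\<close>

lemma trace_\<Sigma>:
  assumes "stab K"
  shows "sigma_min Q * (\<Sigma> K \<bullet> mat 1) \<le> J K"
proof -
  have "\<Sigma> K \<bullet> (sigma_min Q *\<^sub>R mat 1) \<le> \<Sigma> K \<bullet> Qcl K"
    using order_trans[OF Q_ge Qcl_ge] by (intro \<Sigma>_mono assms) (simp add: scaleR_matrix_vec)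
  then show ?thesis
    using \<Sigma>_Qcl[OF assms] by simp
qed

text \<open>The trace of the Lyapunov equation: shifting the trajectory by one step drops the
  initial term. It later removes \<open>Acl K\<close> from the bound on the second derivative
  without a bound on its norm.\<close>

lemma \<Sigma>_gram_Acl:
  assumes "stab K"
  shows "\<Sigma> K \<bullet> (transpose (Acl K) ** Acl K) \<le> \<Sigma> K \<bullet> mat 1"
proof -
  have "\<Sigma> K \<bullet> mat 1 = (X\<^sub>0 + Acl K ** \<Sigma> K ** transpose (Acl K)) \<bullet> mat 1"
    using \<Sigma>_eq[OF assms] by simp
  also have "\<dots> = X\<^sub>0 \<bullet> mat 1 + \<Sigma> K \<bullet> (transpose (Acl K) ** Acl K)"
    by (simp add: inner_add_left inner_congruence)
  finally show ?thesis
    using X0_inner_nonneg[OF psd_mat_1] by simp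
qed

lemma \<Sigma>_vec_ge:
  assumes "stab K"
  shows "sigma_min X\<^sub>0 * (x \<bullet> x) \<le> x \<bullet> (\<Sigma> K *v x)"
proof -
  have "psd X\<^sub>0"
    using X0 unfolding psd_def sym_posdef_def by (metis inner_zero_left less_eq_real_def)
  then have "0 \<le> (transpose (Acl K) *v x) \<bullet> (\<Sigma> K *v (transpose (Acl K) *v x))"
    using psd_dlyap[OF assms] unfolding \<Sigma>_def psd_def by blast
  also have "\<dots> = x \<bullet> ((Acl K ** (\<Sigma> K ** transpose (Acl K))) *v x)"
    using quad_mult[of x "transpose (Acl K)" "\<Sigma> K ** transpose (Acl K)" x]
    by (simp add: matrix_vector_mul_assoc[symmetric])
  finally have "x \<bullet> (X\<^sub>0 *v x) \<le> x \<bullet> ((X\<^sub>0 + Acl K ** \<Sigma> K ** transpose (Acl K)) *v x)"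
    by (simp add: matrix_vector_mult_add_rdistrib inner_add_right matrix_mul_assoc)
  then show ?thesis
    using X0_ge[of x] \<Sigma>_eq[OF assms] by simp
qed

lemma \<Sigma>_trace_ge: "stab K \<Longrightarrow> sigma_min X\<^sub>0 \<le> \<Sigma> K \<bullet> mat 1"
proof -
  assume "stab K"
  define u :: "real^'n" where "u = axis undefined 1"
  have u: "u \<bullet> u = 1"
    by (simp add: u_def inner_axis_axis)
  have "\<Sigma> K \<bullet> outer u u \<le> \<Sigma> K \<bullet> mat 1"
  proof (rule \<Sigma>_mono[OF \<open>stab K\<close>])
    show "x \<bullet> (outer u u *v x) \<le> x \<bullet> (mat 1 *v x)" for x
      using Cauchy_Schwarz_ineq[of u x] u by (simp add: outer_vec power2_eq_square inner_commute)
  qed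
  then show ?thesis
    using \<Sigma>_vec_ge[OF \<open>stab K\<close>, of u] u by (simp add: inner_commute[of "\<Sigma> K"] inner_outer)
qed

text \<open>This floor under every cost makes \<open>\<alpha>\<close> large enough for
  \<open>zeta1\<close> to be nonnegative.\<close>

lemma J_ge: "stab K \<Longrightarrow> sigma_min Q * sigma_min X\<^sub>0 \<le> J K"
  using trace_\<Sigma>[of K] \<Sigma>_trace_ge[of K] sQ_pos
  by (meson less_imp_le mult_left_mono order_trans)

lemma J_pos: "stab K \<Longrightarrow> 0 < J K"
  using J_ge[of K] sQ_pos mu_pos by (meson mult_pos_pos less_le_trans)

text \<open>
  With \<open>a = u \<bullet> P u\<close>, nonnegativity of the form \<open>P\<close> at \<open>x - (x \<bullet> P u / a) u\<close> bounds \<open>P\<close> from below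
  by the rank one form of \<open>P u\<close> scaled by \<open>1 / a\<close>.
\<close>

lemma P_le:
  assumes "stab K"
  shows "u \<bullet> (P K *v u) \<le> J K / sigma_min X\<^sub>0 * (u \<bullet> u)"
proof (cases "u \<bullet> (P K *v u) \<le> 0")
  case True
  have "0 \<le> J K / sigma_min X\<^sub>0 * (u \<bullet> u)"
    using J_pos[OF assms] mu_pos by simp
  with True show ?thesis
    by linarith
next
  case False
  define a where "a = u \<bullet> (P K *v u)"
  define w where "w = P K *v u"
  have "0 < a"
    using False by (simp add: a_def)
  have "x \<bullet> ((1 / a) *\<^sub>R outer w w *v x) \<le> x \<bullet> (P K *v x)" for x
  proof -
    define s where "s = (w \<bullet> x) / a"
    have ux: "u \<bullet> (P K *v x) = w \<bullet> x" "x \<bullet> (P K *v u) = w \<bullet> x"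
      using inner_symmetric[OF transpose_P[OF assms], of u x] by (simp_all add: w_def inner_commute)
    have "0 \<le> (x - s *\<^sub>R u) \<bullet> (P K *v (x - s *\<^sub>R u))"
      using psd_P[OF assms] by (simp add: psd_def)
    also have "\<dots> = x \<bullet> (P K *v x) - 2 * s * (w \<bullet> x) + s\<^sup>2 * a"
      by (simp add: matrix_vector_mult_diff_distrib matrix_vector_mult_scaleR inner_diff_left
          inner_diff_right ux a_def[symmetric] power2_eq_square algebra_simps)
    also have "\<dots> = x \<bullet> (P K *v x) - (w \<bullet> x)\<^sup>2 / a"
      using \<open>0 < a\<close> by (simp add: s_def field_simps power2_eq_square)
    finally show ?thesis
      by (simp add: scaleR_matrix_vec outer_vec power2_eq_square inner_commute)
  qed
  then have "X\<^sub>0 \<bullet> ((1 / a) *\<^sub>R outer w w) \<le> J K"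
    unfolding J_eq[OF assms] by (rule X0_mono)
  then have "(w \<bullet> (X\<^sub>0 *v w)) / a \<le> J K"
    by (simp add: inner_commute[of X\<^sub>0] inner_outer)
  then have "w \<bullet> (X\<^sub>0 *v w) \<le> J K * a"
    using \<open>0 < a\<close> by (simp add: pos_divide_le_eq)
  then have "sigma_min X\<^sub>0 * (w \<bullet> w) \<le> J K * a"
    using X0_ge[of w] by simp
  then have "sigma_min X\<^sub>0 * (w \<bullet> w) * (u \<bullet> u) \<le> J K * a * (u \<bullet> u)"
    by (rule mult_right_mono) simp
  moreover have "a * a \<le> (w \<bullet> w) * (u \<bullet> u)"
    using Cauchy_Schwarz_ineq[of u w] by (simp add: a_def w_def power2_eq_square mult.commute)
  then have "sigma_min X\<^sub>0 * (a * a) \<le> sigma_min X\<^sub>0 * ((w \<bullet> w) * (u \<bullet> u))"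
    using mu_pos by (intro mult_left_mono) auto
  ultimately have "(sigma_min X\<^sub>0 * a) * a \<le> (J K * (u \<bullet> u)) * a"
    by (simp add: mult_ac)
  then have "sigma_min X\<^sub>0 * a \<le> J K * (u \<bullet> u)"
    using \<open>0 < a\<close> by (rule mult_right_le_imp_le)
  then show ?thesis
    using mu_pos by (simp add: a_def field_simps)
qed

lemma Acl_vec: "Acl K *v x = A *v x - B *v (K *v (C *v x))"
  by (simp add: closed_loop_def matrix_vector_mult_diff_rdistrib matrix_vector_mul_assoc matrix_mul_assoc)

lemma Acl_diff: "Acl K' *v x = Acl K *v x - B *v ((K' - K) *v (C *v x))"
  by (simp add: Acl_vec matrix_vector_mult_diff_rdistrib matrix_vector_mult_diff_distrib)

lemma norm_BKC: "norm (B *v (K *v (C *v x))) \<le> op_norm B * norm K * op_norm C * norm x"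
proof -
  have "norm (B *v (K *v (C *v x))) \<le> op_norm B * (norm K * (op_norm C * norm x))"
    by (intro order_trans[OF norm_op_norm] order_trans[OF norm_matrix_vector_mult] mult_left_mono
        norm_op_norm op_norm_nonneg) simp_all
  then show ?thesis
    by (simp add: mult_ac)
qed

text \<open>
  Gains of cost at most \<open>\<alpha>\<close> keep a uniform distance from the boundary of the stabilizing set:
  \<open>P\<close> remains a Lyapunov function for nearby gains.
\<close>

lemma stab_neighbourhood:
  obtains \<delta> where "0 < \<delta>"
    "\<And>K K'. stab K \<Longrightarrow> J K \<le> \<alpha> \<Longrightarrow> norm (K' - K) < \<delta> \<Longrightarrow> stab K'"
proof (cases "0 < \<alpha>")
  case False
  then show ?thesis
    using that[of 1] J_pos by (metis less_le_trans zero_less_one)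
next
  case True
  \<comment> \<open>\<open>\<beta>\<close> bounds \<open>P\<close> on the whole sublevel set. The
    weight satisfies \<open>\<theta> * \<beta> = \<sigma> / 2\<close>, so the mixed term spends half
    of the Lyapunov decrease \<open>\<sigma> * (x \<bullet> x)\<close>; the radius
    \<open>\<delta>\<close> keeps the quadratic term below the other half, with \<open>k + 1\<close>
    avoiding a zero denominator. No constant depends on the gain.\<close>
  define \<sigma> \<beta> \<theta> where "\<sigma> = sigma_min Q" and "\<beta> = \<alpha> / sigma_min X\<^sub>0" and "\<theta> = \<sigma> / (2 * \<beta>)"
  define k where "k = (1 + 1 / \<theta>) * \<beta> * (op_norm B * op_norm C)\<^sup>2"
  have pos: "0 < \<sigma>" "0 < \<beta>" "0 < \<theta>"
    using True sQ_pos mu_pos by (simp_all add: \<sigma>_def \<beta>_def \<theta>_def)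
  have "0 \<le> k"
    using pos by (simp add: k_def)
  define \<delta> where "\<delta> = sqrt (\<sigma> / (2 * (k + 1)))"
  have "0 < \<delta>"
    using pos \<open>0 \<le> k\<close> by (simp add: \<delta>_def)
  moreover have "stab K'" if K: "stab K" "J K \<le> \<alpha>" and near: "norm (K' - K) < \<delta>" for K K'
  proof (rule spec_radius_less_oneI)
    show "0 \<le> x \<bullet> (P K *v x)" for x
      using psd_P[OF K(1)] by (simp add: psd_def)
    fix x :: "real^'n" assume "x \<noteq> 0"
    then have x: "0 < x \<bullet> x"
      by simp
    define q where "q y = y \<bullet> (P K *v y)" for y
    have q_le: "q y \<le> \<beta> * (y \<bullet> y)" for y
    proof -
      have "J K / sigma_min X\<^sub>0 * (y \<bullet> y) \<le> \<beta> * (y \<bullet> y)"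
        unfolding \<beta>_def using K(2) mu_pos by (intro mult_right_mono divide_right_mono) auto
      then show ?thesis
        using P_le[OF K(1), of y] by (simp add: q_def)
    qed
    define m d where "m = Acl K *v x" and "d = B *v ((K' - K) *v (C *v x))"
    have "q (Acl K' *v x) = q m - 2 * (d \<bullet> (P K *v m)) + q d"
      unfolding Acl_diff[of K' x K] q_def m_def[symmetric] d_def[symmetric]
      by (simp add: matrix_vector_mult_diff_distrib inner_diff_left inner_diff_right
          inner_symmetric[OF transpose_P[OF K(1)], of m d])
    moreover have "- (2 * (d \<bullet> (P K *v m))) \<le> q d / \<theta> + \<theta> * q m"
      using psd_AM_GM[OF psd_P[OF K(1)] transpose_P[OF K(1)] pos(3), of "- d" m]
      by (simp add: q_def vec.neg)
    ultimately have 1: "q (Acl K' *v x) \<le> (1 + \<theta>) * q m + (1 + 1 / \<theta>) * q d"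
      by (simp add: distrib_right)
    have "q m = q x - x \<bullet> (Qcl K *v x)"
      using P_quad[OF K(1), of x] by (simp add: q_def m_def)
    moreover have "\<sigma> * (x \<bullet> x) \<le> x \<bullet> (Qcl K *v x)"
      unfolding \<sigma>_def using Q_ge Qcl_ge order_trans by blast
    ultimately have 2: "q m \<le> q x - \<sigma> * (x \<bullet> x)"
      by linarith
    have "(1 + \<theta>) * q m \<le> (1 + \<theta>) * (q x - \<sigma> * (x \<bullet> x))"
      using 2 pos by (intro mult_left_mono) auto
    also have "\<dots> = q x + \<theta> * q x - \<sigma> * (x \<bullet> x) - \<theta> * (\<sigma> * (x \<bullet> x))"
      by (simp add: algebra_simps)
    also have "\<dots> \<le> q x + \<theta> * (\<beta> * (x \<bullet> x)) - \<sigma> * (x \<bullet> x) - 0"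
      using pos q_le[of x] by (intro diff_mono add_left_mono mult_left_mono mult_nonneg_nonneg) auto
    also have "\<theta> * (\<beta> * (x \<bullet> x)) = \<sigma> / 2 * (x \<bullet> x)"
      using pos by (simp add: \<theta>_def)
    finally have 3: "(1 + \<theta>) * q m \<le> q x - \<sigma> / 2 * (x \<bullet> x)"
      by simp
    have "norm d \<le> op_norm B * norm (K' - K) * op_norm C * norm x"
      unfolding d_def by (rule norm_BKC)
    then have "(norm d)\<^sup>2 \<le> (op_norm B * norm (K' - K) * op_norm C * norm x)\<^sup>2"
      by (rule power_mono) simp
    then have "d \<bullet> d \<le> (op_norm B * op_norm C)\<^sup>2 * (norm (K' - K))\<^sup>2 * (x \<bullet> x)"
      by (simp add: power_mult_distrib power2_norm_eq_inner mult_ac)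
    then have "q d \<le> \<beta> * ((op_norm B * op_norm C)\<^sup>2 * (norm (K' - K))\<^sup>2 * (x \<bullet> x))"
      using q_le[of d] pos by (meson less_imp_le mult_left_mono order_trans)
    then have "(1 + 1 / \<theta>) * q d \<le> (1 + 1 / \<theta>) * (\<beta> * ((op_norm B * op_norm C)\<^sup>2 * (norm (K' - K))\<^sup>2 * (x \<bullet> x)))"
      using pos by (intro mult_left_mono) auto
    also have "\<dots> = k * (norm (K' - K))\<^sup>2 * (x \<bullet> x)"
      by (simp add: k_def mult_ac)
    also have "\<dots> < \<sigma> / 2 * (x \<bullet> x)"
    proof (rule mult_strict_right_mono[OF _ x])
      have "(norm (K' - K))\<^sup>2 < \<delta>\<^sup>2"
        using near by (intro power_strict_mono) auto
      also have "\<delta>\<^sup>2 = \<sigma> / (2 * (k + 1))"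
        using pos \<open>0 \<le> k\<close> by (simp add: \<delta>_def)
      finally have "(k + 1) * (norm (K' - K))\<^sup>2 < \<sigma> / 2"
        using \<open>0 \<le> k\<close> by (simp add: field_simps)
      then show "k * (norm (K' - K))\<^sup>2 < \<sigma> / 2"
        using zero_le_power2[of "norm (K' - K)"] unfolding distrib_right by linarith
    qed
    finally have "q (Acl K' *v x) < q x"
      using 1 3 by linarith
    then show "(Acl K' *v x) \<bullet> (P K *v (Acl K' *v x)) < x \<bullet> (P K *v x)"
      by (simp add: q_def)
  qed
  ultimately show ?thesis
    using that by blast
qed

lemma eventually_stab:
  assumes "stab K"
  shows "\<forall>\<^sub>F K' in nhds K. stab K'"
proof -
  obtain \<delta> where "0 < \<delta>" "\<And>K''. norm (K'' - K) < \<delta> \<Longrightarrow> stab K''"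
    using stab_neighbourhood[of "J K"] assms by (metis order_refl)
  then show ?thesis
    unfolding eventually_nhds_metric by (auto simp: dist_norm)
qed

end

section \<open>Derivatives of the cost\<close>

lemma has_vector_derivative_dlyap:
  fixes M S :: "real \<Rightarrow> real^'n^'n"
  assumes M: "(M has_vector_derivative M') (at t)" and S: "(S has_vector_derivative S') (at t)"
    and stable: "\<forall>\<^sub>F s in nhds t. spec_radius (M s) < 1"
    and Z: "Z = dlyap (M t) (S t)"
  shows "((\<lambda>s. dlyap (M s) (S s)) has_vector_derivative
    dlyap (M t) (S' + (M' ** Z ** transpose (M t) + M t ** Z ** transpose M'))) (at t)"
proof -
  have lin: "linear (dlyap (M t))"
    using bounded_linear_dlyap[OF eventually_nhds_x_imp_x[OF stable]] bounded_linear.linear by blast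
  show ?thesis
    using has_derivative_dlyap[OF M[unfolded has_vector_derivative_def]
        S[unfolded has_vector_derivative_def] stable Z]
    unfolding has_vector_derivative_def transpose_scalar matrix_mult.scaleR_left
      matrix_mult.scaleR_right scaleR_add_right[symmetric] linear_scale[OF lin] .
qed

lemmas has_vector_derivative_matrix_mult =
  bounded_bilinear.has_vector_derivative[OF bounded_bilinear_matrix_mult]

lemmas has_vector_derivative_transpose =
  bounded_linear.has_vector_derivative[OF bounded_linear_transpose]

context output_feedback
begin

text \<open>Expanding \<open>Acl K\<close> turns this into
  \<open>(R + B^T P B) K C - B^T P A\<close>, the residual of the state feedback that is optimal for
  one step followed by the cost-to-go \<open>P K\<close>.\<close>

definition EK :: "real^'d^'m \<Rightarrow> real^'n^'m" where
  "EK K = R ** K ** C - transpose B ** P K ** Acl K"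

definition grad :: "real^'d^'m \<Rightarrow> real^'d^'m" where
  "grad K = 2 *\<^sub>R (EK K ** \<Sigma> K ** transpose C)"

section \<open>Gradient of the cost\<close>

lemma has_derivative_Acl: "(Acl has_derivative (\<lambda>H. - (B ** H ** C))) F"
proof -
  have "linear (\<lambda>H. B ** H ** C)"
    by (rule linearI) (simp_all add: matrix_simps)
  then have "((\<lambda>H. B ** H ** C) has_derivative (\<lambda>H. B ** H ** C)) F"
    by (simp add: linear_conv_bounded_linear bounded_linear_imp_has_derivative)
  then have "((\<lambda>H. A - B ** H ** C) has_derivative (\<lambda>H. 0 - B ** H ** C)) F"
    by (intro has_derivative_diff has_derivative_const)
  then show ?thesis
    by (simp add: closed_loop_def[abs_def])
qed

lemma has_derivative_Qcl:
  "(Qcl has_derivative (\<lambda>H. transpose C ** transpose H ** R ** K ** C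
     + transpose C ** transpose K ** R ** H ** C)) (at K)"
proof -
  have "((\<lambda>H. transpose H ** (R ** H)) has_derivative
      (\<lambda>H. transpose K ** (R ** H) + transpose H ** (R ** K))) (at K)"
    by (intro has_derivative_matrix_mult has_derivative_transpose has_derivative_ident
        bounded_linear.has_derivative[OF matrix_mult.bounded_linear_right])
  moreover have "bounded_linear (\<lambda>X. transpose C ** X ** C)"
    using bounded_linear_congruence[of "transpose C"] by simp
  ultimately have "((\<lambda>H. transpose C ** (transpose H ** (R ** H)) ** C) has_derivative
      (\<lambda>H. transpose C ** (transpose K ** (R ** H) + transpose H ** (R ** K)) ** C)) (at K)"
    using bounded_linear.has_derivative by blast
  then have "((\<lambda>H. Q + transpose C ** (transpose H ** (R ** H)) ** C) has_derivative
      (\<lambda>H. 0 + transpose C ** (transpose K ** (R ** H) + transpose H ** (R ** K)) ** C)) (at K)"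
    by (intro has_derivative_add has_derivative_const)
  then show ?thesis
    by (simp add: Qcl_def[abs_def] matrix_add_ldistrib matrix_add_rdistrib matrix_mul_assoc add.commute)
qed

lemma GDERIV_J:
  assumes "stab K"
  shows "GDERIV J K :> grad K"
proof -
  have stable: "\<forall>\<^sub>F K' in nhds K. spec_radius (transpose (Acl K')) < 1"
    using eventually_stab[OF assms] by eventually_elim (rule spec_radius_transpose_less_one)
  let ?S = "\<lambda>H. transpose C ** transpose H ** R ** K ** C + transpose C ** transpose K ** R ** H ** C"
  let ?\<Delta> = "\<lambda>H. - (B ** H ** C)"
  let ?T = "\<lambda>H. ?S H + (transpose (?\<Delta> H) ** P K ** Acl K + transpose (Acl K) ** P K ** ?\<Delta> H)"
  have "(P has_derivative (\<lambda>H. dlyap (transpose (Acl K)) (?T H))) (at K)"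
    using has_derivative_dlyap[OF has_derivative_transpose[OF has_derivative_Acl]
        has_derivative_Qcl stable P_def]
    unfolding P_def[abs_def, symmetric] transpose_transpose .
  then have "((\<lambda>K. X\<^sub>0 \<bullet> P K) has_derivative (\<lambda>H. X\<^sub>0 \<bullet> dlyap (transpose (Acl K)) (?T H))) (at K)"
    by (rule bounded_linear.has_derivative[OF bounded_linear_inner_right])
  moreover have "X\<^sub>0 \<bullet> dlyap (transpose (Acl K)) (?T H) = H \<bullet> grad K" for H
  proof -
    \<comment> \<open>The differentiated right-hand side is \<open>?Y\<close> plus its transpose;
      since \<open>\<Sigma> K\<close> is symmetric both contribute equally, whence the factor
      \<open>2\<close> in \<open>grad\<close>.\<close>
    let ?Y = "transpose C ** (transpose H ** EK K)"
    have "?T H = ?Y + transpose ?Y"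
      by (simp add: EK_def matrix_simps transpose_P[OF assms] weights_symmetric)
    then have "\<Sigma> K \<bullet> ?T H = \<Sigma> K \<bullet> ?Y + \<Sigma> K \<bullet> transpose ?Y"
      by (simp add: inner_add_right)
    also have "\<Sigma> K \<bullet> transpose ?Y = \<Sigma> K \<bullet> ?Y"
      by (metis inner_transpose transpose_\<Sigma>[OF assms])
    also have "\<Sigma> K \<bullet> ?Y = transpose H \<bullet> transpose (EK K ** \<Sigma> K ** transpose C)"
      unfolding inner_commute[of "\<Sigma> K"] inner_matrix_mult_left[of "transpose C"]
        inner_matrix_mult_right[of "transpose H"]
      by (simp add: matrix_transpose_mul transpose_\<Sigma>[OF assms] matrix_mul_assoc)
    also have "\<dots> = H \<bullet> (EK K ** \<Sigma> K ** transpose C)"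
      by (rule inner_transpose)
    finally show ?thesis
      by (simp add: \<Sigma>_inner[OF assms, symmetric] grad_def)
  qed
  ultimately have *: "((\<lambda>K. X\<^sub>0 \<bullet> P K) has_derivative (\<lambda>H. H \<bullet> grad K)) (at K)"
    by simp
  have "\<forall>\<^sub>F K' in at K. X\<^sub>0 \<bullet> P K' = J K'"
    using eventually_stab[OF assms, unfolded eventually_nhds_conv_at, THEN conjunct1]
    by eventually_elim (simp add: J_eq)
  then show ?thesis
    unfolding gderiv_def by (rule has_derivative_transform_eventually[OF *]) (simp_all add: J_eq assms)
qed

lemma gradient_J:
  assumes "stab K"
  shows "gradient J K = grad K"
  unfolding gradient_def
proof (rule the_equality)
  show "GDERIV J K :> grad K"
    by (rule GDERIV_J[OF assms])
  fix G assume "GDERIV J K :> G"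
  then have "(\<lambda>H. H \<bullet> G) = (\<lambda>H. H \<bullet> grad K)"
    using GDERIV_J[OF assms] unfolding gderiv_def by (rule has_derivative_unique)
  then show "G = grad K"
    by (metis vector_eq_ldot)
qed

text \<open>Derivative of \<open>P\<close> at \<open>K\<close> in direction \<open>E\<close>: it
  solves the Lyapunov equation of the same closed loop, with the right-hand side of the equation for
  \<open>P\<close> differentiated while \<open>P\<close> is held fixed.\<close>

definition P' :: "real^'d^'m \<Rightarrow> real^'d^'m \<Rightarrow> real^'n^'n" where
  "P' E K = dlyap (transpose (Acl K))
     (transpose C ** transpose E ** R ** K ** C + transpose C ** transpose K ** R ** E ** C
      - (transpose (B ** E ** C) ** P K ** Acl K + transpose (Acl K) ** P K ** (B ** E ** C)))"

section \<open>First and second derivatives along a line\<close>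

lemma Acl_line: "((\<lambda>s. transpose (Acl (K + s *\<^sub>R E))) has_vector_derivative - transpose (B ** E ** C)) (at t)"
proof -
  have "transpose (Acl (K + s *\<^sub>R E)) = transpose (Acl K) - s *\<^sub>R transpose (B ** E ** C)" for s
    by (simp add: closed_loop_def matrix_simps)
  moreover have "((\<lambda>s. transpose (Acl K) - s *\<^sub>R transpose (B ** E ** C)) has_vector_derivative
      0 - 1 *\<^sub>R transpose (B ** E ** C)) (at t)"
    by (auto intro!: derivative_eq_intros)
  ultimately show ?thesis
    by simp
qed

lemma eventually_stab_line:
  assumes "stab (K + t *\<^sub>R E)"
  shows "\<forall>\<^sub>F s in nhds t. stab (K + s *\<^sub>R E)"
proof -
  have "((\<lambda>s. K + s *\<^sub>R E) \<longlongrightarrow> K + t *\<^sub>R E) (nhds t)"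
    by (intro tendsto_intros filterlim_ident)
  then show ?thesis
    by (rule eventually_compose_filterlim[OF eventually_stab[OF assms]])
qed

lemma P_line:
  assumes "stab (K + t *\<^sub>R E)"
  shows "((\<lambda>s. P (K + s *\<^sub>R E)) has_vector_derivative P' E (K + t *\<^sub>R E)) (at t)"
proof -
  let ?K = "\<lambda>s. K + s *\<^sub>R E"
  have stable: "\<forall>\<^sub>F s in nhds t. spec_radius (transpose (Acl (?K s))) < 1"
    using eventually_stab_line[OF assms] by eventually_elim (rule spec_radius_transpose_less_one)
  have "((\<lambda>s. Qcl (?K s)) has_derivative (\<lambda>h. transpose C ** transpose (h *\<^sub>R E) ** R ** ?K t ** C
     + transpose C ** transpose (?K t) ** R ** (h *\<^sub>R E) ** C)) (at t)"
    by (rule has_derivative_compose[OF _ has_derivative_Qcl]) (auto intro!: derivative_eq_intros)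
  then have Qd: "((\<lambda>s. Qcl (?K s)) has_vector_derivative (transpose C ** transpose E ** R ** ?K t ** C
     + transpose C ** transpose (?K t) ** R ** E ** C)) (at t)"
    unfolding has_vector_derivative_def
    by (simp add: transpose_scalar matrix_mult.scaleR_left matrix_mult.scaleR_right scaleR_add_right)
  show ?thesis
    using has_vector_derivative_dlyap[OF Acl_line Qd stable P_def]
    by (simp add: P_def[symmetric] P'_def transpose_minus matrix_mult.minus_left matrix_mult.minus_right
        algebra_simps)
qed

text \<open>The second derivative along \<open>E\<close>, moved onto \<open>\<Sigma>\<close> by
  adjointness. The terms with \<open>P'\<close> are doubled because \<open>P'\<close> arises both
  from differentiating \<open>P\<close> in the source of its equation and from differentiating the
  closed loop in that equation.\<close>

definition J'' :: "real^'d^'m \<Rightarrow> real^'d^'m \<Rightarrow> real" where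
  "J'' E K = \<Sigma> K \<bullet> (2 *\<^sub>R (transpose (E ** C) ** R ** (E ** C))
      + 2 *\<^sub>R (transpose (B ** E ** C) ** P K ** (B ** E ** C))
      - 2 *\<^sub>R (transpose (B ** E ** C) ** P' E K ** Acl K + transpose (Acl K) ** P' E K ** (B ** E ** C)))"

lemma J_line:
  assumes "stab (K + t *\<^sub>R E)"
  shows "((\<lambda>s. J (K + s *\<^sub>R E)) has_real_derivative (X\<^sub>0 \<bullet> P' E (K + t *\<^sub>R E))) (at t)"
proof -
  have "((\<lambda>s. X\<^sub>0 \<bullet> P (K + s *\<^sub>R E)) has_vector_derivative (X\<^sub>0 \<bullet> P' E (K + t *\<^sub>R E))) (at t)"
    by (rule bounded_linear.has_vector_derivative[OF bounded_linear_inner_right P_line[OF assms]])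
  moreover have "\<forall>\<^sub>F s in nhds t. X\<^sub>0 \<bullet> P (K + s *\<^sub>R E) = J (K + s *\<^sub>R E)"
    using eventually_stab_line[OF assms] by eventually_elim (simp add: J_eq)
  ultimately show ?thesis
    using DERIV_cong_ev[of t t "\<lambda>s. X\<^sub>0 \<bullet> P (K + s *\<^sub>R E)" "\<lambda>s. J (K + s *\<^sub>R E)", OF refl _ refl]
    by (simp add: has_real_derivative_iff_has_vector_derivative)
qed

lemma J_line2:
  assumes "stab (K + t *\<^sub>R E)"
  shows "((\<lambda>s. X\<^sub>0 \<bullet> P' E (K + s *\<^sub>R E)) has_real_derivative J'' E (K + t *\<^sub>R E)) (at t)"
proof -
  let ?K = "\<lambda>s. K + s *\<^sub>R E"
  let ?T = "\<lambda>s. transpose C ** transpose E ** R ** ?K s ** C + transpose C ** transpose (?K s) ** R ** E ** C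
      - (transpose (B ** E ** C) ** P (?K s) ** Acl (?K s) + transpose (Acl (?K s)) ** P (?K s) ** (B ** E ** C))"
  let ?\<Delta> = "B ** E ** C"
  have stable: "\<forall>\<^sub>F s in nhds t. spec_radius (transpose (Acl (?K s))) < 1"
    using eventually_stab_line[OF assms] by eventually_elim (rule spec_radius_transpose_less_one)
  have dK: "(?K has_vector_derivative E) (at t)"
    by (auto intro!: derivative_eq_intros)
  note dP = P_line[OF assms]
  note left = bounded_linear.has_vector_derivative[OF matrix_mult.bounded_linear_left]
  note right = bounded_linear.has_vector_derivative[OF matrix_mult.bounded_linear_right]
  have dA: "((\<lambda>s. Acl (?K s)) has_vector_derivative - ?\<Delta>) (at t)"
    using has_vector_derivative_transpose[OF Acl_line[of K E t]] by (simp add: transpose_minus)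
  have d1: "((\<lambda>s. transpose C ** transpose E ** R ** ?K s ** C) has_vector_derivative
      transpose C ** transpose E ** R ** E ** C) (at t)"
    by (rule left[OF right[OF dK]])
  have d2: "((\<lambda>s. transpose C ** transpose (?K s) ** R ** E ** C) has_vector_derivative
      transpose C ** transpose E ** R ** E ** C) (at t)"
    by (rule left[OF left[OF left[OF right[OF has_vector_derivative_transpose[OF dK]]]]])
  have d3: "((\<lambda>s. transpose ?\<Delta> ** P (?K s) ** Acl (?K s)) has_vector_derivative
      transpose ?\<Delta> ** P (?K t) ** (- ?\<Delta>) + transpose ?\<Delta> ** P' E (?K t) ** Acl (?K t)) (at t)"
    by (rule has_vector_derivative_matrix_mult[OF right[OF dP] dA])
  have d4: "((\<lambda>s. transpose (Acl (?K s)) ** P (?K s) ** ?\<Delta>) has_vector_derivative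
      (transpose (Acl (?K t)) ** P' E (?K t) + (- transpose ?\<Delta>) ** P (?K t)) ** ?\<Delta>) (at t)"
    by (rule left[OF has_vector_derivative_matrix_mult[OF Acl_line dP]])
  define T' where "T' = transpose C ** transpose E ** R ** E ** C + transpose C ** transpose E ** R ** E ** C
      - ((transpose ?\<Delta> ** P (?K t) ** (- ?\<Delta>) + transpose ?\<Delta> ** P' E (?K t) ** Acl (?K t))
        + (transpose (Acl (?K t)) ** P' E (?K t) + (- transpose ?\<Delta>) ** P (?K t)) ** ?\<Delta>)"
  have dT: "(?T has_vector_derivative T') (at t)"
    unfolding T'_def
    by (intro has_vector_derivative_diff has_vector_derivative_add d1 d2 d3 d4)
  have "((\<lambda>s. P' E (?K s)) has_vector_derivative dlyap (transpose (Acl (?K t)))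
      (T' + ((- transpose ?\<Delta>) ** P' E (?K t) ** transpose (transpose (Acl (?K t)))
        + transpose (Acl (?K t)) ** P' E (?K t) ** transpose (- transpose ?\<Delta>)))) (at t)"
    using has_vector_derivative_dlyap[OF Acl_line dT stable P'_def]
    unfolding P'_def[symmetric] .
  then have "((\<lambda>s. X\<^sub>0 \<bullet> P' E (?K s)) has_vector_derivative X\<^sub>0 \<bullet> dlyap (transpose (Acl (?K t)))
      (T' + ((- transpose ?\<Delta>) ** P' E (?K t) ** transpose (transpose (Acl (?K t)))
        + transpose (Acl (?K t)) ** P' E (?K t) ** transpose (- transpose ?\<Delta>)))) (at t)"
    by (rule bounded_linear.has_vector_derivative[OF bounded_linear_inner_right])
  moreover have "T' + ((- transpose ?\<Delta>) ** P' E (?K t) ** transpose (transpose (Acl (?K t)))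
        + transpose (Acl (?K t)) ** P' E (?K t) ** transpose (- transpose ?\<Delta>))
     = 2 *\<^sub>R (transpose (E ** C) ** R ** (E ** C)) + 2 *\<^sub>R (transpose ?\<Delta> ** P (?K t) ** ?\<Delta>)
      - 2 *\<^sub>R (transpose ?\<Delta> ** P' E (?K t) ** Acl (?K t) + transpose (Acl (?K t)) ** P' E (?K t) ** ?\<Delta>)"
    unfolding T'_def transpose_minus transpose_transpose scaleR_2 matrix_mult.minus_left
      matrix_mult.minus_right matrix_add_rdistrib matrix_transpose_mul
    by (simp add: matrix_mul_assoc)
  ultimately show ?thesis
    unfolding has_real_derivative_iff_has_vector_derivative J''_def \<Sigma>_inner[OF assms] by simp
qed

text \<open>Since the Lyapunov operator preserves semidefiniteness, it suffices to compare sources: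
  that of \<open>P'\<close> lies between \<open>- e z Qcl\<close> and \<open>e z Qcl\<close>, and
  \<open>Qcl\<close> is the source of \<open>P\<close>. This comparison is the origin of
  \<open>zeta1\<close>.\<close>

lemma P'_quad_bound:
  assumes K: "stab K" "J K \<le> \<alpha>"
    and z: "0 \<le> zeta1 B C Q R (sigma_min X\<^sub>0) \<alpha>"
  shows "\<bar>x \<bullet> (P' E K *v x)\<bar> \<le> norm E * zeta1 B C Q R (sigma_min X\<^sub>0) \<alpha> * (x \<bullet> (P K *v x))"
proof (cases "E = 0")
  case True
  then have "P' E K = 0"
    unfolding P'_def
    by (simp add: transpose_zero linear_0[OF bounded_linear.linear[OF bounded_linear_dlyap[OF
          spec_radius_transpose_less_one[OF K(1)]]]])
  with True show ?thesis
    by simp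
next
  case False
  define e \<beta> b c z r where "e = norm E" and "\<beta> = \<alpha> / sigma_min X\<^sub>0" and "b = op_norm B"
    and "c = op_norm C" and "z = zeta1 B C Q R (sigma_min X\<^sub>0) \<alpha>" and "r = op_norm R"
  have "0 < e" "0 \<le> z" "0 \<le> b" "0 \<le> c" "0 \<le> r"
    using False assms op_norm_nonneg by (simp_all add: e_def z_def b_def c_def r_def)
  have "0 \<le> \<beta>"
    using J_pos[OF K(1)] K(2) mu_pos by (simp add: \<beta>_def)
  define T where "T = transpose C ** transpose E ** R ** K ** C + transpose C ** transpose K ** R ** E ** C
      - (transpose (B ** E ** C) ** P K ** Acl K + transpose (Acl K) ** P K ** (B ** E ** C))"
  \<comment> \<open>The definition of \<open>zeta1\<close>, solved for
    \<open>(z + 1) * sigma_min Q\<close>.\<close>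
  have zQ: "(r * c\<^sup>2 + \<beta> * (1 + b\<^sup>2 * c\<^sup>2)) * (x \<bullet> x) \<le> (z + 1) * (x \<bullet> (Q *v x))" for x
  proof -
    have "r * c\<^sup>2 + \<beta> * (1 + b\<^sup>2 * c\<^sup>2) = (z + 1) * sigma_min Q"
      using sQ_pos by (simp add: z_def zeta1_def r_def c_def b_def \<beta>_def)
    moreover have "(z + 1) * (sigma_min Q * (x \<bullet> x)) \<le> (z + 1) * (x \<bullet> (Q *v x))"
      using \<open>0 \<le> z\<close> Q_ge by (intro mult_left_mono) auto
    ultimately show ?thesis
      by (simp add: mult.assoc)
  qed
  have T_le: "\<bar>x \<bullet> (T *v x)\<bar> \<le> e * z * (x \<bullet> (Qcl K *v x))" for x
  proof -
    define u v d m where "u = E *v (C *v x)" and "v = K *v (C *v x)"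
      and "d = B *v (E *v (C *v x))" and "m = Acl K *v x"
    have "T = transpose (E ** C) ** (R ** (K ** C)) + transpose (K ** C) ** (R ** (E ** C))
      - (transpose (B ** E ** C) ** (P K ** Acl K) + transpose (Acl K) ** (P K ** (B ** E ** C)))"
      by (simp add: T_def matrix_transpose_mul matrix_mul_assoc)
    then have "x \<bullet> (T *v x) = u \<bullet> (R *v v) + v \<bullet> (R *v u) - (d \<bullet> (P K *v m) + m \<bullet> (P K *v d))"
      by (simp only: matrix_vector_mult_add_rdistrib matrix_vector_mult_diff_rdistrib inner_add_right
          inner_diff_right quad_mult)
        (simp add: u_def v_def d_def m_def matrix_vector_mul_assoc matrix_mul_assoc)
    then have Tx: "x \<bullet> (T *v x) = 2 * (u \<bullet> (R *v v)) - 2 * (d \<bullet> (P K *v m))"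
      using inner_symmetric[OF weights_symmetric(2), of v u] inner_symmetric[OF transpose_P[OF K(1)], of m d] by simp
    have "2 * \<bar>u \<bullet> (R *v v)\<bar> \<le> (u \<bullet> (R *v u)) / e + e * (v \<bullet> (R *v v))"
      using psd_AM_GM[OF psd_R weights_symmetric(2) \<open>0 < e\<close>, of u v] psd_AM_GM[OF psd_R weights_symmetric(2) \<open>0 < e\<close>, of "- u" v]
      by (simp add: vec.neg)
    moreover have "2 * \<bar>d \<bullet> (P K *v m)\<bar> \<le> (d \<bullet> (P K *v d)) / e + e * (m \<bullet> (P K *v m))"
      using psd_AM_GM[OF psd_P[OF K(1)] transpose_P[OF K(1)] \<open>0 < e\<close>, of d m]
        psd_AM_GM[OF psd_P[OF K(1)] transpose_P[OF K(1)] \<open>0 < e\<close>, of "- d" m]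
      by (simp add: vec.neg)
    ultimately have "\<bar>x \<bullet> (T *v x)\<bar> \<le> (u \<bullet> (R *v u)) / e + e * (v \<bullet> (R *v v))
        + ((d \<bullet> (P K *v d)) / e + e * (m \<bullet> (P K *v m)))"
      unfolding Tx by linarith
    moreover have "(u \<bullet> (R *v u)) / e \<le> e * (r * c\<^sup>2 * (x \<bullet> x))"
    proof -
      have "norm u \<le> e * (c * norm x)"
        unfolding u_def e_def c_def
        by (rule order_trans[OF norm_matrix_vector_mult mult_left_mono[OF norm_op_norm]]) simp
      then have "u \<bullet> u \<le> (e * (c * norm x))\<^sup>2"
        by (simp add: power_mono flip: power2_norm_eq_inner)
      then have "r * (u \<bullet> u) \<le> r * (e * (c * norm x))\<^sup>2"
        using \<open>0 \<le> r\<close> by (rule mult_left_mono)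
      then have "u \<bullet> (R *v u) \<le> r * (e * (c * norm x))\<^sup>2"
        using op_norm_quad[of u R] by (simp add: r_def)
      then show ?thesis
        using \<open>0 < e\<close> by (simp add: pos_divide_le_eq power_mult_distrib power2_norm_eq_inner
            power2_eq_square[of e] mult_ac)
    qed
    moreover have "(d \<bullet> (P K *v d)) / e \<le> e * (\<beta> * (b\<^sup>2 * c\<^sup>2) * (x \<bullet> x))"
    proof -
      have "norm d \<le> b * e * c * norm x"
        unfolding d_def b_def e_def c_def by (rule norm_BKC)
      then have "d \<bullet> d \<le> (b * e * c * norm x)\<^sup>2"
        by (simp add: power_mono flip: power2_norm_eq_inner)
      then have "\<beta> * (d \<bullet> d) \<le> \<beta> * (b * e * c * norm x)\<^sup>2"
        using \<open>0 \<le> \<beta>\<close> by (rule mult_left_mono)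
      moreover have "J K / sigma_min X\<^sub>0 * (d \<bullet> d) \<le> \<beta> * (d \<bullet> d)"
        unfolding \<beta>_def using K(2) mu_pos by (intro mult_right_mono divide_right_mono) auto
      ultimately have "d \<bullet> (P K *v d) \<le> \<beta> * (b * e * c * norm x)\<^sup>2"
        using P_le[OF K(1), of d] by linarith
      then show ?thesis
        using \<open>0 < e\<close> by (simp add: pos_divide_le_eq power_mult_distrib power2_norm_eq_inner
            power2_eq_square[of e] mult_ac)
    qed
    \<comment> \<open>The Lyapunov equation replaces the form of \<open>P\<close> at the next state
      by the form at \<open>x\<close>. The \<open>R\<close> term cancels against the one from the
      weighted inequality, and \<open>- x \<bullet> (Q *v x)\<close> becomes the \<open>- 1\<close>
      in \<open>zeta1\<close>.\<close>
    moreover have "m \<bullet> (P K *v m) = x \<bullet> (P K *v x) - x \<bullet> (Q *v x) - v \<bullet> (R *v v)"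
      using P_quad[OF K(1), of x] by (simp add: m_def v_def Qcl_quad)
    moreover have "x \<bullet> (P K *v x) \<le> \<beta> * (x \<bullet> x)"
    proof -
      have "J K / sigma_min X\<^sub>0 * (x \<bullet> x) \<le> \<beta> * (x \<bullet> x)"
        unfolding \<beta>_def using K(2) mu_pos by (intro mult_right_mono divide_right_mono) auto
      then show ?thesis
        using P_le[OF K(1), of x] by linarith
    qed
    then have "e * (x \<bullet> (P K *v x)) \<le> e * (\<beta> * (x \<bullet> x))"
      using \<open>0 < e\<close> by simp
    ultimately have "\<bar>x \<bullet> (T *v x)\<bar> \<le> e * ((r * c\<^sup>2 + \<beta> * (1 + b\<^sup>2 * c\<^sup>2)) * (x \<bullet> x) - x \<bullet> (Q *v x))"
      by (simp add: algebra_simps)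
    also have "\<dots> \<le> e * (z * (x \<bullet> (Q *v x)))"
      using zQ[of x] \<open>0 < e\<close> by (intro mult_left_mono) (auto simp: distrib_right)
    also have "\<dots> \<le> e * (z * (x \<bullet> (Qcl K *v x)))"
      using \<open>0 < e\<close> \<open>0 \<le> z\<close> Qcl_ge by (intro mult_left_mono) auto
    finally show ?thesis
      by (simp add: mult.assoc)
  qed
  have st: "spec_radius (transpose (Acl K)) < 1"
    using K(1) by (rule spec_radius_transpose_less_one)
  have lin: "linear (dlyap (transpose (Acl K)))"
    using bounded_linear_dlyap[OF st] bounded_linear.linear by blast
  have P'_eq: "P' E K = dlyap (transpose (Acl K)) T"
    by (simp add: P'_def T_def)
  have "psd ((e * z) *\<^sub>R Qcl K - T)"
    using T_le by (auto simp: psd_def matrix_vector_mult_diff_rdistrib inner_diff_right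
        scaleR_matrix_vec abs_le_iff)
  from psd_dlyap[OF st this] have up: "psd ((e * z) *\<^sub>R P K - P' E K)"
    by (simp add: linear_diff[OF lin] linear_scale[OF lin] P_def P'_eq)
  have "psd ((e * z) *\<^sub>R Qcl K + T)"
    unfolding psd_def matrix_vector_mult_add_rdistrib inner_add_right scaleR_matrix_vec inner_scaleR_right
  proof
    fix x
    show "0 \<le> e * z * (x \<bullet> (Qcl K *v x)) + x \<bullet> (T *v x)"
      using T_le[of x] by linarith
  qed
  from psd_dlyap[OF st this] have "psd ((e * z) *\<^sub>R P K + P' E K)"
    by (simp add: linear_add[OF lin] linear_scale[OF lin] P_def P'_eq)
  with up have "0 \<le> x \<bullet> (((e * z) *\<^sub>R P K - P' E K) *v x)" "0 \<le> x \<bullet> (((e * z) *\<^sub>R P K + P' E K) *v x)"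
    unfolding psd_def by blast+
  then show ?thesis
    by (simp add: matrix_vector_mult_diff_rdistrib matrix_vector_mult_add_rdistrib inner_diff_right
        inner_add_right scaleR_matrix_vec e_def z_def)
qed

lemma transpose_P':
  assumes "stab K"
  shows "transpose (P' E K) = P' E K"
  unfolding P'_def
  by (subst transpose_dlyap[OF spec_radius_transpose_less_one[OF assms]])
    (simp add: matrix_simps transpose_P[OF assms] weights_symmetric add.commute)

lemma zeta1_nonneg:
  assumes "sigma_min Q * sigma_min X\<^sub>0 \<le> \<alpha>"
  shows "0 \<le> zeta1 B C Q R (sigma_min X\<^sub>0) \<alpha>"
proof -
  have "sigma_min Q \<le> \<alpha> / sigma_min X\<^sub>0"
    using assms mu_pos by (simp add: pos_le_divide_eq)
  also have "\<dots> \<le> \<alpha> / sigma_min X\<^sub>0 * (1 + (op_norm B)\<^sup>2 * (op_norm C)\<^sup>2) + op_norm R * (op_norm C)\<^sup>2"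
  proof -
    have "0 \<le> \<alpha> / sigma_min X\<^sub>0"
      using calculation sQ_pos by linarith
    then have "0 \<le> \<alpha> / sigma_min X\<^sub>0 * ((op_norm B)\<^sup>2 * (op_norm C)\<^sup>2)"
      by (intro mult_nonneg_nonneg) auto
    moreover have "0 \<le> op_norm R * (op_norm C)\<^sup>2"
      by (intro mult_nonneg_nonneg op_norm_nonneg) auto
    ultimately show ?thesis
      by (simp only: distrib_left)
  qed
  finally show ?thesis
    using sQ_pos by (simp add: zeta1_def pos_le_divide_eq)
qed

text \<open>The factored form also covers \<open>B = 0\<close> and \<open>C = 0\<close>, where the quotient in the constant is \<open>0\<close>.\<close>

lemma smooth_const_eq:
  "smooth_const B C Q R \<mu> \<alpha> = 2 * \<alpha> / sigma_min Q *
     ((op_norm R + \<alpha> / \<mu> * (op_norm B)\<^sup>2) * (op_norm C)\<^sup>2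
       + 2 * (op_norm B * op_norm C) * (zeta1 B C Q R \<mu> \<alpha> * (\<alpha> / \<mu>)))"
proof -
  define b c \<beta> z where "b = op_norm B" and "c = op_norm C" and "\<beta> = \<alpha> / \<mu>"
    and "z = zeta1 B C Q R \<mu> \<alpha>"
  have "\<beta> * (1 + 2 * z / (b * c)) * b\<^sup>2 * c\<^sup>2 = \<beta> * b\<^sup>2 * c\<^sup>2 + 2 * (b * c) * (z * \<beta>)"
    by (cases "b = 0"; cases "c = 0") (simp_all add: field_simps power2_eq_square)
  then show ?thesis
    unfolding smooth_const_def b_def[symmetric] c_def[symmetric] \<beta>_def[symmetric] z_def[symmetric]
    by (simp only: distrib_right mult.assoc add.assoc)
qed

text \<open>An upper bound is enough for descent. It combines
  \<open>P \<le> \<alpha> / \<mu>\<close>, the comparison of \<open>P'\<close> with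
  \<open>P\<close>, and the trace bound on \<open>\<Sigma>\<close>; together these produce
  \<open>L\<close>.\<close>

lemma J''_bound:
  assumes K: "stab K" "J K \<le> \<alpha>"
  shows "J'' E K \<le> smooth_const B C Q R (sigma_min X\<^sub>0) \<alpha> * (norm E)\<^sup>2"
proof -
  define e \<beta> b c z r where "e = norm E" and "\<beta> = \<alpha> / sigma_min X\<^sub>0" and "b = op_norm B"
    and "c = op_norm C" and "z = zeta1 B C Q R (sigma_min X\<^sub>0) \<alpha>" and "r = op_norm R"
  have z: "0 \<le> zeta1 B C Q R (sigma_min X\<^sub>0) \<alpha>"
    using J_ge[OF K(1)] K(2) by (intro zeta1_nonneg) linarith
  then have pos: "0 \<le> e" "0 \<le> z" "0 \<le> b" "0 \<le> c" "0 \<le> r"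
    using op_norm_nonneg by (simp_all add: e_def z_def b_def c_def r_def)
  have "0 \<le> \<beta>"
    using J_pos[OF K(1)] K(2) mu_pos by (simp add: \<beta>_def)
  have P_le': "y \<bullet> (P K *v y) \<le> \<beta> * (y \<bullet> y)" for y
  proof -
    have "J K / sigma_min X\<^sub>0 * (y \<bullet> y) \<le> \<beta> * (y \<bullet> y)"
      unfolding \<beta>_def using K(2) mu_pos by (intro mult_right_mono divide_right_mono) auto
    then show ?thesis
      using P_le[OF K(1), of y] by linarith
  qed
  have P'_le: "\<bar>y \<bullet> (P' E K *v y)\<bar> \<le> e * z * \<beta> * (y \<bullet> y)" for y
  proof -
    have "e * z * (y \<bullet> (P K *v y)) \<le> e * z * (\<beta> * (y \<bullet> y))"
      using P_le' pos by (intro mult_left_mono) auto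
    then show ?thesis
      using P'_quad_bound[OF K z, of y E] unfolding e_def[symmetric] z_def[symmetric]
      by (simp add: mult.assoc)
  qed
  \<comment> \<open>\<open>a\<close> collects the coefficients of \<open>x \<bullet> x\<close> and
    \<open>a'\<close> that of \<open>m \<bullet> m\<close>, where \<open>m\<close> is the next
    state. Both squares have the same trace bound, so the mixed term counts twice, which gives the
    factor \<open>2\<close> in front of \<open>zeta1\<close> in \<open>L\<close>.\<close>
  define a where "a = 2 * (r * e\<^sup>2 * c\<^sup>2) + 2 * (\<beta> * (b * e * c)\<^sup>2) + 2 * (b * e * c * (e * z * \<beta>))"
  define a' where "a' = 2 * (b * e * c * (e * z * \<beta>))"
  have "0 \<le> a'" "0 \<le> a"
    using pos \<open>0 \<le> \<beta>\<close> by (simp_all add: a_def a'_def)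
  let ?H = "2 *\<^sub>R (transpose (E ** C) ** R ** (E ** C))
      + 2 *\<^sub>R (transpose (B ** E ** C) ** P K ** (B ** E ** C))
      - 2 *\<^sub>R (transpose (B ** E ** C) ** P' E K ** Acl K + transpose (Acl K) ** P' E K ** (B ** E ** C))"
  have "\<Sigma> K \<bullet> ?H \<le> \<Sigma> K \<bullet> (a *\<^sub>R mat 1 + a' *\<^sub>R (transpose (Acl K) ** Acl K))"
  proof (rule \<Sigma>_mono[OF K(1)])
    fix x :: "real^'n"
    define u d m where "u = E *v (C *v x)" and "d = B *v (E *v (C *v x))" and "m = Acl K *v x"
    have "?H = 2 *\<^sub>R (transpose (E ** C) ** (R ** (E ** C)))
      + 2 *\<^sub>R (transpose (B ** E ** C) ** (P K ** (B ** E ** C)))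
      - 2 *\<^sub>R (transpose (B ** E ** C) ** (P' E K ** Acl K) + transpose (Acl K) ** (P' E K ** (B ** E ** C)))"
      by (simp add: matrix_mul_assoc)
    then have "x \<bullet> (?H *v x) = 2 * (u \<bullet> (R *v u)) + 2 * (d \<bullet> (P K *v d))
        - 2 * (d \<bullet> (P' E K *v m) + m \<bullet> (P' E K *v d))"
      by (simp only: matrix_vector_mult_add_rdistrib matrix_vector_mult_diff_rdistrib inner_add_right
          inner_diff_right scaleR_matrix_vec inner_scaleR_right quad_mult)
        (simp add: u_def d_def m_def matrix_vector_mul_assoc matrix_mul_assoc)
    also have "\<dots> = 2 * (u \<bullet> (R *v u)) + 2 * (d \<bullet> (P K *v d)) - 4 * (d \<bullet> (P' E K *v m))"
      using inner_symmetric[OF transpose_P'[OF K(1)], of m E d] by simp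
    finally have Hx: "x \<bullet> (?H *v x) = 2 * (u \<bullet> (R *v u)) + 2 * (d \<bullet> (P K *v d)) - 4 * (d \<bullet> (P' E K *v m))" .
    have nd: "norm d \<le> b * e * c * norm x"
      unfolding d_def b_def e_def c_def by (rule norm_BKC)
    have "norm u \<le> e * (c * norm x)"
      unfolding u_def e_def c_def
      by (rule order_trans[OF norm_matrix_vector_mult mult_left_mono[OF norm_op_norm]]) simp
    then have "u \<bullet> u \<le> (e * (c * norm x))\<^sup>2"
      by (simp add: power_mono flip: power2_norm_eq_inner)
    then have "r * (u \<bullet> u) \<le> r * (e * (c * norm x))\<^sup>2"
      using \<open>0 \<le> r\<close> by (rule mult_left_mono)
    then have 1: "u \<bullet> (R *v u) \<le> r * e\<^sup>2 * c\<^sup>2 * (x \<bullet> x)"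
      using op_norm_quad[of u R] by (simp add: r_def power_mult_distrib power2_norm_eq_inner mult_ac)
    have "d \<bullet> d \<le> (b * e * c * norm x)\<^sup>2"
      using nd by (simp add: power_mono flip: power2_norm_eq_inner)
    then have dd: "d \<bullet> d \<le> (b * e * c)\<^sup>2 * (x \<bullet> x)"
      by (simp add: power_mult_distrib power2_norm_eq_inner)
    then have "\<beta> * (d \<bullet> d) \<le> \<beta> * ((b * e * c)\<^sup>2 * (x \<bullet> x))"
      using \<open>0 \<le> \<beta>\<close> by (rule mult_left_mono)
    then have 2: "d \<bullet> (P K *v d) \<le> \<beta> * (b * e * c)\<^sup>2 * (x \<bullet> x)"
      using P_le'[of d] by (simp add: mult.assoc)
    have 3: "- (2 * (d \<bullet> (P' E K *v m))) \<le> b * e * c * (e * z * \<beta>) * (x \<bullet> x + m \<bullet> m)"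
    proof (cases "b * e * c = 0")
      case True
      then have "d = 0"
        using nd[unfolded True] by simp
      then show ?thesis
        unfolding True by simp
    next
      case False
      \<comment> \<open>Rescaling \<open>d\<close> by \<open>- 1 / s\<close> makes it no longer than
        \<open>x\<close> and absorbs the sign, so that the polarization bound is applied to vectors
        of comparable size.\<close>
      define s where "s = b * e * c"
      have "0 < s"
        using False pos by (simp add: s_def less_le)
      define w where "w = (- (1 / s)) *\<^sub>R d"
      have dw: "d = - s *\<^sub>R w"
        using \<open>0 < s\<close> by (simp add: w_def)
      have "s\<^sup>2 * (w \<bullet> w) \<le> s\<^sup>2 * (x \<bullet> x)"
        using dd unfolding s_def[symmetric] dw by (simp add: power2_eq_square)
      then have ww: "w \<bullet> w \<le> x \<bullet> x"
        using \<open>0 < s\<close> by simp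
      have "- (2 * (d \<bullet> (P' E K *v m))) = s * (2 * (w \<bullet> (P' E K *v m)))"
        unfolding dw by simp
      also have "\<dots> \<le> s * (e * z * \<beta> * (w \<bullet> w + m \<bullet> m))"
        using \<open>0 < s\<close> polarization_bound[OF transpose_P'[OF K(1)] P'_le] by (intro mult_left_mono) auto
      also have "\<dots> \<le> s * (e * z * \<beta> * (x \<bullet> x + m \<bullet> m))"
        using \<open>0 < s\<close> ww pos \<open>0 \<le> \<beta>\<close> by (intro mult_left_mono add_right_mono mult_nonneg_nonneg) auto
      finally show ?thesis
        by (simp add: s_def mult.assoc)
    qed
    have "x \<bullet> ((a *\<^sub>R mat 1 + a' *\<^sub>R (transpose (Acl K) ** Acl K)) *v x) = a * (x \<bullet> x) + a' * (m \<bullet> m)"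
      by (simp only: matrix_vector_mult_add_rdistrib inner_add_right scaleR_matrix_vec inner_scaleR_right
          quad_mult) (simp add: m_def)
    then show "x \<bullet> (?H *v x) \<le> x \<bullet> ((a *\<^sub>R mat 1 + a' *\<^sub>R (transpose (Acl K) ** Acl K)) *v x)"
      using 1 2 3 unfolding Hx a_def a'_def by (simp add: algebra_simps)
  qed
  also have "\<dots> = a * (\<Sigma> K \<bullet> mat 1) + a' * (\<Sigma> K \<bullet> (transpose (Acl K) ** Acl K))"
    by (simp add: inner_add_right)
  also have "\<dots> \<le> a * (\<Sigma> K \<bullet> mat 1) + a' * (\<Sigma> K \<bullet> mat 1)"
    using \<Sigma>_gram_Acl[OF K(1)] \<open>0 \<le> a'\<close> by (intro add_left_mono mult_left_mono)
  also have "\<dots> = (a + a') * (\<Sigma> K \<bullet> mat 1)"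
    by (simp add: distrib_right)
  also have "\<dots> \<le> (a + a') * (\<alpha> / sigma_min Q)"
    using trace_\<Sigma>[OF K(1)] K(2) sQ_pos \<open>0 \<le> a\<close> \<open>0 \<le> a'\<close>
    by (intro mult_left_mono) (auto simp: pos_le_divide_eq mult.commute)
  also have "\<dots> = smooth_const B C Q R (sigma_min X\<^sub>0) \<alpha> * (norm E)\<^sup>2"
    unfolding smooth_const_eq e_def[symmetric] \<beta>_def[symmetric] b_def[symmetric] c_def[symmetric]
      z_def[symmetric] r_def[symmetric] a_def a'_def
    by (simp add: divide_simps power2_eq_square) (simp add: algebra_simps)
  finally show ?thesis
    by (simp add: J''_def)
qed

end

section \<open>Descent of the natural policy gradient method\<close>

text \<open>
  As long as the segment stays below level \<open>\<alpha>\<close>, Taylor's formula bounds \<open>\<phi> t\<close> by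
  \<open>\<phi> 0 + t \<phi>' 0 + c t\<^sup>2 / 2\<close>, which is less than \<open>\<phi> 0\<close> for \<open>0 < t < 1\<close>; hence the segment cannot leave
  the sublevel set before \<open>t = 1\<close>.
\<close>

lemma descent_on_segment:
  fixes \<phi> \<phi>' \<phi>'' :: "real \<Rightarrow> real"
  assumes start: "0 \<in> G" "\<phi> 0 \<le> \<alpha>" and \<delta>: "0 < \<delta>"
    and nbhd: "\<And>t s. t \<in> G \<Longrightarrow> \<phi> t \<le> \<alpha> \<Longrightarrow> \<bar>s - t\<bar> < \<delta> \<Longrightarrow> s \<in> G"
    and d1: "\<And>t. t \<in> G \<Longrightarrow> (\<phi> has_real_derivative \<phi>' t) (at t)"
    and d2: "\<And>t. t \<in> G \<Longrightarrow> (\<phi>' has_real_derivative \<phi>'' t) (at t)"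
    and bound: "\<And>t. t \<in> G \<Longrightarrow> \<phi> t \<le> \<alpha> \<Longrightarrow> \<phi>'' t \<le> c"
    and c: "0 \<le> c" "\<phi>' 0 < 0" "\<phi>' 0 + c / 2 \<le> 0"
  shows "1 \<in> G \<and> \<phi> 1 \<le> \<phi> 0 + \<phi>' 0 + c / 2"
proof -
  define good where "good T \<longleftrightarrow> (\<forall>s\<in>{0..T}. s \<in> G \<and> \<phi> s \<le> \<alpha>)" for T
  have quad: "\<phi> T \<le> \<phi> 0 + T * \<phi>' 0 + c / 2 * T\<^sup>2" if "0 \<le> T" "good T" for T
  proof -
    have slope: "\<phi>' s \<le> \<phi>' 0 + c * s" if "0 \<le> s" "s \<le> T" for s
    proof -
      have "\<phi>' s - c * s \<le> \<phi>' 0 - c * 0"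
      proof (rule DERIV_nonpos_imp_nonincreasing[OF \<open>0 \<le> s\<close>])
        fix x assume "0 \<le> x" "x \<le> s"
        then have x: "x \<in> G" "\<phi> x \<le> \<alpha>"
          using \<open>good T\<close> \<open>s \<le> T\<close> by (auto simp: good_def)
        have "((\<lambda>s. \<phi>' s - c * s) has_real_derivative \<phi>'' x - c) (at x)"
          by (auto intro!: derivative_eq_intros d2 x)
        then show "\<exists>y. ((\<lambda>s. \<phi>' s - c * s) has_real_derivative y) (at x) \<and> y \<le> 0"
          using bound[OF x] by fastforce
      qed
      then show ?thesis by simp
    qed
    have "\<phi> T - \<phi>' 0 * T - c / 2 * T\<^sup>2 \<le> \<phi> 0 - \<phi>' 0 * 0 - c / 2 * 0\<^sup>2"
    proof (rule DERIV_nonpos_imp_nonincreasing[OF \<open>0 \<le> T\<close>])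
      fix x assume "0 \<le> x" "x \<le> T"
      then have x: "x \<in> G"
        using \<open>good T\<close> by (auto simp: good_def)
      have "((\<lambda>s. \<phi> s - \<phi>' 0 * s - c / 2 * s\<^sup>2) has_real_derivative \<phi>' x - \<phi>' 0 - c * x) (at x)"
        by (auto intro!: derivative_eq_intros d1 x)
      then show "\<exists>y. ((\<lambda>s. \<phi> s - \<phi>' 0 * s - c / 2 * s\<^sup>2) has_real_derivative y) (at x) \<and> y \<le> 0"
        using slope[OF \<open>0 \<le> x\<close> \<open>x \<le> T\<close>] by fastforce
    qed
    then show ?thesis
      by (simp add: mult.commute)
  qed
  define S where "S = {T \<in> {0..1}. good T}"
  define m where "m = Sup S"
  have "0 \<in> S"
    using start by (simp add: S_def good_def)
  have bdd: "bdd_above S"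
    by (rule bdd_aboveI[of _ 1]) (simp add: S_def)
  have m01: "0 \<le> m" "m \<le> 1"
    unfolding m_def using \<open>0 \<in> S\<close> bdd
    by (auto intro!: cSup_upper cSup_least simp: S_def)
  have below: "s \<in> G \<and> \<phi> s \<le> \<alpha>" if s: "0 \<le> s" "s < m" for s
  proof -
    obtain T where "T \<in> S" "s < T"
      using less_cSupE[of s S] s \<open>0 \<in> S\<close> unfolding m_def by blast
    then show ?thesis
      using s by (auto simp: S_def good_def)
  qed
  have m: "m \<in> G \<and> \<phi> m \<le> \<alpha>"
  proof (cases "m = 0")
    case True
    with start show ?thesis by simp
  next
    case False
    \<comment> \<open>A good parameter closer to \<open>m\<close> than \<open>\<delta>\<close>: it
      carries membership in \<open>G\<close> over to the supremum.\<close>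
    define s where "s = max (m / 2) (m - \<delta> / 2)"
    have "0 \<le> s" "s < m" "\<bar>m - s\<bar> < \<delta>"
      using False m01 \<delta> by (auto simp: s_def max_def)
    then have "m \<in> G"
      using below nbhd by blast
    have "(\<phi> \<longlongrightarrow> \<phi> m) (at m)"
      using d1[OF \<open>m \<in> G\<close>] DERIV_isCont isCont_def by blast
    then have "(\<phi> \<longlongrightarrow> \<phi> m) (at_left m)"
      using filterlim_at_split by blast
    moreover have "\<forall>\<^sub>F s in at_left m. \<phi> s \<le> \<alpha>"
      unfolding eventually_at_left_field using below False m01 by (intro exI[of _ 0]) auto
    ultimately have "\<phi> m \<le> \<alpha>"
      by (rule tendsto_upperbound) simp
    with \<open>m \<in> G\<close> show ?thesis by simp
  qed
  have "good m"
    unfolding good_def using below m by (metis atLeastAtMost_iff le_less)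
  have "m = 1"
  proof (rule ccontr)
    assume "m \<noteq> 1"
    with m01 have "m < 1" by simp
    \<comment> \<open>At \<open>m = 0\<close> the value may equal \<open>\<alpha>\<close>, so the
      negative slope has to be used. For \<open>0 < m < 1\<close> the quadratic bound already puts
      \<open>\<phi> m\<close> strictly below \<open>\<alpha>\<close>, and continuity
      suffices.\<close>
    have "\<exists>d>0. \<forall>h>0. h < d \<longrightarrow> \<phi> (m + h) \<le> \<alpha>"
    proof (cases "m = 0")
      case True
      obtain d where "0 < d" "\<And>h. 0 < h \<Longrightarrow> h < d \<Longrightarrow> \<phi> (0 + h) < \<phi> 0"
        using DERIV_neg_dec_right[OF d1[OF start(1)] c(2)] by blast
      then show ?thesis
        using start(2) True by (intro exI[of _ d]) force
    next
      case False
      with m01 have "0 < m" by simp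
      have "\<phi>' 0 + c / 2 * m < 0"
      proof (cases "c = 0")
        case False
        then have "c / 2 * m < c / 2"
          using c \<open>m < 1\<close> by simp
        with c show ?thesis by linarith
      qed (use c in simp)
      then have "m * (\<phi>' 0 + c / 2 * m) < 0"
        using \<open>0 < m\<close> by (simp add: mult_less_0_iff)
      then have "\<phi> m < \<alpha>"
        using quad[OF m01(1) \<open>good m\<close>] start(2) by (simp add: algebra_simps power2_eq_square)
      moreover have "(\<phi> \<longlongrightarrow> \<phi> m) (at m)"
        using d1 m DERIV_isCont isCont_def by blast
      ultimately have "\<forall>\<^sub>F s in at m. \<phi> s < \<alpha>"
        using order_tendstoD(2) by blast
      then obtain d where "0 < d" "\<And>s. s \<noteq> m \<Longrightarrow> dist s m < d \<Longrightarrow> \<phi> s < \<alpha>"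
        unfolding eventually_at by blast
      then show ?thesis
        by (intro exI[of _ d]) (auto simp: dist_real_def intro: less_imp_le)
    qed
    then obtain d where d: "0 < d" "\<And>h. 0 < h \<Longrightarrow> h < d \<Longrightarrow> \<phi> (m + h) \<le> \<alpha>"
      by blast
    define T where "T = m + min (min d \<delta>) (1 - m) / 2"
    have T: "m < T" "T \<le> 1" "T - m < d" "T - m < \<delta>"
      using d(1) \<delta> \<open>m < 1\<close> by (auto simp: T_def min_def field_simps)
    have "s \<in> G \<and> \<phi> s \<le> \<alpha>" if "0 \<le> s" "s \<le> T" for s
    proof (cases "s \<le> m")
      case True
      with that \<open>good m\<close> show ?thesis by (simp add: good_def)
    next
      case False
      then have "\<bar>s - m\<bar> < \<delta>" "\<phi> (m + (s - m)) \<le> \<alpha>"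
        using that T by (simp, intro d(2)) auto
      then show ?thesis
        using nbhd m by auto
    qed
    then have "T \<in> S"
      using T m01 by (auto simp: S_def good_def)
    then have "T \<le> m"
      unfolding m_def by (rule cSup_upper[OF _ bdd])
    with T show False by simp
  qed
  then show ?thesis
    using m quad[of 1] \<open>good m\<close> by auto
qed

text \<open>\<open>sigma_min C\<close> is tied to the transpose and \<open>op_norm C\<close> to
  \<open>C\<close> itself. For a unit vector \<open>y\<close> and \<open>w = C^T y\<close> the
  identity \<open>norm w ^ 2 = y \<bullet> C w\<close> connects the two.\<close>

lemma sigma_min_wide:
  fixes C :: "real^'n^'d"
  assumes "independent_rows C"
  shows "0 < sigma_min C" and "sigma_min C \<le> op_norm C"
proof -
  show pos: "0 < sigma_min C"
  proof (rule sigma_min_pos)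
    fix y assume "transpose C *v y = 0"
    then have "(\<Sum>i\<in>UNIV. y $ i *\<^sub>R row i C) = 0"
      by (simp add: vec_eq_iff vector_matrix_mult_def row_def sum_component)
    then show "y = 0"
      using assms unfolding independent_rows_def by (simp add: vec_eq_iff)
  qed
  define y :: "real^'d" where "y = axis undefined 1"
  have y: "y \<bullet> y = 1" "norm y = 1"
    by (simp_all add: y_def inner_axis_axis norm_axis_1)
  let ?w = "transpose C *v y"
  have lower: "(sigma_min C)\<^sup>2 \<le> (norm ?w)\<^sup>2"
    using sigma_min_transpose_lower[of C y] y by simp
  have "(norm ?w)\<^sup>2 = y \<bullet> (C *v ?w)"
    unfolding power2_norm_eq_inner using inner_transpose_vec[of ?w C y] by (simp add: inner_commute)
  also have "\<dots> \<le> norm y * (op_norm C * norm ?w)"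
    by (rule order_trans[OF norm_cauchy_schwarz mult_left_mono[OF norm_op_norm]]) simp
  finally have "norm ?w * norm ?w \<le> op_norm C * norm ?w"
    by (simp add: y power2_eq_square)
  moreover have "0 < norm ?w"
    using lower pos by (metis norm_le_zero_iff not_le power2_less_eq_zero_iff norm_zero zero_power2 less_irrefl)
  ultimately have "norm ?w \<le> op_norm C"
    by simp
  moreover have "sigma_min C \<le> norm ?w"
    using lower by (rule power2_le_imp_le) simp
  ultimately show "sigma_min C \<le> op_norm C"
    by simp
qed

section \<open>Matrix pairings evaluated row by row, and inverses\<close>

lemma gram_inner: "S \<bullet> (transpose E ** E) = (\<Sum>i\<in>UNIV. E $ i \<bullet> (S *v E $ i))" for E :: "real^'n^'m"
proof -
  have "S \<bullet> (transpose E ** E) = E \<bullet> (E ** S)"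
    by (simp add: inner_commute[of S] inner_matrix_mult_left)
  also have "\<dots> = (\<Sum>i\<in>UNIV. E $ i \<bullet> (transpose S *v E $ i))"
    by (simp only: inner_vec_def[of E] row_matrix_mult)
  finally show ?thesis
    by (simp only: quad_transpose)
qed

lemma norm_matrix_sq: "(norm E)\<^sup>2 = (\<Sum>i\<in>UNIV. E $ i \<bullet> E $ i)" for E :: "real^'n^'m"
  by (simp add: power2_norm_eq_inner inner_vec_def[of E])

lemma posdef_imp_inverse:
  fixes Y :: "real^'d^'d"
  assumes "\<And>y. y \<noteq> 0 \<Longrightarrow> 0 < y \<bullet> (Y *v y)"
  shows "matrix_inv Y ** Y = mat 1" and "Y ** matrix_inv Y = mat 1"
proof -
  have "\<forall>y. Y *v y = 0 \<longrightarrow> y = 0"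
    using assms by (metis inner_zero_right less_irrefl)
  then have "invertible Y"
    unfolding invertible_left_inverse matrix_left_invertible_ker .
  then have "\<exists>Z. Y ** Z = mat 1 \<and> Z ** Y = mat 1"
    by (simp add: invertible_def)
  then have "Y ** matrix_inv Y = mat 1 \<and> matrix_inv Y ** Y = mat 1"
    unfolding matrix_inv_def by (rule someI_ex)
  then show "matrix_inv Y ** Y = mat 1" "Y ** matrix_inv Y = mat 1"
    by auto
qed

lemma gram_quad_vec: "x \<bullet> ((transpose E ** E) *v x) = (E *v x) \<bullet> (E *v x)" for E :: "real^'n^'m"
  by (rule quad_mult)

context output_feedback
begin

text \<open>The advantage as a matrix: one step with \<open>K'\<close> followed by \<open>K\<close>
  forever, minus \<open>K\<close> throughout. Equivalently, the defect of \<open>P K\<close> in the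
  Lyapunov equation of \<open>K'\<close>.\<close>

definition cost_gap :: "real^'d^'m \<Rightarrow> real^'d^'m \<Rightarrow> real^'n^'n" where
  "cost_gap K K' = Qcl K' + transpose (Acl K') ** P K ** Acl K' - P K"

text \<open>The advantages telescope along the trajectory of \<open>K'\<close>; the Lyapunov
  equation of \<open>\<Sigma> K'\<close> performs the summation, so the formula is exact for gains
  that are far apart.\<close>

lemma J_diff:
  assumes "stab K" "stab K'"
  shows "J K' - J K = \<Sigma> K' \<bullet> cost_gap K K'"
proof -
  have "\<Sigma> K' \<bullet> (transpose (Acl K') ** P K ** Acl K') = (\<Sigma> K' - X\<^sub>0) \<bullet> P K"
    using \<Sigma>_eq[OF assms(2)] inner_congruence[of "Acl K'" "\<Sigma> K'" "P K"]
    by (metis add_diff_cancel_left')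
  then show ?thesis
    by (simp add: cost_gap_def inner_add_right inner_diff_right inner_diff_left \<Sigma>_Qcl[OF assms(2)]
        J_eq[OF assms(1)])
qed

lemma cost_gap_quad:
  assumes "stab K" and f: "f = (K' - K) *v (C *v x)"
  shows "x \<bullet> (cost_gap K K' *v x)
    = 2 * (f \<bullet> (EK K *v x)) + f \<bullet> (R *v f) + (B *v f) \<bullet> (P K *v (B *v f))"
proof -
  define k m where "k = K *v (C *v x)" and "m = Acl K *v x"
  have k': "K' *v (C *v x) = k + f"
    by (simp add: k_def f matrix_vector_mult_diff_rdistrib)
  have m': "Acl K' *v x = m - B *v f"
    by (simp add: m_def f Acl_diff[of K' x K])
  have "cost_gap K K' = Qcl K' + transpose (Acl K') ** (P K ** Acl K') - P K"
    by (simp add: cost_gap_def matrix_mul_assoc)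
  then have "x \<bullet> (cost_gap K K' *v x)
      = x \<bullet> (Qcl K' *v x) + (m - B *v f) \<bullet> (P K *v (m - B *v f)) - x \<bullet> (P K *v x)"
    by (simp only: matrix_vector_mult_add_rdistrib matrix_vector_mult_diff_rdistrib inner_add_right
        inner_diff_right quad_mult flip: m')
      (simp add: matrix_vector_mul_assoc)
  also have "\<dots> = (k + f) \<bullet> (R *v (k + f)) + (m - B *v f) \<bullet> (P K *v (m - B *v f))
      - k \<bullet> (R *v k) - m \<bullet> (P K *v m)"
    using P_quad[OF assms(1), of x] by (simp add: Qcl_quad k' k_def m_def)
  also have "\<dots> = 2 * (f \<bullet> (R *v k)) - 2 * ((B *v f) \<bullet> (P K *v m)) + f \<bullet> (R *v f)
      + (B *v f) \<bullet> (P K *v (B *v f))"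
    using inner_symmetric[OF weights_symmetric(2), of k f] inner_symmetric[OF transpose_P[OF assms(1)], of m "B *v f"]
    by (simp add: matrix_vector_right_distrib matrix_vector_mult_diff_distrib inner_add_left
        inner_add_right inner_diff_left inner_diff_right)
  also have "f \<bullet> (R *v k) = f \<bullet> (EK K *v x) + (B *v f) \<bullet> (P K *v m)"
  proof -
    have "EK K = R ** (K ** C) - transpose B ** (P K ** Acl K)"
      by (simp add: EK_def matrix_mul_assoc)
    then have "f \<bullet> (EK K *v x) = f \<bullet> (R *v k) - (B *v f) \<bullet> (P K *v m)"
      by (simp only: matrix_vector_mult_diff_rdistrib inner_diff_right quad_mult)
        (simp add: k_def m_def matrix_vector_mul_assoc matrix_mul_assoc)
    then show ?thesis by simp
  qed
  finally show ?thesis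
    by simp
qed

text \<open>The advantage is quadratic in the change \<open>f\<close> of the input. Dropping the
  nonnegative \<open>B\<close> term and completing the square, with minimum at
  \<open>- e / sigma_min R\<close>, bounds it below in terms of \<open>EK K\<close> alone;
  \<open>K'\<close> remains only in the weight \<open>\<Sigma> K'\<close>.\<close>

lemma gradient_domination:
  assumes "stab K" "stab K'"
  shows "J K - J K' \<le> op_norm (\<Sigma> K') / sigma_min R * (norm (EK K))\<^sup>2"
proof -
  let ?s = "sigma_min R"
  have s: "0 < ?s"
    by (rule sigma_min_posdef(1)[OF R])
  have "\<Sigma> K' \<bullet> ((- (1 / ?s)) *\<^sub>R (transpose (EK K) ** EK K)) \<le> \<Sigma> K' \<bullet> cost_gap K K'"
  proof (rule \<Sigma>_mono[OF assms(2)])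
    fix x
    define e f where "e = EK K *v x" and "f = (K' - K) *v (C *v x)"
    have "0 \<le> (e + ?s *\<^sub>R f) \<bullet> (e + ?s *\<^sub>R f) / ?s"
      using s by simp
    also have "\<dots> = (e \<bullet> e) / ?s + 2 * (f \<bullet> e) + ?s * (f \<bullet> f)"
      using s by (simp add: inner_add_left inner_add_right inner_commute[of e f] field_simps)
    also have "\<dots> \<le> (e \<bullet> e) / ?s + 2 * (f \<bullet> e) + f \<bullet> (R *v f)"
      using sigma_min_posdef(2)[OF R, of f] by simp
    also have "\<dots> \<le> (e \<bullet> e) / ?s + (2 * (f \<bullet> e) + f \<bullet> (R *v f) + (B *v f) \<bullet> (P K *v (B *v f)))"
      using psd_P[OF assms(1)] by (simp add: psd_def)
    also have "2 * (f \<bullet> e) + f \<bullet> (R *v f) + (B *v f) \<bullet> (P K *v (B *v f)) = x \<bullet> (cost_gap K K' *v x)"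
      using cost_gap_quad[OF assms(1) f_def] by (simp add: e_def)
    finally have "- ((e \<bullet> e) / ?s) \<le> x \<bullet> (cost_gap K K' *v x)"
      by linarith
    then show "x \<bullet> (((- (1 / ?s)) *\<^sub>R (transpose (EK K) ** EK K)) *v x) \<le> x \<bullet> (cost_gap K K' *v x)"
      unfolding scaleR_matrix_vec inner_scaleR_right gram_quad_vec e_def by simp
  qed
  then have "J K - J K' \<le> (1 / ?s) * (\<Sigma> K' \<bullet> (transpose (EK K) ** EK K))"
    using J_diff[OF assms] by simp
  also have "\<Sigma> K' \<bullet> (transpose (EK K) ** EK K) \<le> op_norm (\<Sigma> K') * (norm (EK K))\<^sup>2"
    unfolding gram_inner norm_matrix_sq sum_distrib_left by (intro sum_mono op_norm_quad)
  then have "(1 / ?s) * (\<Sigma> K' \<bullet> (transpose (EK K) ** EK K)) \<le> (1 / ?s) * (op_norm (\<Sigma> K') * (norm (EK K))\<^sup>2)"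
    using s by (intro mult_left_mono) auto
  finally show ?thesis
    by simp
qed

lemma state_feedback_cost_eq: "state_feedback_cost A B Q R D (K ** C) = J K"
proof -
  have "x \<bullet> (Q *v x) + (- ((K ** C) *v x)) \<bullet> (R *v (- ((K ** C) *v x)))
      = x \<bullet> ((Q + transpose C ** transpose K ** R ** K ** C) *v x)" for x
    using Qcl_quad[of x K] by (simp add: Qcl_def vec.neg matrix_vector_mul_assoc)
  then show ?thesis
    by (simp add: state_feedback_cost_def sof_cost_def closed_loop_def Let_def matrix_mul_assoc)
qed

text \<open>A left inverse of \<open>C\<close> writes each state gain \<open>Ks\<close> as
  \<open>(Ks ** C') ** C\<close>, so both problems range over the same closed loops with the same
  costs.\<close>

lemma lqr_opt_cost_eq:
  assumes C': "C' ** C = mat 1" and opt: "stab K" "\<And>K'. stab K' \<Longrightarrow> J K \<le> J K'"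
  shows "lqr_opt_cost A B Q R D = J K"
proof -
  have "{Ks. spec_radius (A - B ** Ks) < 1} = (\<lambda>K. K ** C) ` {K. stab K}"
  proof (intro equalityI subsetI)
    fix Ks assume "Ks \<in> {Ks. spec_radius (A - B ** Ks) < 1}"
    moreover have "Ks = (Ks ** C') ** C"
      using C' by (simp flip: matrix_mul_assoc)
    ultimately show "Ks \<in> (\<lambda>K. K ** C) ` {K. stab K}"
      by (intro image_eqI[of _ _ "Ks ** C'"]) (auto simp: closed_loop_def simp flip: matrix_mul_assoc)
  qed (auto simp: closed_loop_def matrix_mul_assoc)
  then have "lqr_opt_cost A B Q R D = Inf (J ` {K. stab K})"
    by (simp add: lqr_opt_cost_def image_image state_feedback_cost_eq)
  also have "\<dots> = J K"
    using opt by (intro cInf_eq_minimum) auto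
  finally show ?thesis .
qed

end

text \<open>The condition on \<open>\<alpha>\<close> is the floor that \<open>J_ge\<close> puts
  under every cost. It yields positivity of \<open>\<alpha>\<close> and \<open>L\<close> before any
  iterate is mentioned.\<close>

locale output_feedback_step = output_feedback A B C Q R D
  for A :: "real^'n^'n" and B :: "real^'m^'n" and C :: "real^'n^'d"
    and Q :: "real^'n^'n" and R :: "real^'m^'m" and D :: "(real^'n) measure" +
  fixes \<alpha> \<eta> :: real
  assumes rows: "independent_rows C"
    and \<alpha>: "sigma_min Q * sigma_min X\<^sub>0 \<le> \<alpha>"
    and \<eta>: "0 < \<eta>" "\<eta> \<le> sigma_min X\<^sub>0 * (sigma_min C)\<^sup>2 / smooth_const B C Q R (sigma_min X\<^sub>0) \<alpha>"
begin

abbreviation \<mu> where "\<mu> \<equiv> sigma_min X\<^sub>0"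
abbreviation \<sigma> where "\<sigma> \<equiv> sigma_min C"
abbreviation L where "L \<equiv> smooth_const B C Q R \<mu> \<alpha>"
abbreviation N where "N \<equiv> natural_gradient A B C Q R D"
abbreviation W where "W \<equiv> op_norm R + \<alpha> / \<mu> * (op_norm B)\<^sup>2"

section \<open>Consequences of the step size bound\<close>

lemma \<alpha>_pos: "0 < \<alpha>"
  using \<alpha> mult_pos_pos[OF sQ_pos mu_pos] by linarith

lemma op_norm_R_pos: "0 < op_norm R"
proof -
  define y :: "real^'m" where "y = axis undefined 1"
  have "y \<bullet> y = 1"
    by (simp add: y_def inner_axis_axis)
  then show ?thesis
    using sigma_min_posdef(1)[OF R] sigma_min_posdef(2)[OF R, of y] op_norm_quad[of y R] by simp
qed

lemma W_pos: "0 < W"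
  using op_norm_R_pos \<alpha>_pos mu_pos by (intro add_pos_nonneg) auto

text \<open>\<open>W\<close> bounds the form of \<open>R + B^T P B\<close> on the sublevel set; this
  is what remains of \<open>L\<close> after discarding its nonnegative \<open>zeta1\<close>
  term.\<close>

lemma L_ge: "2 * \<alpha> / sigma_min Q * (W * (op_norm C)\<^sup>2) \<le> L"
proof -
  have "0 \<le> \<alpha> / \<mu>" "0 \<le> 2 * \<alpha> / sigma_min Q"
    using \<alpha>_pos mu_pos sQ_pos by simp_all
  then have "0 \<le> 2 * (op_norm B * op_norm C) * (zeta1 B C Q R \<mu> \<alpha> * (\<alpha> / \<mu>))"
    using zeta1_nonneg[OF \<alpha>] by (intro mult_nonneg_nonneg op_norm_nonneg) auto
  with \<open>0 \<le> 2 * \<alpha> / sigma_min Q\<close> show ?thesis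
    unfolding smooth_const_eq by (intro mult_left_mono) auto
qed

lemma op_norm_C_pos: "0 < op_norm C"
  using sigma_min_wide[OF rows] by simp

lemma L_pos: "0 < L"
proof -
  have "0 < 2 * \<alpha> / sigma_min Q * (W * (op_norm C)\<^sup>2)"
    using \<alpha>_pos sQ_pos W_pos op_norm_C_pos by (intro mult_pos_pos divide_pos_pos) auto
  then show ?thesis
    using L_ge by linarith
qed

lemma \<eta>_L: "\<eta> * L \<le> \<mu> * \<sigma>\<^sup>2"
  using \<eta> L_pos by (simp add: pos_le_divide_eq)

text \<open>In the step size bound \<open>sigma_min C \<le> op_norm C\<close> and
  \<open>\<mu> \<le> \<alpha> / sigma_min Q\<close> cancel everything in \<open>L\<close> but
  \<open>2 * W\<close>. Thus a step chosen for smoothness also controls the quadratic term of the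
  exact cost difference.\<close>

lemma \<eta>_W: "2 * \<eta> * W \<le> 1"
proof -
  have "\<eta> * (2 * \<alpha> / sigma_min Q * (W * (op_norm C)\<^sup>2)) \<le> \<eta> * L"
    using L_ge \<eta> by (intro mult_left_mono) auto
  also have "\<dots> \<le> \<mu> * \<sigma>\<^sup>2"
    by (rule \<eta>_L)
  also have "\<dots> \<le> \<mu> * (op_norm C)\<^sup>2"
    using mu_pos sigma_min_wide[OF rows] by (intro mult_left_mono power_mono) auto
  finally have "(2 * \<eta> * W * (\<alpha> / sigma_min Q)) * (op_norm C)\<^sup>2 \<le> \<mu> * (op_norm C)\<^sup>2"
    by (simp add: mult_ac)
  then have "2 * \<eta> * W * (\<alpha> / sigma_min Q) \<le> \<mu>"
    by (rule mult_right_le_imp_le) (use op_norm_C_pos in simp)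
  also have "\<mu> \<le> 1 * (\<alpha> / sigma_min Q)"
    using \<alpha> sQ_pos by (simp add: pos_le_divide_eq mult.commute)
  finally show ?thesis
    using \<alpha>_pos sQ_pos by (simp add: divide_le_cancel)
qed

section \<open>Output correlation and a single natural gradient step\<close>

lemma output_corr_ge:
  assumes "stab K"
  shows "\<mu> * \<sigma>\<^sup>2 * (y \<bullet> y) \<le> y \<bullet> (output_corr A B C D K *v y)"
proof -
  let ?w = "transpose C *v y"
  have "y \<bullet> (output_corr A B C D K *v y) = ?w \<bullet> (\<Sigma> K *v ?w)"
    using quad_mult[of y "transpose C" "\<Sigma> K ** transpose C" y]
    by (simp add: output_corr_def state_corr_eq[OF assms] matrix_mul_assoc[symmetric])
      (simp add: matrix_vector_mul_assoc[symmetric])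
  then have "\<mu> * (norm ?w)\<^sup>2 \<le> y \<bullet> (output_corr A B C D K *v y)"
    using \<Sigma>_vec_ge[OF assms, of ?w] by (simp add: power2_norm_eq_inner)
  moreover have "\<mu> * (\<sigma>\<^sup>2 * (y \<bullet> y)) \<le> \<mu> * (norm ?w)\<^sup>2"
    using mu_pos sigma_min_transpose_lower by (intro mult_left_mono) auto
  ultimately show ?thesis
    by (simp add: mult.assoc)
qed

lemma output_corr_inverse:
  assumes "stab K"
  shows "matrix_inv (output_corr A B C D K) ** output_corr A B C D K = mat 1"
    and "output_corr A B C D K ** matrix_inv (output_corr A B C D K) = mat 1"
proof -
  have "0 < y \<bullet> (output_corr A B C D K *v y)" if "y \<noteq> 0" for y
  proof -
    have "0 < \<mu> * \<sigma>\<^sup>2 * (y \<bullet> y)"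
      using that mu_pos sigma_min_wide(1)[OF rows] by simp
    then show ?thesis
      using output_corr_ge[OF assms, of y] by linarith
  qed
  from posdef_imp_inverse[OF this] show
    "matrix_inv (output_corr A B C D K) ** output_corr A B C D K = mat 1"
    "output_corr A B C D K ** matrix_inv (output_corr A B C D K) = mat 1"
    by auto
qed

text \<open>The gradient is the natural gradient times the output correlation, so the pairing is the
  quadratic form of the latter summed over the rows of \<open>N K\<close>.\<close>

lemma N_inner_grad:
  assumes "stab K"
  shows "\<mu> * \<sigma>\<^sup>2 * (norm (N K))\<^sup>2 \<le> N K \<bullet> grad K"
proof -
  let ?Y = "output_corr A B C D K"
  have "N K ** ?Y = grad K"
    by (simp add: natural_gradient_def gradient_J[OF assms] output_corr_inverse[OF assms]
        flip: matrix_mul_assoc)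
  then have "N K \<bullet> grad K = N K \<bullet> (N K ** ?Y)"
    by simp
  also have "\<dots> = (\<Sum>i\<in>UNIV. N K $ i \<bullet> (transpose ?Y *v N K $ i))"
    by (simp only: inner_vec_def[of "N K"] row_matrix_mult)
  also have "\<dots> = (\<Sum>i\<in>UNIV. N K $ i \<bullet> (?Y *v N K $ i))"
    by (simp only: quad_transpose)
  also have "\<dots> \<ge> (\<Sum>i\<in>UNIV. \<mu> * \<sigma>\<^sup>2 * (N K $ i \<bullet> N K $ i))"
    by (intro sum_mono output_corr_ge assms)
  finally show ?thesis
    by (simp add: norm_matrix_sq sum_distrib_left)
qed

lemma natural_gradient_step:
  assumes K: "stab K" "J K \<le> \<alpha>"
  shows "stab (K - \<eta> *\<^sub>R N K)"
    and "J (K - \<eta> *\<^sub>R N K) \<le> J K - \<eta> * \<mu> * \<sigma>\<^sup>2 / 2 * (norm (N K))\<^sup>2"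
proof -
  have "stab (K - \<eta> *\<^sub>R N K) \<and> J (K - \<eta> *\<^sub>R N K) \<le> J K - \<eta> * \<mu> * \<sigma>\<^sup>2 / 2 * (norm (N K))\<^sup>2"
  proof (cases "N K = 0")
    \<comment> \<open>Treated apart because the descent along the segment requires a strictly
      negative initial slope.\<close>
    case True
    with K show ?thesis by simp
  next
    case False
    define E where "E = - \<eta> *\<^sub>R N K"
    obtain \<delta> where \<delta>: "0 < \<delta>" "\<And>K K'. stab K \<Longrightarrow> J K \<le> \<alpha> \<Longrightarrow> norm (K' - K) < \<delta> \<Longrightarrow> stab K'"
      using stab_neighbourhood[of \<alpha>] by metis
    define c where "c = L * (norm E)\<^sup>2"
    have "((\<lambda>s. J (K + s *\<^sub>R E)) has_derivative (\<lambda>h. (h *\<^sub>R E) \<bullet> grad K)) (at 0)"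
    proof (rule has_derivative_compose[of "\<lambda>s. K + s *\<^sub>R E"])
      show "((\<lambda>s. K + s *\<^sub>R E) has_derivative (\<lambda>h. h *\<^sub>R E)) (at 0)"
        by (auto intro!: derivative_eq_intros)
      show "(J has_derivative (\<lambda>H. H \<bullet> grad K)) (at (K + 0 *\<^sub>R E))"
        using GDERIV_J[OF K(1)] by (simp add: gderiv_def)
    qed
    then have "((\<lambda>s. J (K + s *\<^sub>R E)) has_real_derivative E \<bullet> grad K) (at 0)"
      by (simp add: has_field_derivative_def mult_commute_abs)
    \<comment> \<open>The derivative at \<open>0\<close> is known in two forms, through
      \<open>P'\<close> and through the gradient; uniqueness identifies them.\<close>
    then have slope: "X\<^sub>0 \<bullet> P' E (K + 0 *\<^sub>R E) = E \<bullet> grad K"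
      using J_line[of K 0 E] K(1) DERIV_unique by fastforce
    have E_grad: "E \<bullet> grad K \<le> - (\<eta> * (\<mu> * \<sigma>\<^sup>2 * (norm (N K))\<^sup>2))"
      using N_inner_grad[OF K(1)] \<eta>(1) by (simp add: E_def)
    \<comment> \<open>The step size bound makes the curvature at most the guaranteed first-order
      decrease. It enters Taylor's formula with the factor \<open>1/2\<close>, so half of the
      decrease survives.\<close>
    have c_le: "c \<le> \<eta> * (\<mu> * \<sigma>\<^sup>2 * (norm (N K))\<^sup>2)"
    proof -
      have "c = \<eta> * L * (\<eta> * (norm (N K))\<^sup>2)"
        using \<eta>(1) by (simp add: c_def E_def power_mult_distrib power2_eq_square mult_ac)
      also have "\<dots> \<le> \<mu> * \<sigma>\<^sup>2 * (\<eta> * (norm (N K))\<^sup>2)"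
        using \<eta>_L \<eta>(1) by (intro mult_right_mono) auto
      finally show ?thesis
        by (simp add: mult_ac)
    qed
    have pos: "0 < \<eta> * (\<mu> * \<sigma>\<^sup>2 * (norm (N K))\<^sup>2)"
      using \<eta>(1) mu_pos sigma_min_wide(1)[OF rows] False by (intro mult_pos_pos) auto
    have "1 \<in> {t. stab (K + t *\<^sub>R E)} \<and>
        J (K + 1 *\<^sub>R E) \<le> J (K + 0 *\<^sub>R E) + X\<^sub>0 \<bullet> P' E (K + 0 *\<^sub>R E) + c / 2"
    proof (rule descent_on_segment[where \<phi> = "\<lambda>t. J (K + t *\<^sub>R E)" and \<alpha> = \<alpha>
          and \<phi>' = "\<lambda>t. X\<^sub>0 \<bullet> P' E (K + t *\<^sub>R E)" and \<phi>'' = "\<lambda>t. J'' E (K + t *\<^sub>R E)"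
          and \<delta> = "\<delta> / norm E"])
      have "0 < norm E"
        using False \<eta>(1) by (simp add: E_def)
      then show "0 < \<delta> / norm E"
        using \<delta>(1) by simp
      fix t s :: real
      assume t: "t \<in> {t. stab (K + t *\<^sub>R E)}" "J (K + t *\<^sub>R E) \<le> \<alpha>" "\<bar>s - t\<bar> < \<delta> / norm E"
      have "norm (K + s *\<^sub>R E - (K + t *\<^sub>R E)) = \<bar>s - t\<bar> * norm E"
        by (simp flip: scaleR_diff_left)
      also have "\<dots> < \<delta>"
        using t(3) \<open>0 < norm E\<close> by (simp add: pos_less_divide_eq)
      finally show "s \<in> {t. stab (K + t *\<^sub>R E)}"
        using \<delta>(2)[of "K + t *\<^sub>R E"] t by blast
    next
      show "0 \<le> c"
        using L_pos by (simp add: c_def)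
      show "X\<^sub>0 \<bullet> P' E (K + 0 *\<^sub>R E) < 0"
        using slope E_grad pos by linarith
      show "X\<^sub>0 \<bullet> P' E (K + 0 *\<^sub>R E) + c / 2 \<le> 0"
        using slope E_grad c_le pos by linarith
    next
      fix t assume "t \<in> {t. stab (K + t *\<^sub>R E)}"
      then have t: "stab (K + t *\<^sub>R E)"
        by simp
      show "((\<lambda>t. J (K + t *\<^sub>R E)) has_real_derivative X\<^sub>0 \<bullet> P' E (K + t *\<^sub>R E)) (at t)"
        by (rule J_line[OF t])
      show "((\<lambda>t. X\<^sub>0 \<bullet> P' E (K + t *\<^sub>R E)) has_real_derivative J'' E (K + t *\<^sub>R E)) (at t)"
        by (rule J_line2[OF t])
      show "J'' E (K + t *\<^sub>R E) \<le> c" if "J (K + t *\<^sub>R E) \<le> \<alpha>"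
        unfolding c_def by (rule J''_bound[OF t that])
    qed (use K in simp_all)
    then have *: "stab (K + E)" "J (K + E) \<le> J K + E \<bullet> grad K + c / 2"
      using slope by simp_all
    have "K + E = K - \<eta> *\<^sub>R N K"
      by (simp add: E_def)
    moreover have "J (K + E) \<le> J K - \<eta> * (\<mu> * \<sigma>\<^sup>2 * (norm (N K))\<^sup>2) / 2"
      using *(2) E_grad c_le by linarith
    ultimately show ?thesis
      using *(1) by (simp add: mult.assoc)
  qed
  then show "stab (K - \<eta> *\<^sub>R N K)"
    "J (K - \<eta> *\<^sub>R N K) \<le> J K - \<eta> * \<mu> * \<sigma>\<^sup>2 / 2 * (norm (N K))\<^sup>2"
    by auto
qed

text \<open>Sandwiching the identity \<open>?Y ** matrix_inv ?Y = mat 1\<close> between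
  \<open>C'\<close> and \<open>C\<close> shows that all factors of \<open>grad\<close> after
  \<open>EK K\<close> cancel.\<close>

lemma natural_gradient_state_feedback:
  assumes "stab K" "C' ** C = mat 1"
  shows "N K ** C = 2 *\<^sub>R EK K"
proof -
  let ?Y = "output_corr A B C D K"
  have "C' ** (?Y ** matrix_inv ?Y) ** C = (C' ** C) ** (\<Sigma> K ** transpose C ** matrix_inv ?Y ** C)"
    by (simp add: output_corr_def state_corr_eq[OF assms(1)] matrix_mul_assoc)
  then have "\<Sigma> K ** transpose C ** matrix_inv ?Y ** C = mat 1"
    by (simp add: output_corr_inverse[OF assms(1)] assms(2))
  then have "(2 *\<^sub>R EK K) ** (\<Sigma> K ** transpose C ** matrix_inv ?Y ** C) = 2 *\<^sub>R EK K"
    by simp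
  then show ?thesis
    by (simp add: natural_gradient_def gradient_J[OF assms(1)] grad_def matrix_mul_assoc
        matrix_mult.scaleR_left)
qed

text \<open>With \<open>f = - 2 \<eta> e\<close> the linear part of the advantage is
  \<open>- 4 \<eta> (e \<bullet> e)\<close>, and by \<open>2 * \<eta> * W \<le> 1\<close> the
  quadratic part gives back at most half of it. The rest is integrated against
  \<open>\<Sigma> \<ge> \<mu>\<close>.\<close>

lemma full_rank_step:
  assumes K: "stab K" "J K \<le> \<alpha>" and C': "C' ** C = mat 1"
  shows "J (K - \<eta> *\<^sub>R N K) \<le> J K - 2 * \<eta> * \<mu> * (norm (EK K))\<^sup>2"
proof -
  let ?K = "K - \<eta> *\<^sub>R N K"
  have st: "stab ?K"
    by (rule natural_gradient_step(1)[OF K])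
  have "\<Sigma> ?K \<bullet> cost_gap K ?K \<le> \<Sigma> ?K \<bullet> ((- (2 * \<eta>)) *\<^sub>R (transpose (EK K) ** EK K))"
  proof (rule \<Sigma>_mono[OF st])
    fix x
    define e where "e = EK K *v x"
    have f: "(- (2 * \<eta>)) *\<^sub>R e = (?K - K) *v (C *v x)"
    proof -
      have "N K *v (C *v x) = (2 *\<^sub>R EK K) *v x"
        by (simp only: matrix_vector_mul_assoc natural_gradient_state_feedback[OF K(1) C'])
      then show ?thesis
        by (simp add: e_def neg_matrix_vec scaleR_matrix_vec)
    qed
    have "e \<bullet> (R *v e) \<le> op_norm R * (e \<bullet> e)"
      by (rule op_norm_quad)
    moreover have "(B *v e) \<bullet> (P K *v (B *v e)) \<le> \<alpha> / \<mu> * (op_norm B)\<^sup>2 * (e \<bullet> e)"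
    proof -
      have "norm (B *v e) \<le> op_norm B * norm e"
        by (rule norm_op_norm)
      then have "(B *v e) \<bullet> (B *v e) \<le> (op_norm B * norm e)\<^sup>2"
        by (simp add: power_mono flip: power2_norm_eq_inner)
      then have "\<alpha> / \<mu> * ((B *v e) \<bullet> (B *v e)) \<le> \<alpha> / \<mu> * (op_norm B * norm e)\<^sup>2"
        using \<alpha>_pos mu_pos by (intro mult_left_mono) auto
      moreover have "J K / \<mu> * ((B *v e) \<bullet> (B *v e)) \<le> \<alpha> / \<mu> * ((B *v e) \<bullet> (B *v e))"
        using K(2) mu_pos by (intro mult_right_mono divide_right_mono) auto
      ultimately show ?thesis
        using P_le[OF K(1), of "B *v e"] by (simp add: power_mult_distrib power2_norm_eq_inner)
    qed
    ultimately have "e \<bullet> (R *v e) + (B *v e) \<bullet> (P K *v (B *v e)) \<le> W * (e \<bullet> e)"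
      by (simp add: distrib_right)
    then have "4 * \<eta>\<^sup>2 * (e \<bullet> (R *v e) + (B *v e) \<bullet> (P K *v (B *v e))) \<le> 4 * \<eta>\<^sup>2 * (W * (e \<bullet> e))"
      by (intro mult_left_mono) auto
    also have "\<dots> = 2 * \<eta> * (e \<bullet> e) * (2 * \<eta> * W)"
      by (simp add: power2_eq_square mult_ac)
    also have "\<dots> \<le> 2 * \<eta> * (e \<bullet> e) * 1"
      using \<eta>_W \<eta>(1) by (intro mult_left_mono) auto
    finally have "4 * \<eta>\<^sup>2 * (e \<bullet> (R *v e) + (B *v e) \<bullet> (P K *v (B *v e))) \<le> 2 * \<eta> * (e \<bullet> e)"
      by simp
    moreover have "x \<bullet> (cost_gap K ?K *v x)
        = - 4 * \<eta> * (e \<bullet> e) + 4 * \<eta>\<^sup>2 * (e \<bullet> (R *v e) + (B *v e) \<bullet> (P K *v (B *v e)))"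
      unfolding cost_gap_quad[OF K(1) f] e_def[symmetric]
      by (simp add: matrix_vector_mult_scaleR vec.neg power2_eq_square algebra_simps)
    ultimately show "x \<bullet> (cost_gap K ?K *v x) \<le> x \<bullet> (((- (2 * \<eta>)) *\<^sub>R (transpose (EK K) ** EK K)) *v x)"
      unfolding scaleR_matrix_vec inner_scaleR_right gram_quad_vec e_def[symmetric] by simp
  qed
  then have "J ?K - J K \<le> - (2 * \<eta>) * (\<Sigma> ?K \<bullet> (transpose (EK K) ** EK K))"
    using J_diff[OF K(1) st] by simp
  moreover have "\<mu> * (norm (EK K))\<^sup>2 \<le> \<Sigma> ?K \<bullet> (transpose (EK K) ** EK K)"
    unfolding gram_inner norm_matrix_sq sum_distrib_left by (intro sum_mono \<Sigma>_vec_ge st)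
  then have "2 * \<eta> * (\<mu> * (norm (EK K))\<^sup>2) \<le> 2 * \<eta> * (\<Sigma> ?K \<bullet> (transpose (EK K) ** EK K))"
    using \<eta>(1) by (intro mult_left_mono) auto
  ultimately show ?thesis
    by (simp add: mult.assoc)
qed

section \<open>Iterates: stationarity and rate of convergence\<close>

context
  fixes K :: "nat \<Rightarrow> real^'d^'m"
  assumes init: "stab (K 0)" "J (K 0) = \<alpha>"
    and step: "\<And>i. K (Suc i) = K i - \<eta> *\<^sub>R N (K i)"
begin

lemma iterates: "stab (K i) \<and> J (K i) \<le> \<alpha>"
proof (induction i)
  case (Suc i)
  then have "J (K (Suc i)) \<le> J (K i) - \<eta> * \<mu> * \<sigma>\<^sup>2 / 2 * (norm (N (K i)))\<^sup>2"
    unfolding step by (intro natural_gradient_step(2)) auto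
  moreover have "0 \<le> \<eta> * \<mu> * \<sigma>\<^sup>2 / 2 * (norm (N (K i)))\<^sup>2"
    using \<eta>(1) mu_pos by simp
  moreover have "stab (K (Suc i))"
    unfolding step using Suc by (intro natural_gradient_step(1)) auto
  ultimately show ?case
    using Suc by linarith
qed (use init in simp)

lemma iterates_decrease: "J (K (Suc i)) \<le> J (K i) - \<eta> * \<mu> * \<sigma>\<^sup>2 / 2 * (norm (N (K i)))\<^sup>2"
  unfolding step using iterates by (intro natural_gradient_step(2)) auto

lemma iterates_mono: "J (K (Suc i)) \<le> J (K i)"
proof -
  have "0 \<le> \<eta> * \<mu> * \<sigma>\<^sup>2 / 2 * (norm (N (K i)))\<^sup>2"
    using \<eta>(1) mu_pos by simp
  then show ?thesis
    using iterates_decrease[of i] by linarith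
qed

lemma stationary_iterate:
  assumes "0 < \<epsilon>"
  shows "\<exists>i. real i \<le> 2 * \<alpha> / (\<eta> * \<mu> * \<sigma>\<^sup>2 * \<epsilon>\<^sup>2) \<and> norm (N (K i)) \<le> \<epsilon>"
proof (rule ccontr)
  assume none: "\<not> ?thesis"
  define a where "a = \<eta> * \<mu> * \<sigma>\<^sup>2 / 2"
  define T where "T = \<alpha> / (a * \<epsilon>\<^sup>2)"
  have a: "0 < a"
    using \<eta>(1) mu_pos sigma_min_wide(1)[OF rows] by (simp add: a_def)
  have T: "T = 2 * \<alpha> / (\<eta> * \<mu> * \<sigma>\<^sup>2 * \<epsilon>\<^sup>2)"
    by (simp add: T_def a_def)
  have "0 \<le> T"
    using \<alpha>_pos a by (simp add: T_def)
  \<comment> \<open>The range extends to \<open>T + 1\<close> because the decrease from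
    \<open>i\<close> to \<open>i + 1\<close> only needs the iterate \<open>i\<close>, with
    \<open>i \<le> T\<close>, to be non-stationary.\<close>
  have "J (K i) \<le> \<alpha> - real i * (a * \<epsilon>\<^sup>2)" if "real i \<le> T + 1" for i
    using that
  proof (induction i)
    case (Suc i)
    then have "norm (N (K i)) > \<epsilon>"
      using none T by auto
    then have "a * \<epsilon>\<^sup>2 \<le> a * (norm (N (K i)))\<^sup>2"
      using a assms by (intro mult_left_mono power_mono) auto
    moreover have "J (K i) \<le> \<alpha> - real i * (a * \<epsilon>\<^sup>2)"
      using Suc by simp
    ultimately show ?case
      using iterates_decrease[of i] by (simp add: a_def[symmetric] distrib_right)
  qed (use init in simp)
  \<comment> \<open>The first index beyond \<open>T\<close>: the accumulated decrease exceeds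
    \<open>\<alpha>\<close> there and would make the cost negative.\<close>
  moreover define i where "i = Suc (nat \<lfloor>T\<rfloor>)"
  have "real i \<le> T + 1" "T < real i"
    using \<open>0 \<le> T\<close> unfolding i_def by linarith+
  moreover have "\<alpha> = T * (a * \<epsilon>\<^sup>2)"
    using a assms by (simp add: T_def)
  then have "\<alpha> < real i * (a * \<epsilon>\<^sup>2)"
    using \<open>T < real i\<close> a assms by simp
  ultimately have "J (K i) < 0"
    by fastforce
  then show False
    using J_pos[of "K i"] iterates[of i] by simp
qed

lemma full_rank_rate:
  assumes C': "C' ** C = mat 1" and opt: "stab Ks" "\<And>K'. stab K' \<Longrightarrow> J Ks \<le> J K'"
    and "0 < \<epsilon>"
    and n: "real n \<ge> op_norm (\<Sigma> Ks) / (2 * \<eta> * \<mu> * sigma_min R) * ln ((J (K 0) - J Ks) / \<epsilon>)"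
  shows "J (K n) - J Ks \<le> \<epsilon>"
proof -
  define s where "s = sigma_min R"
  define S where "S = op_norm (\<Sigma> Ks)"
  \<comment> \<open>The ratio of the decrease per step to the domination constant;
    \<open>1 / r\<close> is the factor in front of the logarithm.\<close>
  define r where "r = 2 * \<eta> * \<mu> * s / S"
  have "0 < S"
  proof -
    define y :: "real^'n" where "y = axis undefined 1"
    have "y \<bullet> y = 1"
      by (simp add: y_def inner_axis_axis)
    then show ?thesis
      using \<Sigma>_vec_ge[OF opt(1), of y] op_norm_quad[of y "\<Sigma> Ks"] mu_pos by (simp add: S_def)
  qed
  have s: "0 < s"
    unfolding s_def by (rule sigma_min_posdef(1)[OF R])
  have r: "0 < r"
    using \<eta>(1) mu_pos s \<open>0 < S\<close> by (simp add: r_def)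
  have gap: "0 \<le> J (K i) - J Ks" for i
    using opt(2) iterates by simp
  have contr: "J (K (Suc i)) - J Ks \<le> exp (- r) * (J (K i) - J Ks)" for i
  proof -
    have "J (K i) - J Ks \<le> S / s * (norm (EK (K i)))\<^sup>2"
      unfolding S_def s_def using iterates opt(1) by (intro gradient_domination) auto
    then have "r * (J (K i) - J Ks) \<le> r * (S / s * (norm (EK (K i)))\<^sup>2)"
      using r by (intro mult_left_mono) auto
    also have "\<dots> = 2 * \<eta> * \<mu> * (norm (EK (K i)))\<^sup>2"
      using s \<open>0 < S\<close> by (simp add: r_def)
    finally have "J (K (Suc i)) - J Ks \<le> (1 - r) * (J (K i) - J Ks)"
      using full_rank_step[of "K i", OF _ _ C'] iterates[of i] unfolding step by (simp add: algebra_simps)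
    \<comment> \<open>Passing from \<open>1 - r\<close> to \<open>exp (- r)\<close> keeps the factor
      positive, so the bound can be iterated by monotonicity.\<close>
    also have "\<dots> \<le> exp (- r) * (J (K i) - J Ks)"
      using exp_ge_add_one_self[of "- r"] gap by (intro mult_right_mono) auto
    finally show ?thesis .
  qed
  have decay: "J (K i) - J Ks \<le> exp (- r * real i) * (J (K 0) - J Ks)" for i
  proof (induction i)
    case (Suc i)
    have "J (K (Suc i)) - J Ks \<le> exp (- r) * (J (K i) - J Ks)"
      by (rule contr)
    also have "\<dots> \<le> exp (- r) * (exp (- r * real i) * (J (K 0) - J Ks))"
      using Suc by (intro mult_left_mono) auto
    also have "\<dots> = exp (- r * real (Suc i)) * (J (K 0) - J Ks)"
      by (simp add: algebra_simps flip: exp_add mult.assoc)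
    finally show ?case .
  qed simp
  show ?thesis
  \<comment> \<open>The logarithm of the initial gap is meaningful only if the gap is positive; with
    gap \<open>0\<close> the decay bound finishes directly.\<close>
  proof (cases "J (K 0) - J Ks = 0")
    case True
    then show ?thesis
      using decay[of n] \<open>0 < \<epsilon>\<close> by simp
  next
    case False
    then have pos: "0 < J (K 0) - J Ks"
      using gap[of 0] by simp
    have "(1 / r) * ln ((J (K 0) - J Ks) / \<epsilon>) \<le> real n"
      using n by (simp add: r_def S_def s_def)
    then have "ln ((J (K 0) - J Ks) / \<epsilon>) \<le> r * real n"
      using r by (simp add: field_simps)
    then have "(J (K 0) - J Ks) / \<epsilon> \<le> exp (r * real n)"
      using pos \<open>0 < \<epsilon>\<close> by (metis divide_pos_pos exp_le_cancel_iff exp_ln)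
    then have "exp (- r * real n) * (J (K 0) - J Ks) \<le> \<epsilon>"
      using \<open>0 < \<epsilon>\<close> by (simp add: exp_minus field_simps)
    then show ?thesis
      using decay[of n] by simp
  qed
qed

end

end

theorem theorem3:
  fixes A :: "real^'n^'n" and B :: "real^'m^'n" and C :: "real^'n^'d"
    and Q :: "real^'n^'n" and R :: "real^'m^'m"
    and D :: "(real^'n) measure"
    and K :: "nat \<Rightarrow> real^'d^'m" and \<mu> \<alpha> \<eta> :: real
  assumes "controllable A B" and "observable C A" and "independent_rows C"
    and "sym_posdef Q" and "sym_posdef R"
    and "prob_space D" and "sets D = sets borel"
    and "sym_posdef (init_corr D)"
    and "\<mu> = sigma_min (init_corr D)"
    and "K 0 \<in> stabilizing A B C"
    and "sof_cost A B C Q R D (K 0) = \<alpha>"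
    and "0 < \<eta>" and "\<eta> \<le> \<mu> * (sigma_min C)\<^sup>2 / smooth_const B C Q R \<mu> \<alpha>"
    and "\<And>i. K (Suc i) = K i - \<eta> *\<^sub>R natural_gradient A B C Q R D (K i)"
  shows "(\<forall>i. sof_cost A B C Q R D (K (Suc i)) \<le> sof_cost A B C Q R D (K i)
            \<and> K i \<in> sublevel A B C Q R D \<alpha>)
       \<and> (\<forall>\<epsilon>>0. \<exists>i. real i \<le> 2 * \<alpha> / (\<eta> * \<mu> * (sigma_min C)\<^sup>2 * \<epsilon>\<^sup>2)
            \<and> norm (natural_gradient A B C Q R D (K i)) \<le> \<epsilon>)
       \<and> (CARD('d) = CARD('n) \<and> rank C = CARD('n) \<longrightarrow>
            (\<forall>Kstar. is_arg_min (sof_cost A B C Q R D) (\<lambda>K'. K' \<in> stabilizing A B C) Kstar \<longrightarrow>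
              (\<forall>\<epsilon>\<^sub>J>0. \<forall>N::nat.
                 real N \<ge> op_norm (state_corr A B C D Kstar) / (2 * \<eta> * \<mu> * sigma_min R)
                           * ln ((sof_cost A B C Q R D (K 0) - lqr_opt_cost A B Q R D) / \<epsilon>\<^sub>J)
                 \<longrightarrow> sof_cost A B C Q R D (K N) - lqr_opt_cost A B Q R D \<le> \<epsilon>\<^sub>J)))"
proof -
  interpret output_feedback A B C Q R D
    by unfold_locales fact+
  have init: "stab (K 0)"
    using assms(10) by (simp add: stabilizing_iff)
  \<comment> \<open>The floor required of \<open>\<alpha>\<close> holds because
    \<open>\<alpha>\<close> is the cost of the stabilizing gain \<open>K 0\<close>.\<close>
  interpret output_feedback_step A B C Q R D \<alpha> \<eta>
    using assms J_ge[OF init] by unfold_locales simp_all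
  note run = init assms(11) assms(14)
  show ?thesis
  proof (intro conjI allI impI)
    fix i
    show "J (K (Suc i)) \<le> J (K i)"
      by (rule iterates_mono[OF run])
    show "K i \<in> sublevel A B C Q R D \<alpha>"
      using iterates[OF run, of i] by (simp add: sublevel_def stabilizing_iff)
  next
    fix \<epsilon> :: real assume "0 < \<epsilon>"
    then show "\<exists>i. real i \<le> 2 * \<alpha> / (\<eta> * \<mu> * (sigma_min C)\<^sup>2 * \<epsilon>\<^sup>2)
        \<and> norm (natural_gradient A B C Q R D (K i)) \<le> \<epsilon>"
      unfolding assms(9) by (rule stationary_iterate[OF run])
  next
    fix Kstar and \<epsilon>\<^sub>J :: real and n :: nat
    assume "CARD('d) = CARD('n) \<and> rank C = CARD('n)"
      and arg_min: "is_arg_min J (\<lambda>K'. K' \<in> stabilizing A B C) Kstar" and "0 < \<epsilon>\<^sub>J"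
      and n: "op_norm (state_corr A B C D Kstar) / (2 * \<eta> * \<mu> * sigma_min R)
               * ln ((J (K 0) - lqr_opt_cost A B Q R D) / \<epsilon>\<^sub>J) \<le> real n"
    then have "inj ((*v) C)"
      by (simp add: full_rank_injective)
    then obtain C' where C': "C' ** C = mat 1"
      using matrix_left_invertible_injective[of C] by (auto simp: inj_def)
    have opt: "stab Kstar"
      using arg_min by (simp add: is_arg_min_def stabilizing_iff)
    have opt': "J Kstar \<le> J K'" if "stab K'" for K'
      using arg_min that unfolding is_arg_min_def stabilizing_iff by (meson not_less)
    \<comment> \<open>The output feedback minimiser attains the full-state optimum, so the gap to
      \<open>J Kstar\<close> is the gap to the LQR cost and \<open>\<Sigma> Kstar\<close> is the
      weight in the domination inequality.\<close>
    have lqr: "lqr_opt_cost A B Q R D = J Kstar"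
      by (rule lqr_opt_cost_eq[OF C' opt opt'])
    show "J (K n) - lqr_opt_cost A B Q R D \<le> \<epsilon>\<^sub>J"
      using full_rank_rate[OF run C' opt opt' \<open>0 < \<epsilon>\<^sub>J\<close>, of n] n
      unfolding lqr assms(9) by (simp add: state_corr_eq[OF opt])
  qed
qed

end
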